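(* Let $\mathbb{K}$ be $\mathbb{R}$ or $\mathbb{C}$. The C*-algebra $C([0,1];\mathbb{K})$ of continuous $\mathbb{K}$-valued functions on $[0,1]$ is not computably categorical as a C*-algebra over $\mathbb{K}$.
   Context: A C*-algebra over $\mathbb{K}\in\{\mathbb{R},\mathbb{C}\}$ is a Banach *-algebra over $\mathbb{K}$ (not necessarily unital) that is isometrically *-isomorphic to a norm-closed *-subalgebra of the bounded operators on a Hilbert space over $\mathbb{K}$. *-homomorphisms are $\mathbb{K}$-linear. $C([0,1];\mathbb{K})$ carries the sup norm, pointwise operations, and pointwise conjugation as involution. A presentation $A^\dagger=(A,\overline{a})$ of a separable C*-algebra $A$ over $\mathbb{K}$ consists of $A$ and a countable (finite or infinite) sequence $\overline{a}$ of elements (the special points) generating $A$ as a C*-algebra over $\mathbb{K}$. A polynomial is rational if its coefficients lie in $\mathbb{Q}$ (when $\mathbb{K}=\mathbb{R}$) or $\mathbb{Q}(i)$ (when $\mathbb{K}=\mathbb{C}$). A rational point of $A^\dagger$ is an element $p(a_{i_1},\ldots,a_{i_n})$ with $p$ a rational noncommutative *-polynomial with no constant term (as input to an algorithm it is given by $p$ and the indices). $A^\dagger$ is computable if there is an effective procedure which, given a rational point $r$ and $k\in\mathbb{N}$, returns $q\in\mathbb{Q}$ with $|\|r\|-q|<2^{-k}$. For computable presentations $A^\dagger$, $B^\dagger$ of $A$, $B$, a *-homomorphism $\varphi:A\to B$ is computable from $A^\dagger$ to $B^\dagger$ if there is an effective procedure which, given a rational point $r$ of $A^\dagger$ and $k\in\mathbb{N}$,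 returns a rational point $s$ of $B^\dagger$ with $\|\varphi(r)-s\|<2^{-k}$. A computable isomorphism is a bijective computable *-homomorphism. $A$ is computably categorical (as a C*-algebra over $\mathbb{K}$) if for all computable presentations $A^\dagger$, $A^+$ of $A$ there is a computable isomorphism from $A^\dagger$ to $A^+$. *)

theory Defs
  imports "HOL-Analysis.Analysis" "HOL-Library.Nat_Bijection" "HOL-Library.Extended_Nat"
begin

section \<open>Partial recursive functions\<close>

datatype recf =
    RZero
  | RSucc
  | RProj nat
  | RComp recf "recf list"
  | RPrim recf recf
  | RMin recf

text \<open>
  \<open>rec_eval f xs y\<close>: the program \<open>f\<close> halts on the argument list \<open>xs\<close> with output \<open>y\<close>.
  The recursion argument of \<open>RPrim\<close> and the search variable of \<open>RMin\<close> come first.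
\<close>

inductive rec_eval :: "recf \<Rightarrow> nat list \<Rightarrow> nat \<Rightarrow> bool" where
  zero: "rec_eval RZero xs 0"
| succ: "rec_eval RSucc (x # xs) (Suc x)"
| proj: "i < length xs \<Longrightarrow> rec_eval (RProj i) xs (xs ! i)"
| comp: "list_all2 (\<lambda>g y. rec_eval g xs y) gs ys \<Longrightarrow> rec_eval f ys z \<Longrightarrow>
    rec_eval (RComp f gs) xs z"
| prim_0: "rec_eval f xs y \<Longrightarrow> rec_eval (RPrim f g) (0 # xs) y"
| prim_Suc: "rec_eval (RPrim f g) (n # xs) y \<Longrightarrow> rec_eval g (n # y # xs) z \<Longrightarrow>
    rec_eval (RPrim f g) (Suc n # xs) z"
| minim: "rec_eval f (n # xs) 0 \<Longrightarrow> (\<forall>m<n. \<exists>y>0. rec_eval f (m # xs) y) \<Longrightarrow>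
    rec_eval (RMin f) xs n"


section \<open>Normed *-algebras over a subfield of the complex numbers\<close>

text \<open>
  The scalar field \<open>K\<close> is a set of complex numbers. Only \<open>K = \<real>\<close> and \<open>K = UNIV\<close> are
  intended, so that the real and the complex case are treated uniformly; complex
  conjugation is the identity on \<open>\<real>\<close>. Structures have explicit carriers, and the operations
  are only meaningful on the carrier and for scalars in \<open>K\<close>.
\<close>

record 'v vect_space =
  points :: "'v set"
  vzero :: "'v"
  vadd :: "'v \<Rightarrow> 'v \<Rightarrow> 'v"
  vscale :: "complex \<Rightarrow> 'v \<Rightarrow> 'v"

record 'v ip_space = "'v vect_space" +
  ip :: "'v \<Rightarrow> 'v \<Rightarrow> complex"

record 'a star_alg = "'a vect_space" +
  amult :: "'a \<Rightarrow> 'a \<Rightarrow> 'a"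
  astar :: "'a \<Rightarrow> 'a"
  anorm :: "'a \<Rightarrow> real"

definition vminus :: "('v, 'b) vect_space_scheme \<Rightarrow> 'v \<Rightarrow> 'v \<Rightarrow> 'v" where
  "vminus V x y = vadd V x (vscale V (-1) y)"

locale vect_space_over =
  fixes K :: "complex set" and V :: "('v, 'b) vect_space_scheme"
  assumes zero_closed: "vzero V \<in> points V"
    and add_closed: "\<lbrakk>x \<in> points V; y \<in> points V\<rbrakk> \<Longrightarrow> vadd V x y \<in> points V"
    and scale_closed: "\<lbrakk>c \<in> K; x \<in> points V\<rbrakk> \<Longrightarrow> vscale V c x \<in> points V"
    and add_assoc: "\<lbrakk>x \<in> points V; y \<in> points V; z \<in> points V\<rbrakk> \<Longrightarrow>
      vadd V (vadd V x y) z = vadd V x (vadd V y z)"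
    and add_commute: "\<lbrakk>x \<in> points V; y \<in> points V\<rbrakk> \<Longrightarrow> vadd V x y = vadd V y x"
    and add_zero: "x \<in> points V \<Longrightarrow> vadd V x (vzero V) = x"
    and add_inverse: "x \<in> points V \<Longrightarrow> \<exists>y\<in>points V. vadd V x y = vzero V"
    and scale_one: "x \<in> points V \<Longrightarrow> vscale V 1 x = x"
    and scale_scale: "\<lbrakk>c \<in> K; d \<in> K; x \<in> points V\<rbrakk> \<Longrightarrow>
      vscale V c (vscale V d x) = vscale V (c * d) x"
    and scale_add_right: "\<lbrakk>c \<in> K; x \<in> points V; y \<in> points V\<rbrakk> \<Longrightarrow>
      vscale V c (vadd V x y) = vadd V (vscale V c x) (vscale V c y)"
    and scale_add_left: "\<lbrakk>c \<in> K; d \<in> K; x \<in> points V\<rbrakk> \<Longrightarrow>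
      vscale V (c + d) x = vadd V (vscale V c x) (vscale V d x)"

text \<open>
  The value off the carrier is irrelevant, but \<^locale>\<open>Metric_space\<close> requires a distance that is
  nonnegative and symmetric on the whole type.
\<close>

definition adist :: "'a star_alg \<Rightarrow> 'a \<Rightarrow> 'a \<Rightarrow> real" where
  "adist A x y = (if x \<in> points A \<and> y \<in> points A then anorm A (vminus A x y) else 0)"

locale banach_star_algebra = vect_space_over K A
  for K :: "complex set" and A :: "'a star_alg" +
  assumes mult_closed: "\<lbrakk>x \<in> points A; y \<in> points A\<rbrakk> \<Longrightarrow> amult A x y \<in> points A"
    and mult_assoc: "\<lbrakk>x \<in> points A; y \<in> points A; z \<in> points A\<rbrakk> \<Longrightarrow>
      amult A (amult A x y) z = amult A x (amult A y z)"
    and mult_add_left: "\<lbrakk>x \<in> points A; y \<in> points A; z \<in> points A\<rbrakk> \<Longrightarrow>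
      amult A (vadd A x y) z = vadd A (amult A x z) (amult A y z)"
    and mult_add_right: "\<lbrakk>x \<in> points A; y \<in> points A; z \<in> points A\<rbrakk> \<Longrightarrow>
      amult A x (vadd A y z) = vadd A (amult A x y) (amult A x z)"
    and mult_scale_left: "\<lbrakk>c \<in> K; x \<in> points A; y \<in> points A\<rbrakk> \<Longrightarrow>
      amult A (vscale A c x) y = vscale A c (amult A x y)"
    and mult_scale_right: "\<lbrakk>c \<in> K; x \<in> points A; y \<in> points A\<rbrakk> \<Longrightarrow>
      amult A x (vscale A c y) = vscale A c (amult A x y)"
    and star_closed: "x \<in> points A \<Longrightarrow> astar A x \<in> points A"
    and star_add: "\<lbrakk>x \<in> points A; y \<in> points A\<rbrakk> \<Longrightarrow>
      astar A (vadd A x y) = vadd A (astar A x) (astar A y)"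
    and star_scale: "\<lbrakk>c \<in> K; x \<in> points A\<rbrakk> \<Longrightarrow>
      astar A (vscale A c x) = vscale A (cnj c) (astar A x)"
    and star_mult: "\<lbrakk>x \<in> points A; y \<in> points A\<rbrakk> \<Longrightarrow>
      astar A (amult A x y) = amult A (astar A y) (astar A x)"
    and star_star: "x \<in> points A \<Longrightarrow> astar A (astar A x) = x"
    and norm_nonneg: "x \<in> points A \<Longrightarrow> 0 \<le> anorm A x"
    and norm_eq_zero: "x \<in> points A \<Longrightarrow> anorm A x = 0 \<longleftrightarrow> x = vzero A"
    and norm_triangle: "\<lbrakk>x \<in> points A; y \<in> points A\<rbrakk> \<Longrightarrow>
      anorm A (vadd A x y) \<le> anorm A x + anorm A y"
    and norm_scale: "\<lbrakk>c \<in> K; x \<in> points A\<rbrakk> \<Longrightarrow> anorm A (vscale A c x) = cmod c * anorm A x"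
    and norm_mult: "\<lbrakk>x \<in> points A; y \<in> points A\<rbrakk> \<Longrightarrow>
      anorm A (amult A x y) \<le> anorm A x * anorm A y"
    and norm_star: "x \<in> points A \<Longrightarrow> anorm A (astar A x) = anorm A x"
    and complete: "Metric_space.mcomplete (points A) (adist A)"

definition closed_star_subalgebra :: "complex set \<Rightarrow> 'a star_alg \<Rightarrow> 'a set \<Rightarrow> bool" where
  "closed_star_subalgebra K A S \<longleftrightarrow>
     S \<subseteq> points A \<and> vzero A \<in> S \<and>
     (\<forall>x\<in>S. \<forall>y\<in>S. vadd A x y \<in> S \<and> amult A x y \<in> S) \<and>
     (\<forall>x\<in>S. astar A x \<in> S \<and> (\<forall>c\<in>K. vscale A c x \<in> S)) \<and>
     closedin (Metric_space.mtopology (points A) (adist A)) S"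

definition star_hom :: "complex set \<Rightarrow> 'a star_alg \<Rightarrow> 'b star_alg \<Rightarrow> ('a \<Rightarrow> 'b) \<Rightarrow> bool" where
  "star_hom K A B \<phi> \<longleftrightarrow>
     (\<forall>x\<in>points A. \<phi> x \<in> points B \<and> \<phi> (astar A x) = astar B (\<phi> x) \<and>
        (\<forall>c\<in>K. \<phi> (vscale A c x) = vscale B c (\<phi> x)) \<and>
        (\<forall>y\<in>points A. \<phi> (vadd A x y) = vadd B (\<phi> x) (\<phi> y) \<and>
                        \<phi> (amult A x y) = amult B (\<phi> x) (\<phi> y)))"


section \<open>Hilbert spaces and C*-algebras\<close>

definition hnorm :: "'h ip_space \<Rightarrow> 'h \<Rightarrow> real" where
  "hnorm H v = sqrt (Re (ip H v v))"

definition hdist :: "'h ip_space \<Rightarrow> 'h \<Rightarrow> 'h \<Rightarrow> real" where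
  "hdist H v w = (if v \<in> points H \<and> w \<in> points H then hnorm H (vminus H v w) else 0)"

locale hilbert_space_over = vect_space_over K H
  for K :: "complex set" and H :: "'h ip_space" +
  assumes ip_scalar: "\<lbrakk>v \<in> points H; w \<in> points H\<rbrakk> \<Longrightarrow> ip H v w \<in> K"
    and ip_add: "\<lbrakk>u \<in> points H; v \<in> points H; w \<in> points H\<rbrakk> \<Longrightarrow>
      ip H (vadd H u v) w = ip H u w + ip H v w"
    and ip_scale: "\<lbrakk>c \<in> K; v \<in> points H; w \<in> points H\<rbrakk> \<Longrightarrow>
      ip H (vscale H c v) w = c * ip H v w"
    and ip_commute: "\<lbrakk>v \<in> points H; w \<in> points H\<rbrakk> \<Longrightarrow> ip H w v = cnj (ip H v w)"
    and ip_nonneg: "v \<in> points H \<Longrightarrow> 0 \<le> Re (ip H v v)"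
    and ip_definite: "\<lbrakk>v \<in> points H; ip H v v = 0\<rbrakk> \<Longrightarrow> v = vzero H"
    and complete: "Metric_space.mcomplete (points H) (hdist H)"

text \<open>
  Bounded operators are functions on the carrier of \<open>H\<close>, made total by the value
  \<open>undefined\<close> elsewhere, so that equality of operators is equality of functions.
\<close>

definition bounded_operators :: "complex set \<Rightarrow> 'h ip_space \<Rightarrow> ('h \<Rightarrow> 'h) star_alg" where
  "bounded_operators K H =
     \<lparr>points = {T \<in> points H \<rightarrow>\<^sub>E points H.
        (\<forall>v\<in>points H. \<forall>w\<in>points H. T (vadd H v w) = vadd H (T v) (T w)) \<and>
        (\<forall>c\<in>K. \<forall>v\<in>points H. T (vscale H c v) = vscale H c (T v)) \<and>
        (\<exists>M. \<forall>v\<in>points H. hnorm H (T v) \<le> M * hnorm H v)},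
      vzero = (\<lambda>v\<in>points H. vzero H),
      vadd = (\<lambda>S T. \<lambda>v\<in>points H. vadd H (S v) (T v)),
      vscale = (\<lambda>c T. \<lambda>v\<in>points H. vscale H c (T v)),
      amult = (\<lambda>S T. \<lambda>v\<in>points H. S (T v)),
      astar = (\<lambda>T. \<lambda>v\<in>points H.
        THE w. w \<in> points H \<and> (\<forall>u\<in>points H. ip H (T u) v = ip H u w)),
      anorm = (\<lambda>T. SUP v\<in>{v \<in> points H. hnorm H v \<le> 1}. hnorm H (T v))\<rparr>"

text \<open>
  HOL cannot quantify over Hilbert spaces of arbitrary type. Fixing the type
  \<open>'a \<times> nat \<Rightarrow> complex\<close> loses nothing: given an isometric representation of \<open>A\<close> on any
  Hilbert space, choose for each \<open>x\<close> in \<open>A\<close> countably many vectors of the unit ball on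
  which the norm of the operator of \<open>x\<close> is attained in the limit. The closed invariant subspace they generate still
  carries an isometric representation, and it has dimension at most \<open>|A| \<cdot> \<aleph>\<^sub>0\<close>, so it is
  isomorphic to a space of square-summable families indexed by a subset of \<open>'a \<times> nat\<close>.
\<close>

definition cstar_algebra :: "complex set \<Rightarrow> 'a star_alg \<Rightarrow> bool" where
  "cstar_algebra K A \<longleftrightarrow>
     banach_star_algebra K A \<and>
     (\<exists>(H :: ('a \<times> nat \<Rightarrow> complex) ip_space) \<pi>.
        hilbert_space_over K H \<and>
        star_hom K A (bounded_operators K H) \<pi> \<and>
        (\<forall>x\<in>points A. anorm (bounded_operators K H) (\<pi> x) = anorm A x) \<and>
        closed_star_subalgebra K (bounded_operators K H) (\<pi> ` points A))"

text \<open>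
  Functions on the unit interval are represented by their extension by zero to the real line.
\<close>

definition cont_unit_interval :: "complex set \<Rightarrow> (real \<Rightarrow> complex) star_alg" where
  "cont_unit_interval K =
     \<lparr>points = {f. continuous_on {0..1} f \<and> f ` {0..1} \<subseteq> K \<and> (\<forall>t. t \<notin> {0..1} \<longrightarrow> f t = 0)},
      vzero = (\<lambda>t. 0),
      vadd = (\<lambda>f g t. f t + g t),
      vscale = (\<lambda>c f t. c * f t),
      amult = (\<lambda>f g t. f t * g t),
      astar = (\<lambda>f t. cnj (f t)),
      anorm = (\<lambda>f. SUP t\<in>{0..1}. cmod (f t))\<rparr>"


section \<open>Presentations and rational points\<close>

text \<open>
  The special points are \<open>special P i\<close> for \<open>i < num_special P\<close>; the values of \<open>special P\<close> at
  other indices are irrelevant.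
\<close>

record 'a presentation =
  alg :: "'a star_alg"
  num_special :: enat
  special :: "nat \<Rightarrow> 'a"

text \<open>
  Separability is not listed as a condition: it follows from countable generation.
\<close>

definition presentation_of :: "complex set \<Rightarrow> 'a star_alg \<Rightarrow> 'a presentation \<Rightarrow> bool" where
  "presentation_of K A P \<longleftrightarrow>
     cstar_algebra K A \<and> alg P = A \<and>
     special P ` {i. enat i < num_special P} \<subseteq> points A \<and>
     (\<forall>S. closed_star_subalgebra K A S \<and> special P ` {i. enat i < num_special P} \<subseteq> S
        \<longrightarrow> S = points A)"

text \<open>
  A noncommutative *-polynomial is a formal sum, given as a list of terms. Each term is a
  coefficient with a word in the letters \<open>Inl i\<close> (the variable \<open>x\<^sub>i\<close>) and \<open>Inr i\<close> (its adjoint).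
  There is no constant term if and only if all words are nonempty.
\<close>

type_synonym star_poly = "(complex \<times> (nat + nat) list) list"

fun letter_index :: "nat + nat \<Rightarrow> nat" where
  "letter_index (Inl i) = i"
| "letter_index (Inr i) = i"

definition rational_poly :: "complex set \<Rightarrow> enat \<Rightarrow> star_poly \<Rightarrow> bool" where
  "rational_poly K n p \<longleftrightarrow>
     (\<forall>(c, w)\<in>set p. c \<in> K \<and> Re c \<in> \<rat> \<and> Im c \<in> \<rat> \<and> w \<noteq> [] \<and>
        (\<forall>l\<in>set w. enat (letter_index l) < n))"

fun letter_value :: "'a presentation \<Rightarrow> nat + nat \<Rightarrow> 'a" where
  "letter_value P (Inl i) = special P i"
| "letter_value P (Inr i) = astar (alg P) (special P i)"

fun word_value :: "'a presentation \<Rightarrow> (nat + nat) list \<Rightarrow> 'a" where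
  "word_value P [] = undefined"
| "word_value P [l] = letter_value P l"
| "word_value P (l # l' # w) = amult (alg P) (letter_value P l) (word_value P (l' # w))"

fun poly_value :: "'a presentation \<Rightarrow> star_poly \<Rightarrow> 'a" where
  "poly_value P [] = vzero (alg P)"
| "poly_value P ((c, w) # p) =
     vadd (alg P) (vscale (alg P) c (word_value P w)) (poly_value P p)"

text \<open>
  Codes of rational numbers and of polynomials with coefficients in the Gaussian rationals.
  Decoding is surjective; objects may have several codes.
\<close>

definition rat_of_code :: "nat \<Rightarrow> rat" where
  "rat_of_code n = (case prod_decode n of (a, b) \<Rightarrow> of_int (int_decode a) / of_nat (Suc b))"

definition coeff_of_code :: "nat \<Rightarrow> complex" where
  "coeff_of_code n =
     (case prod_decode n of (a, b) \<Rightarrow> Complex (of_rat (rat_of_code a)) (of_rat (rat_of_code b)))"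

definition term_of_code :: "nat \<Rightarrow> complex \<times> (nat + nat) list" where
  "term_of_code n =
     (case prod_decode n of (a, b) \<Rightarrow> (coeff_of_code a, map sum_decode (list_decode b)))"

definition poly_of_code :: "nat \<Rightarrow> star_poly" where
  "poly_of_code n = map term_of_code (list_decode n)"


section \<open>Computability\<close>

text \<open>\<open>rational_code K P p\<close>: the number \<open>p\<close> describes a rational point of \<open>P\<close>, namely
  \<open>point_of_code P p\<close>.\<close>

definition rational_code :: "complex set \<Rightarrow> 'a presentation \<Rightarrow> nat \<Rightarrow> bool" where
  "rational_code K P p \<longleftrightarrow> rational_poly K (num_special P) (poly_of_code p)"

definition point_of_code :: "'a presentation \<Rightarrow> nat \<Rightarrow> 'a" where
  "point_of_code P p = poly_value P (poly_of_code p)"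

text \<open>Effective procedures are only required to halt on inputs that are codes.\<close>

definition computable_presentation_of ::
  "complex set \<Rightarrow> 'a star_alg \<Rightarrow> 'a presentation \<Rightarrow> bool" where
  "computable_presentation_of K A P \<longleftrightarrow>
     presentation_of K A P \<and>
     (\<exists>f. \<forall>p k. rational_code K P p \<longrightarrow>
        (\<exists>q. rec_eval f [p, k] q \<and>
             \<bar>anorm A (point_of_code P p) - of_rat (rat_of_code q)\<bar> < 1 / 2 ^ k))"

definition computable_star_hom ::
  "complex set \<Rightarrow> 'a presentation \<Rightarrow> 'b presentation \<Rightarrow> ('a \<Rightarrow> 'b) \<Rightarrow> bool" where
  "computable_star_hom K P Q \<phi> \<longleftrightarrow>
     star_hom K (alg P) (alg Q) \<phi> \<and>
     (\<exists>f. \<forall>p k. rational_code K P p \<longrightarrow>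
        (\<exists>q. rec_eval f [p, k] q \<and> rational_code K Q q \<and>
             anorm (alg Q) (vminus (alg Q) (\<phi> (point_of_code P p)) (point_of_code Q q))
               < 1 / 2 ^ k))"

definition computable_isomorphism ::
  "complex set \<Rightarrow> 'a presentation \<Rightarrow> 'b presentation \<Rightarrow> ('a \<Rightarrow> 'b) \<Rightarrow> bool" where
  "computable_isomorphism K P Q \<phi> \<longleftrightarrow>
     computable_star_hom K P Q \<phi> \<and> bij_betw \<phi> (points (alg P)) (points (alg Q))"

definition computably_categorical :: "complex set \<Rightarrow> 'a star_alg \<Rightarrow> bool" where
  "computably_categorical K A \<longleftrightarrow>
     (\<forall>P Q. computable_presentation_of K A P \<and> computable_presentation_of K A Q \<longrightarrow>
        (\<exists>\<phi>. computable_isomorphism K P Q \<phi>))"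

end

theory Submission
  imports Defs
begin

text \<open>
  Cut \<open>(0, 1]\<close> into the intervals \<open>[2^-(n+1), 2^-n]\<close> and collapse it to a curve in
  \<open>\<real>^\<nat>\<close> on which the \<open>n\<close>-th interval is a segment. If the \<open>n\<close>-th
  program halts on its own code at time \<open>s\<close>, the segment is traced three times instead of once,
  the strands being \<open>2^-s\<close> apart. At precision \<open>2^-s\<close> a single and a triple
  segment are the same set, so the norm of the algebra generated by the coordinates is computable
  although halting is not decidable.

  A computable isomorphism from the presentation without zigzags is composition with a
  homeomorphism \<open>h\<close> of \<open>[0, 1]\<close>. Approximate a coordinate composed with \<open>h\<close> by rational
  polynomials with precision \<open>2^-k\<close> until its values at the ends of the \<open>n\<close>-th interval are seen to
  differ by much more than \<open>2^-k\<close>. As \<open>h\<close> is monotone, this polynomial also separates two points on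
  different strands, so \<open>2^-k\<close> is at most its Lipschitz constant times \<open>2^-s\<close>. This gives a
  recursive bound on the halting time, which does not exist.
\<close>

section \<open>Recursive functions\<close>

text \<open>The obstacle is to hide a non-recursive fact from the norm without hiding it from
  isomorphisms. The norm of a rational point is the maximum modulus of a polynomial on the curve, so
  it sees the curve only as a set and with finite precision; an isomorphism also sees the order in
  which the curve is traced. Three is the least number of strands that can be used: whether or not
  the program halts, the path has to run from one end of the segment to the other, so the number of
  strands is odd.

  The presentation without zigzags serves as the source because its special points include the
  ramps, the coordinates along the intervals themselves. The isomorphism can then be queried at
  codes that depend recursively on the interval alone and not on halting. Likewise the end values of
  a segment do not depend on the distance of its strands, so the test for separation is decidable
  although the distance is not known exactly.\<close>

definition recursive :: "nat \<Rightarrow> (nat list \<Rightarrow> nat) \<Rightarrow> bool" where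
  "recursive n F \<longleftrightarrow> (\<exists>g. \<forall>xs. length xs = n \<longrightarrow> rec_eval g xs (F xs))"

definition decidable :: "nat \<Rightarrow> (nat list \<Rightarrow> bool) \<Rightarrow> bool" where
  "decidable n P \<longleftrightarrow> recursive n (\<lambda>xs. of_bool (P xs))"

lemma recursive_cong:
  assumes "recursive n F" "\<And>xs. length xs = n \<Longrightarrow> F xs = G xs"
  shows "recursive n G"
  using assms unfolding recursive_def by metis

lemma recursive_comp:
  assumes "recursive (length Gs) F" "\<And>G. G \<in> set Gs \<Longrightarrow> recursive n G"
  shows "recursive n (\<lambda>xs. F (map (\<lambda>G. G xs) Gs))"
proof -
  obtain f where f: "\<And>xs. length xs = length Gs \<Longrightarrow> rec_eval f xs (F xs)"
    using assms(1) unfolding recursive_def by auto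
  have "\<forall>G\<in>set Gs. \<exists>g. \<forall>xs. length xs = n \<longrightarrow> rec_eval g xs (G xs)"
    using assms(2) unfolding recursive_def by auto
  then obtain c where c: "\<And>G xs. G \<in> set Gs \<Longrightarrow> length xs = n \<Longrightarrow> rec_eval (c G) xs (G xs)"
    by metis
  have "rec_eval (RComp f (map c Gs)) xs (F (map (\<lambda>G. G xs) Gs))" if "length xs = n" for xs
    by (rule rec_eval.comp[where ys = "map (\<lambda>G. G xs) Gs"])
      (auto simp: list_all2_map1 list_all2_map2 list_all2_same f c that)
  then show ?thesis unfolding recursive_def by blast
qed

lemma recursive_nth: "i < n \<Longrightarrow> recursive n (\<lambda>xs. xs ! i)"
  unfolding recursive_def using rec_eval.proj by blast

lemma recursive_hd: "recursive (Suc n) (\<lambda>xs. hd xs)"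
proof (rule recursive_cong)
  show "recursive (Suc n) (\<lambda>xs. xs ! 0)" by (simp add: recursive_nth)
next
  fix xs :: "nat list" assume "length xs = Suc n"
  then show "xs ! 0 = hd xs" by (cases xs) auto
qed

text \<open>This is how the rules pass under a binder: the bound variable is pushed on the front of
  the argument list, and a subterm without it depends on the tail only. The closure rules for
  recursion, sums, quantifiers and minimisation therefore have premises in \<open>hd ys\<close> and
  \<open>tl ys\<close>.\<close>

lemma recursive_tl:
  assumes "recursive n F"
  shows "recursive (Suc n) (\<lambda>xs. F (tl xs))"
proof -
  let ?Gs = "map (\<lambda>i xs. xs ! Suc i) [0..<n] :: (nat list \<Rightarrow> nat) list"
  have "recursive (Suc n) (\<lambda>xs. F (map (\<lambda>G. G xs) ?Gs))"
    by (rule recursive_comp) (auto simp: assms recursive_nth)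
  then show ?thesis
  proof (rule recursive_cong)
    fix xs :: "nat list" assume "length xs = Suc n"
    then have "map (\<lambda>G. G xs) ?Gs = tl xs"
      by (intro nth_equalityI) (auto simp: nth_tl)
    then show "F (map (\<lambda>G. G xs) ?Gs) = F (tl xs)" by simp
  qed
qed

lemma recursive_app1:
  assumes "recursive 1 (\<lambda>xs. f (xs ! 0))" "recursive n a"
  shows "recursive n (\<lambda>xs. f (a xs))"
  using recursive_comp[of "[a]" "\<lambda>xs. f (xs ! 0)" n] assms by simp

lemma recursive_app2:
  assumes "recursive 2 (\<lambda>xs. f (xs ! 0) (xs ! 1))" "recursive n a" "recursive n b"
  shows "recursive n (\<lambda>xs. f (a xs) (b xs))"
  using recursive_comp[of "[a, b]" "\<lambda>xs. f (xs ! 0) (xs ! 1)" n] assms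
  by (auto simp: numeral_2_eq_2)

lemma recursive_Suc:
  assumes "recursive n a" shows "recursive n (\<lambda>xs. Suc (a xs))"
proof (rule recursive_app1[OF _ assms])
  have "rec_eval RSucc xs (Suc (xs ! 0))" if "length xs = 1" for xs
    using that rec_eval.succ[of "xs ! 0"] by (cases xs) auto
  then show "recursive 1 (\<lambda>xs. Suc (xs ! 0))"
    unfolding recursive_def by blast
qed

lemma recursive_const: "recursive n (\<lambda>xs. c)"
proof (induction c)
  case 0
  show ?case unfolding recursive_def using rec_eval.zero by blast
qed (rule recursive_Suc)

lemma recursive_rec:
  assumes f: "recursive n f"
    and g: "recursive (Suc (Suc n)) (\<lambda>ys. g (hd ys) (hd (tl ys)) (tl (tl ys)))"
    and c: "recursive n c"
  shows "recursive n (\<lambda>xs. rec_nat (f xs) (\<lambda>m y. g m y xs) (c xs))"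
proof -
  let ?R = "\<lambda>m xs. rec_nat (f xs) (\<lambda>m y. g m y xs) m"
  obtain pf where pf: "\<And>xs. length xs = n \<Longrightarrow> rec_eval pf xs (f xs)"
    using f unfolding recursive_def by auto
  obtain pg where pg: "\<And>ys. length ys = Suc (Suc n) \<Longrightarrow>
      rec_eval pg ys (g (hd ys) (hd (tl ys)) (tl (tl ys)))"
    using g unfolding recursive_def by auto
  have "rec_eval (RPrim pf pg) (m # xs) (?R m xs)" if "length xs = n" for m xs
  proof (induction m)
    case 0
    show ?case using rec_eval.prim_0[OF pf[OF that]] by simp
  next
    case (Suc m)
    show ?case
      using rec_eval.prim_Suc[OF Suc, of "g m (?R m xs) xs"] pg[of "m # ?R m xs # xs"] that by simp
  qed
  then have "rec_eval (RPrim pf pg) ys (?R (hd ys) (tl ys))" if "length ys = Suc n" for ys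
    using that by (cases ys) auto
  then have R: "recursive (Suc n) (\<lambda>ys. ?R (hd ys) (tl ys))"
    unfolding recursive_def by blast
  let ?Gs = "c # map (\<lambda>i xs. xs ! i) [0..<n]"
  have "recursive n (\<lambda>xs. (\<lambda>ys. ?R (hd ys) (tl ys)) (map (\<lambda>G. G xs) ?Gs))"
    by (rule recursive_comp) (auto simp: R c recursive_nth)
  then show ?thesis
  proof (rule recursive_cong)
    fix xs :: "nat list" assume "length xs = n"
    then have "map (\<lambda>G. G xs) ?Gs = c xs # xs"
      by (intro nth_equalityI) (auto simp: nth_Cons')
    then show "(\<lambda>ys. ?R (hd ys) (tl ys)) (map (\<lambda>G. G xs) ?Gs) = ?R (c xs) xs"
      by simp
  qed
qed

lemma recursive_pred: "recursive n a \<Longrightarrow> recursive n (\<lambda>xs. a xs - 1)"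
proof -
  assume a: "recursive n a"
  have "recursive n (\<lambda>xs. rec_nat 0 (\<lambda>m y. m) (a xs))"
    by (intro recursive_rec recursive_const recursive_hd a)
  moreover have "rec_nat 0 (\<lambda>m y. m) x = x - 1" for x :: nat
    by (cases x) auto
  ultimately show ?thesis by simp
qed

lemma recursive_diff:
  assumes "recursive n a" "recursive n b"
  shows "recursive n (\<lambda>xs. a xs - b xs)"
proof -
  have "recursive n (\<lambda>xs. rec_nat (a xs) (\<lambda>m y. y - 1) (b xs))"
    by (intro recursive_rec recursive_pred recursive_tl recursive_hd assms)
  moreover have "rec_nat x (\<lambda>m y. y - 1) z = x - z" for x z :: nat
    by (induction z) auto
  ultimately show ?thesis by simp
qed

lemma recursive_add:
  assumes "recursive n a" "recursive n b"
  shows "recursive n (\<lambda>xs. a xs + b xs)"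
proof -
  have "recursive n (\<lambda>xs. rec_nat (a xs) (\<lambda>m y. Suc y) (b xs))"
    by (intro recursive_rec recursive_Suc recursive_tl recursive_hd assms)
  moreover have "rec_nat x (\<lambda>m y. Suc y) z = x + z" for x z :: nat
    by (induction z) auto
  ultimately show ?thesis by simp
qed

lemma recursive_mult:
  assumes "recursive n a" "recursive n b"
  shows "recursive n (\<lambda>xs. a xs * b xs)"
proof -
  have "recursive n (\<lambda>xs. rec_nat 0 (\<lambda>m y. y + a xs) (b xs))"
    by (intro recursive_rec recursive_add recursive_const recursive_tl recursive_hd assms)
  moreover have "rec_nat 0 (\<lambda>m y. y + x) z = x * z" for x z :: nat
    by (induction z) auto
  ultimately show ?thesis by simp
qed

lemma recursive_power:
  assumes "recursive n a" "recursive n b"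
  shows "recursive n (\<lambda>xs. a xs ^ b xs)"
proof -
  have "recursive n (\<lambda>xs. rec_nat 1 (\<lambda>m y. a xs * y) (b xs))"
    by (intro recursive_rec recursive_mult recursive_const recursive_tl recursive_hd assms)
  moreover have "rec_nat 1 (\<lambda>m y. x * y) z = x ^ z" for x z :: nat
    by (induction z) auto
  ultimately show ?thesis by simp
qed

text \<open>The step of a primitive recursion sees the counter, the accumulator and the arguments. A
  summand depends on the first and the last, so the accumulator between them has to be
  skipped.\<close>

lemma recursive_skip:
  assumes "recursive (Suc n) F"
  shows "recursive (Suc (Suc n)) (\<lambda>ys. F (hd ys # tl (tl ys)))"
proof -
  let ?Gs = "hd # map (\<lambda>i xs. xs ! Suc (Suc i)) [0..<n] :: (nat list \<Rightarrow> nat) list"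
  have "recursive (Suc (Suc n)) (\<lambda>xs. F (map (\<lambda>G. G xs) ?Gs))"
    by (rule recursive_comp) (use recursive_hd[of "Suc n"] in \<open>auto simp: assms recursive_nth\<close>)
  then show ?thesis
  proof (rule recursive_cong)
    fix xs :: "nat list" assume "length xs = Suc (Suc n)"
    then have "map (\<lambda>G. G xs) ?Gs = hd xs # tl (tl xs)"
      by (intro nth_equalityI) (auto simp: nth_tl nth_Cons')
    then show "F (map (\<lambda>G. G xs) ?Gs) = F (hd xs # tl (tl xs))" by simp
  qed
qed

lemma recursive_sum:
  assumes B: "recursive (Suc n) (\<lambda>ys. B (hd ys) (tl ys))" and c: "recursive n c"
  shows "recursive n (\<lambda>xs. \<Sum>i<c xs. B i xs)"
proof -
  have B': "recursive (Suc (Suc n)) (\<lambda>ys. B (hd ys) (tl (tl ys)))"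
    using recursive_skip[OF B] by simp
  have "recursive n (\<lambda>xs. rec_nat 0 (\<lambda>m y. y + B m xs) (c xs))"
    by (intro recursive_rec recursive_add recursive_const B' c recursive_tl recursive_hd)
  moreover have "rec_nat 0 (\<lambda>m y. y + B m xs) z = (\<Sum>i<z. B i xs)" for xs z
    by (induction z) auto
  ultimately show ?thesis by simp
qed

section \<open>Decidable predicates and search\<close>

lemma decidable_eq:
  assumes "recursive n a" "recursive n b"
  shows "decidable n (\<lambda>xs. a xs = b xs)"
proof -
  have "recursive n (\<lambda>xs. 1 - ((a xs - b xs) + (b xs - a xs)))"
    by (intro recursive_diff recursive_add recursive_const assms)
  then show ?thesis unfolding decidable_def by (rule recursive_cong) auto
qed

lemma decidable_less:
  assumes "recursive n a" "recursive n b"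
  shows "decidable n (\<lambda>xs. a xs < b xs)"
proof -
  have "recursive n (\<lambda>xs. 1 - (Suc (a xs) - b xs))"
    by (intro recursive_diff recursive_Suc recursive_const assms)
  then show ?thesis unfolding decidable_def by (rule recursive_cong) auto
qed

lemma decidable_not: "decidable n P \<Longrightarrow> decidable n (\<lambda>xs. \<not> P xs)"
  unfolding decidable_def
  by (rule recursive_cong[OF recursive_diff[OF recursive_const[of _ 1]]]) auto

lemma decidable_conj: "decidable n P \<Longrightarrow> decidable n Q \<Longrightarrow> decidable n (\<lambda>xs. P xs \<and> Q xs)"
  unfolding decidable_def of_bool_conj by (rule recursive_mult)

lemma decidable_disj:
  assumes "decidable n P" "decidable n Q" shows "decidable n (\<lambda>xs. P xs \<or> Q xs)"
  using decidable_not[OF decidable_conj[OF decidable_not decidable_not], OF assms] by simp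

lemma decidable_imp:
  assumes "decidable n P" "decidable n Q" shows "decidable n (\<lambda>xs. P xs \<longrightarrow> Q xs)"
  unfolding imp_conv_disj by (intro decidable_disj decidable_not assms)

lemma decidable_le:
  assumes "recursive n a" "recursive n b"
  shows "decidable n (\<lambda>xs. a xs \<le> b xs)"
  using decidable_not[OF decidable_less[OF assms(2,1)]] by (simp add: not_less)

lemma decidable_const: "decidable n (\<lambda>xs. b)"
  unfolding decidable_def by (rule recursive_const)

lemma decidable_tl: "decidable n P \<Longrightarrow> decidable (Suc n) (\<lambda>xs. P (tl xs))"
  unfolding decidable_def by (rule recursive_tl)

text \<open>A bounded universal quantifier says that the number of counterexamples is 0.\<close>

lemma decidable_all:
  assumes "decidable (Suc n) (\<lambda>ys. P (hd ys) (tl ys))" "recursive n c"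
  shows "decidable n (\<lambda>xs. \<forall>i<c xs. P i xs)"
proof -
  have "decidable n (\<lambda>xs. (\<Sum>i<c xs. of_bool (\<not> P i xs)) = (0 :: nat))"
    by (intro decidable_eq recursive_sum recursive_const
      decidable_not[unfolded decidable_def] assms[unfolded decidable_def])
  moreover have "(\<Sum>i<c xs. of_bool (\<not> P i xs)) = (0 :: nat) \<longleftrightarrow> (\<forall>i<c xs. P i xs)" for xs
    by (auto simp: sum_eq_0_iff simp del: sum_of_bool_eq)
  ultimately show ?thesis by simp
qed

lemma decidable_ex:
  assumes "decidable (Suc n) (\<lambda>ys. P (hd ys) (tl ys))" "recursive n c"
  shows "decidable n (\<lambda>xs. \<exists>i<c xs. P i xs)"
  using decidable_not[OF decidable_all[OF decidable_not], OF assms] by simp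

lemma decidable_all_le:
  assumes "decidable (Suc n) (\<lambda>ys. P (hd ys) (tl ys))" "recursive n c"
  shows "decidable n (\<lambda>xs. \<forall>i\<le>c xs. P i xs)"
  using decidable_all[OF assms(1) recursive_Suc[OF assms(2)]] by (simp add: less_Suc_eq_le)

lemma decidable_ex_le:
  assumes "decidable (Suc n) (\<lambda>ys. P (hd ys) (tl ys))" "recursive n c"
  shows "decidable n (\<lambda>xs. \<exists>i\<le>c xs. P i xs)"
  using decidable_ex[OF assms(1) recursive_Suc[OF assms(2)]] by (simp add: less_Suc_eq_le)

lemma recursive_if:
  assumes "decidable n P" "recursive n a" "recursive n b"
  shows "recursive n (\<lambda>xs. if P xs then a xs else b xs)"
proof -
  have "recursive n (\<lambda>xs. of_bool (P xs) * a xs + of_bool (\<not> P xs) * b xs)"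
    using assms decidable_not[OF assms(1)]
    by (intro recursive_add recursive_mult) (auto simp: decidable_def)
  then show ?thesis by (rule recursive_cong) auto
qed

text \<open>\<open>RMin\<close> searches for a zero, so its program decides the negation of
  \<open>P\<close>. The hypothesis \<open>ex\<close> makes the search total.\<close>

lemma recursive_Least:
  assumes P: "decidable (Suc n) (\<lambda>ys. P (hd ys) (tl ys))"
    and ex: "\<And>xs. length xs = n \<Longrightarrow> \<exists>m. P m xs"
  shows "recursive n (\<lambda>xs. LEAST m. P m xs)"
proof -
  obtain f where f: "\<And>ys. length ys = Suc n \<Longrightarrow> rec_eval f ys (of_bool (\<not> P (hd ys) (tl ys)))"
    using decidable_not[OF P] unfolding decidable_def recursive_def by auto
  have "rec_eval (RMin f) xs (LEAST m. P m xs)" if len: "length xs = n" for xs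
  proof (rule rec_eval.minim)
    have "P (LEAST m. P m xs) xs"
      using ex[OF len] by (metis LeastI)
    then show "rec_eval f ((LEAST m. P m xs) # xs) 0"
      using f[of "(LEAST m. P m xs) # xs"] len by simp
    show "\<forall>m<LEAST m. P m xs. \<exists>y>0. rec_eval f (m # xs) y"
    proof (intro allI impI)
      fix m assume "m < (LEAST m. P m xs)"
      then have "\<not> P m xs" by (rule not_less_Least)
      then show "\<exists>y>0. rec_eval f (m # xs) y"
        using f[of "m # xs"] len by (intro exI[of _ 1]) simp
    qed
  qed
  then show ?thesis unfolding recursive_def by blast
qed

lemma recursive_div:
  assumes "recursive n a" "recursive n b"
  shows "recursive n (\<lambda>xs. a xs div b xs)"
proof -
  \<comment> \<open>The disjunct \<open>b xs = 0\<close> makes the search end at 0, which is the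
    value of division by 0.\<close>
  have "recursive n (\<lambda>xs. LEAST q. b xs = 0 \<or> a xs < Suc q * b xs)"
  proof (intro recursive_Least decidable_disj decidable_eq decidable_less recursive_mult
      recursive_Suc recursive_const recursive_hd recursive_tl assms)
    fix xs
    have "a xs < Suc (a xs) * b xs" if "b xs \<noteq> 0"
      using that by (cases "b xs") auto
    then show "\<exists>m. b xs = 0 \<or> a xs < Suc m * b xs" by metis
  qed
  moreover have "(LEAST q. y = 0 \<or> x < Suc q * y) = x div y" for x y :: nat
  proof (cases "y = 0")
    case False
    then have "x < Suc q * y \<longleftrightarrow> x div y \<le> q" for q
      by (metis bot_nat_0.not_eq_extremum div_less_iff_less_mult less_Suc_eq_le)
    with False show ?thesis
      by (intro Least_equality) (simp_all del: mult_Suc)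
  qed (auto intro: Least_equality)
  ultimately show ?thesis by simp
qed

lemma decidable_even: "recursive n a \<Longrightarrow> decidable n (\<lambda>xs. even (a xs))"
proof -
  assume a: "recursive n a"
  have "decidable n (\<lambda>xs. a xs = 2 * (a xs div 2))"
    by (intro decidable_eq recursive_mult recursive_div recursive_const a)
  moreover have "a xs = 2 * (a xs div 2) \<longleftrightarrow> even (a xs)" for xs by presburger
  ultimately show ?thesis by simp
qed

lemmas recursive_intros =
  recursive_const recursive_Suc recursive_hd recursive_add recursive_diff recursive_mult
  recursive_power recursive_div recursive_sum recursive_if decidable_const decidable_eq decidable_less
  decidable_le decidable_not decidable_conj decidable_disj decidable_imp decidable_all decidable_ex
  decidable_all_le decidable_ex_le decidable_even

subsection \<open>Pairs and lists\<close>

lemma recursive_prod_encode: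
  "recursive n a \<Longrightarrow> recursive n b \<Longrightarrow> recursive n (\<lambda>xs. prod_encode (a xs, b xs))"
  unfolding prod_encode_def triangle_def prod.case
  by (intro recursive_intros)

text \<open>Decoding becomes a search that uses only \<open>prod_encode\<close>. The components of a
  pair are at most its code, so the inner quantifier is bounded.\<close>

lemma fst_prod_decode_eq: "fst (prod_decode e) = (LEAST a. \<exists>b\<le>e. prod_encode (a, b) = e)"
proof (rule Least_equality[symmetric])
  show "\<exists>b\<le>e. prod_encode (fst (prod_decode e), b) = e"
    by (metis prod.collapse prod_decode_inverse le_prod_encode_2)
next
  fix a assume "\<exists>b\<le>e. prod_encode (a, b) = e"
  then show "fst (prod_decode e) \<le> a" by auto
qed

lemma snd_prod_decode_eq: "snd (prod_decode e) = (LEAST b. \<exists>a\<le>e. prod_encode (a, b) = e)"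
proof (rule Least_equality[symmetric])
  show "\<exists>a\<le>e. prod_encode (a, snd (prod_decode e)) = e"
    by (metis prod.collapse prod_decode_inverse le_prod_encode_1)
next
  fix b assume "\<exists>a\<le>e. prod_encode (a, b) = e"
  then show "snd (prod_decode e) \<le> b" by auto
qed

lemma recursive_fst_prod_decode:
  assumes "recursive n a" shows "recursive n (\<lambda>xs. fst (prod_decode (a xs)))"
proof -
  have "\<exists>m. \<exists>b\<le>e. prod_encode (m, b) = e" for e
    by (metis prod.collapse prod_decode_inverse le_prod_encode_2)
  then show ?thesis
    unfolding fst_prod_decode_eq
    by (intro recursive_Least recursive_intros recursive_prod_encode recursive_tl assms)
qed

lemma recursive_snd_prod_decode:
  assumes "recursive n a" shows "recursive n (\<lambda>xs. snd (prod_decode (a xs)))"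
proof -
  have "\<exists>m. \<exists>b\<le>e. prod_encode (b, m) = e" for e
    by (metis prod.collapse prod_decode_inverse le_prod_encode_1)
  then show ?thesis
    unfolding snd_prod_decode_eq
    by (intro recursive_Least recursive_intros recursive_prod_encode recursive_tl assms)
qed

definition code_hd :: "nat \<Rightarrow> nat" where "code_hd e = fst (prod_decode (e - 1))"
definition code_tl :: "nat \<Rightarrow> nat" where "code_tl e = snd (prod_decode (e - 1))"
definition code_drop :: "nat \<Rightarrow> nat \<Rightarrow> nat" where "code_drop e i = rec_nat e (\<lambda>_. code_tl) i"
definition code_nth :: "nat \<Rightarrow> nat \<Rightarrow> nat" where "code_nth e i = code_hd (code_drop e i)"
definition code_length :: "nat \<Rightarrow> nat" where "code_length e = (LEAST i. code_drop e i = 0)"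
definition code_cons :: "nat \<Rightarrow> nat \<Rightarrow> nat" where "code_cons x e = Suc (prod_encode (x, e))"

lemma list_encode_eq_0_iff [simp]: "list_encode xs = 0 \<longleftrightarrow> xs = []"
  by (cases xs) auto

lemma code_cons_list_encode [simp]: "code_cons x (list_encode xs) = list_encode (x # xs)"
  by (simp add: code_cons_def)

lemma code_hd_list_encode [simp]: "xs \<noteq> [] \<Longrightarrow> code_hd (list_encode xs) = hd xs"
  by (cases xs) (auto simp: code_hd_def)

lemma code_tl_list_encode [simp]: "code_tl (list_encode xs) = list_encode (tl xs)"
proof (cases xs)
  case Nil
  \<comment> \<open>Truncated subtraction makes the tail of the code 0 equal to 0 again. Hence
    \<open>code_drop\<close> stays at 0 past the end of a list.\<close>
  have "snd (prod_decode 0) \<le> 0"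
    using le_prod_encode_2[of "snd (prod_decode 0)" "fst (prod_decode 0)"] by simp
  then show ?thesis by (simp add: code_tl_def Nil)
qed (simp add: code_tl_def)

lemma code_drop_list_encode [simp]: "code_drop (list_encode xs) i = list_encode (drop i xs)"
proof (induction i)
  case (Suc i)
  then show ?case by (simp add: code_drop_def drop_Suc tl_drop)
qed (simp add: code_drop_def)

lemma code_nth_list_encode [simp]: "i < length xs \<Longrightarrow> code_nth (list_encode xs) i = xs ! i"
  by (simp add: code_nth_def hd_drop_conv_nth)

lemma code_length_list_encode [simp]: "code_length (list_encode xs) = length xs"
  unfolding code_length_def by (auto intro!: Least_equality)

lemma recursive_code_hd: "recursive n a \<Longrightarrow> recursive n (\<lambda>xs. code_hd (a xs))"
  unfolding code_hd_def by (intro recursive_fst_prod_decode recursive_intros)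

lemma recursive_code_tl: "recursive n a \<Longrightarrow> recursive n (\<lambda>xs. code_tl (a xs))"
  unfolding code_tl_def by (intro recursive_snd_prod_decode recursive_intros)

lemma recursive_code_cons:
  "recursive n a \<Longrightarrow> recursive n b \<Longrightarrow> recursive n (\<lambda>xs. code_cons (a xs) (b xs))"
  unfolding code_cons_def by (intro recursive_prod_encode recursive_intros)

lemma recursive_code_drop:
  assumes "recursive n a" "recursive n b"
  shows "recursive n (\<lambda>xs. code_drop (a xs) (b xs))"
  unfolding code_drop_def
  by (intro recursive_rec recursive_code_tl recursive_tl recursive_hd assms)

lemma recursive_code_nth:
  "recursive n a \<Longrightarrow> recursive n b \<Longrightarrow> recursive n (\<lambda>xs. code_nth (a xs) (b xs))"
  unfolding code_nth_def by (intro recursive_code_hd recursive_code_drop)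

lemma recursive_code_length:
  assumes "recursive n a" shows "recursive n (\<lambda>xs. code_length (a xs))"
proof -
  have "\<exists>i. code_drop e i = 0" for e
    using code_drop_list_encode[of "list_decode e" "length (list_decode e)"] by auto
  then show ?thesis
    unfolding code_length_def
    by (intro recursive_Least recursive_intros recursive_code_drop recursive_tl assms)
qed

lemma triangle_ge: "n \<le> triangle n"
  by (induction n) auto

text \<open>Codes dominate the sizes that occur in a coded list: length, entries and their sum. This
  bounds the quantifiers over derivations and, later, the Lipschitz constant of a coded
  polynomial.\<close>

lemma sum_list_length_le_list_encode: "sum_list xs + length xs \<le> list_encode xs"
proof (induction xs)
  case (Cons x xs)
  have "x + list_encode xs \<le> prod_encode (x, list_encode xs)"
    using triangle_ge[of "x + list_encode xs"] by (simp add: prod_encode_def)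
  with Cons show ?case by simp
qed simp

lemma member_less_list_encode: "x \<in> set xs \<Longrightarrow> x < list_encode xs"
  using sum_list_length_le_list_encode[of xs] member_le_sum_list[of x xs] length_pos_if_in_set[of x xs]
  by linarith

lemmas code_intros =
  recursive_intros recursive_prod_encode recursive_fst_prod_decode recursive_snd_prod_decode
  recursive_code_hd recursive_code_tl recursive_code_cons recursive_code_drop recursive_code_nth
  recursive_code_length recursive_tl decidable_tl

section \<open>A halting time that dominates every recursive function\<close>

lemma rec_eval_deterministic: "rec_eval f xs y \<Longrightarrow> rec_eval f xs z \<Longrightarrow> y = z"
proof (induction arbitrary: z rule: rec_eval.induct)
  case (comp xs gs ys f y z)
  from comp.prems obtain ys' where ys': "list_all2 (\<lambda>g y. rec_eval g xs y) gs ys'" "rec_eval f ys' z"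
    by (auto elim: rec_eval.cases)
  have "ys = ys'"
    using comp.IH(1) ys'(1) by (auto simp: list_all2_conv_all_nth intro!: nth_equalityI)
  then show ?case using comp.IH(2) ys'(2) by simp
next
  case (prim_Suc f g n xs y w)
  from prim_Suc.prems obtain y' where "rec_eval (RPrim f g) (n # xs) y'" "rec_eval g (n # y' # xs) z"
    by (auto elim: rec_eval.cases)
  then show ?case using prim_Suc.IH by blast
next
  case (minim f n xs)
  from minim.prems have z: "rec_eval f (z # xs) 0" "\<And>m. m < z \<Longrightarrow> \<exists>y>0. rec_eval f (m # xs) y"
    by (auto elim: rec_eval.cases)
  show ?case
  proof (rule linorder_cases[of n z])
    assume "n < z"
    then obtain y where "y > 0" "rec_eval f (n # xs) y" using z(2) by blast
    then show ?thesis using minim.IH(1) by force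
  next
    assume "z < n"
    then show ?thesis using minim.IH(2) z(1) by force
  qed
next
  case (prim_0 f xs y g)
  from prim_0.prems have "rec_eval f xs z" by cases auto
  then show ?case by (rule prim_0.IH)
qed (erule rec_eval.cases; simp)+

section \<open>Programs and derivations as numbers\<close>

primrec code :: "recf \<Rightarrow> nat" where
  "code RZero = prod_encode (0, 0)"
| "code RSucc = prod_encode (1, 0)"
| "code (RProj i) = prod_encode (2, i)"
| "code (RComp f gs) = prod_encode (3, prod_encode (code f, list_encode (map code gs)))"
| "code (RPrim f g) = prod_encode (4, prod_encode (code f, code g))"
| "code (RMin f) = prod_encode (5, code f)"

definition entry :: "nat \<Rightarrow> nat \<Rightarrow> nat \<Rightarrow> nat" where
  "entry c a r = prod_encode (c, prod_encode (a, r))"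

definition tag :: "nat \<Rightarrow> nat" where "tag c = fst (prod_decode c)"
definition arg :: "nat \<Rightarrow> nat" where "arg c = snd (prod_decode c)"

text \<open>
  \<open>justified S c a r\<close>: one rule of \<open>rec_eval\<close> derives that the program with code \<open>c\<close> returns \<open>r\<close>
  on the argument list with code \<open>a\<close>, from premises whose entries are in \<open>S\<close>.
\<close>

definition justified :: "nat set \<Rightarrow> nat \<Rightarrow> nat \<Rightarrow> nat \<Rightarrow> bool" where
  "justified S c a r \<longleftrightarrow>
     (tag c = 0 \<and> r = 0) \<or>
     (tag c = 1 \<and> a \<noteq> 0 \<and> r = Suc (code_hd a)) \<or>
     (tag c = 2 \<and> arg c < code_length a \<and> r = code_nth a (arg c)) \<or>
     (tag c = 3 \<and> (\<exists>b. entry (tag (arg c)) b r \<in> S \<and> code_length b = code_length (arg (arg c)) \<and>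
        (\<forall>i<code_length b. entry (code_nth (arg (arg c)) i) a (code_nth b i) \<in> S))) \<or>
     (tag c = 4 \<and> a \<noteq> 0 \<and> code_hd a = 0 \<and> entry (tag (arg c)) (code_tl a) r \<in> S) \<or>
     (tag c = 4 \<and> a \<noteq> 0 \<and> code_hd a \<noteq> 0 \<and>
        (\<exists>y. entry c (code_cons (code_hd a - 1) (code_tl a)) y \<in> S \<and>
          entry (arg (arg c)) (code_cons (code_hd a - 1) (code_cons y (code_tl a))) r \<in> S)) \<or>
     (tag c = 5 \<and> entry (arg c) (code_cons r a) 0 \<in> S \<and>
        (\<forall>m<r. \<exists>y. 0 < y \<and> entry (arg c) (code_cons m a) y \<in> S))"

text \<open>Premises stand after their conclusion, so a derivation grows at its front and cannot
  justify itself in a circle.\<close>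

definition valid_derivation :: "nat list \<Rightarrow> bool" where
  "valid_derivation D \<longleftrightarrow> (\<forall>i<length D. justified (set (drop (Suc i) D))
     (tag (D ! i)) (tag (arg (D ! i))) (arg (arg (D ! i))))"

lemma entry_simps [simp]:
  "tag (entry c a r) = c" "tag (arg (entry c a r)) = a" "arg (arg (entry c a r)) = r"
  by (simp_all add: tag_def arg_def entry_def)

lemma entry_inject [simp]: "entry c a r = entry c' a' r' \<longleftrightarrow> c = c' \<and> a = a' \<and> r = r'"
  by (auto simp: entry_def prod_encode_eq)

lemma tag_arg_prod_encode [simp]: "tag (prod_encode (x, y)) = x" "arg (prod_encode (x, y)) = y"
  by (simp_all add: tag_def arg_def)

lemma valid_derivation_Nil [simp]: "valid_derivation []"
  by (simp add: valid_derivation_def)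

lemma valid_derivation_Cons [simp]:
  "valid_derivation (e # D) \<longleftrightarrow>
     justified (set D) (tag e) (tag (arg e)) (arg (arg e)) \<and> valid_derivation D"
  by (auto simp: valid_derivation_def All_less_Suc2)

text \<open>The constructors of \<open>recf\<close> have different tags, so only the disjuncts of
  the matching constructor remain.\<close>

lemma justified_sound:
  assumes "justified S (code f) (list_encode xs) r"
    and S: "\<And>f xs r. entry (code f) (list_encode xs) r \<in> S \<Longrightarrow> rec_eval f xs r"
  shows "rec_eval f xs r"
proof (cases f)
  case RZero
  then show ?thesis using assms(1) by (auto simp: justified_def intro: rec_eval.zero)
next
  case RSucc
  then show ?thesis using assms(1) by (cases xs) (auto simp: justified_def simp del: list_encode.simps intro: rec_eval.succ)
next
  case (RProj i)
  then show ?thesis using assms(1) by (auto simp: justified_def intro: rec_eval.proj)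
next
  case (RComp f' gs)
  then obtain b where b: "entry (code f') b r \<in> S" "code_length b = length gs"
      "\<And>i. i < length gs \<Longrightarrow> entry (code (gs ! i)) (list_encode xs) (code_nth b i) \<in> S"
    using assms(1) by (auto simp: justified_def)
  \<comment> \<open>Every number codes a list, so the intermediate results may be taken to be a list
    \<open>ys\<close>.\<close>
  have "b = list_encode (list_decode b)" by simp
  then obtain ys where ys: "b = list_encode ys" by blast
  show ?thesis
    unfolding RComp
    by (rule rec_eval.comp[where ys = ys]) (use b ys in \<open>auto simp: list_all2_conv_all_nth intro!: S\<close>)
next
  case (RPrim f' g)
  then obtain x ys where xs: "xs = x # ys"
    using assms(1) by (cases xs) (auto simp: justified_def)
  show ?thesis
  proof (cases x)
    case 0
    then show ?thesis
      using assms(1) S[of f' ys] by (auto simp: justified_def RPrim xs simp del: list_encode.simps intro: rec_eval.prim_0)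
  next
    case (Suc m)
    then obtain y where y: "entry (code f) (list_encode (m # ys)) y \<in> S"
        "entry (code g) (list_encode (m # y # ys)) r \<in> S"
      using assms(1) by (auto simp: justified_def RPrim xs simp del: list_encode.simps)
    show ?thesis
      using S[OF y(1)] S[OF y(2)] by (auto simp: RPrim xs Suc intro: rec_eval.prim_Suc)
  qed
next
  case (RMin f')
  then have "entry (code f') (list_encode (r # xs)) 0 \<in> S"
      "\<forall>m<r. \<exists>y. 0 < y \<and> entry (code f') (list_encode (m # xs)) y \<in> S"
    using assms(1) by (auto simp: justified_def simp del: list_encode.simps)
  then show ?thesis unfolding RMin using S by (intro rec_eval.minim) blast+
qed

lemma valid_derivation_sound:
  "valid_derivation D \<Longrightarrow> entry (code f) (list_encode xs) r \<in> set D \<Longrightarrow> rec_eval f xs r"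
proof (induction D arbitrary: f xs r)
  case (Cons e D)
  then show ?case
    using justified_sound[of "set D" f xs r] by auto
qed simp

text \<open>\<open>S\<close> occurs only positively in \<open>justified\<close>. This is why
  derivations can be extended and concatenated.\<close>

lemma justified_mono: "justified S c a r \<Longrightarrow> S \<subseteq> S' \<Longrightarrow> justified S' c a r"
  unfolding justified_def by (elim disj_forward) (fast | blast)+

lemma valid_derivation_append:
  "valid_derivation D \<Longrightarrow> valid_derivation D' \<Longrightarrow> valid_derivation (D @ D')"
  by (induction D) (auto elim: justified_mono)

definition derivable :: "nat \<Rightarrow> bool" where
  "derivable e \<longleftrightarrow> (\<exists>D. valid_derivation D \<and> e \<in> set D)"

text \<open>A rule such as \<open>comp\<close> or \<open>minim\<close> has several premises with
  separate derivations; their concatenation contains all of them.\<close>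

lemma finite_derivable:
  assumes "finite S" "\<And>e. e \<in> S \<Longrightarrow> derivable e"
  shows "\<exists>D. valid_derivation D \<and> S \<subseteq> set D"
  using assms
proof (induction S)
  case empty
  show ?case by (intro exI[of _ "[]"]) simp
next
  case (insert e S)
  then obtain D where "valid_derivation D" "S \<subseteq> set D" by auto
  moreover obtain D' where "valid_derivation D'" "e \<in> set D'"
    using insert.prems unfolding derivable_def by blast
  ultimately show ?case by (intro exI[of _ "D @ D'"]) (auto intro: valid_derivation_append)
qed

lemma derivable_step:
  assumes "justified S c a r" "finite S" "\<And>e. e \<in> S \<Longrightarrow> derivable e"
  shows "derivable (entry c a r)"
proof -
  obtain D where "valid_derivation D" "S \<subseteq> set D"
    using finite_derivable[OF assms(2,3)] by blast
  then show ?thesis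
    using justified_mono[OF assms(1)] unfolding derivable_def
    by (intro exI[of _ "entry c a r # D"]) auto
qed

lemma rec_eval_derivable: "rec_eval f xs r \<Longrightarrow> derivable (entry (code f) (list_encode xs) r)"
proof (induction rule: rec_eval.induct)
  case (zero xs)
  show ?case by (rule derivable_step[of "{}"]) (auto simp: justified_def)
next
  case (succ x xs)
  show ?case
    by (rule derivable_step[of "{}"]) (auto simp: justified_def simp del: list_encode.simps)
next
  case (proj i xs)
  then show ?case by (intro derivable_step[of "{}"]) (auto simp: justified_def)
next
  case (comp xs gs ys f z)
  let ?S = "insert (entry (code f) (list_encode ys) z)
    ((\<lambda>i. entry (code (gs ! i)) (list_encode xs) (ys ! i)) ` {..<length ys})"
  have len: "length gs = length ys" using comp.IH(1) by (rule list_all2_lengthD)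
  show ?case
  proof (rule derivable_step[of ?S])
    show "justified ?S (code (RComp f gs)) (list_encode xs) z"
      by (auto simp: justified_def len intro!: exI[of _ "list_encode ys"])
    show "derivable e" if "e \<in> ?S" for e
      using that comp by (auto simp: list_all2_conv_all_nth)
  qed simp
next
  case (prim_0 f xs y g)
  then show ?case
    by (intro derivable_step[of "{entry (code f) (list_encode xs) y}"])
      (auto simp: justified_def simp del: list_encode.simps)
next
  case (prim_Suc f g n xs y z)
  then show ?case
    by (intro derivable_step[of "{entry (code (RPrim f g)) (list_encode (n # xs)) y,
        entry (code g) (list_encode (n # y # xs)) z}"])
      (auto simp: justified_def simp del: list_encode.simps)
next
  case (minim f n xs)
  then obtain y where y: "\<And>m. m < n \<Longrightarrow> y m > 0"
      "\<And>m. m < n \<Longrightarrow> derivable (entry (code f) (list_encode (m # xs)) (y m))"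
    by metis
  show ?case
    by (rule derivable_step[of "insert (entry (code f) (list_encode (n # xs)) 0)
        ((\<lambda>m. entry (code f) (list_encode (m # xs)) (y m)) ` {..<n})"])
      (use minim y in \<open>auto simp: justified_def simp del: list_encode.simps\<close>)
qed

section \<open>Derivations can be checked recursively\<close>

lemma recursive_tag: "recursive n a \<Longrightarrow> recursive n (\<lambda>xs. tag (a xs))"
  unfolding tag_def by (rule recursive_fst_prod_decode)

lemma recursive_arg: "recursive n a \<Longrightarrow> recursive n (\<lambda>xs. arg (a xs))"
  unfolding arg_def by (rule recursive_snd_prod_decode)

lemma recursive_entry:
  "recursive n c \<Longrightarrow> recursive n a \<Longrightarrow> recursive n r \<Longrightarrow> recursive n (\<lambda>xs. entry (c xs) (a xs) (r xs))"
  unfolding entry_def by (intro recursive_prod_encode)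

lemma decidable_member_list_decode:
  assumes "recursive n e" "recursive n d"
  shows "decidable n (\<lambda>xs. e xs \<in> set (list_decode (d xs)))"
proof -
  have "decidable n (\<lambda>xs. \<exists>i<code_length (d xs). code_nth (d xs) i = e xs)"
    by (intro code_intros assms)
  moreover have "(\<exists>i<code_length d. code_nth d i = e) \<longleftrightarrow> e \<in> set (list_decode d)" for d e
    using code_length_list_encode[of "list_decode d"] code_nth_list_encode[of _ "list_decode d"]
    by (auto simp: in_set_conv_nth)
  ultimately show ?thesis by simp
qed

lemma entry_member_le:
  assumes "entry c a r \<in> set (list_decode d)" shows "a \<le> d" "r \<le> d"
proof -
  have "entry c a r < d" using member_less_list_encode[OF assms] by simp
  moreover have "a \<le> entry c a r" "r \<le> entry c a r"
    unfolding entry_def by (meson le_prod_encode_1 le_prod_encode_2 order_trans)+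
  ultimately show "a \<le> d" "r \<le> d" by linarith+
qed

lemma decidable_justified:
  assumes "recursive n d" "recursive n c" "recursive n a" "recursive n r"
  shows "decidable n (\<lambda>xs. justified (set (list_decode (d xs))) (c xs) (a xs) (r xs))"
proof -
  \<comment> \<open>The quantifiers over intermediate results are unbounded, but a witness occurs in
    an entry of the list coded by \<open>d\<close>, so \<open>d\<close> bounds it.\<close>
  have bounded: "(\<exists>b. entry x b r \<in> set (list_decode d) \<and> Q b) \<longleftrightarrow>
        (\<exists>b\<le>d. entry x b r \<in> set (list_decode d) \<and> Q b)"
      "(\<exists>y. entry x a y \<in> set (list_decode d) \<and> Q y) \<longleftrightarrow>
        (\<exists>y\<le>d. entry x a y \<in> set (list_decode d) \<and> Q y)"
      "(\<exists>y. 0 < y \<and> entry x a y \<in> set (list_decode d)) \<longleftrightarrow>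
        (\<exists>y\<le>d. 0 < y \<and> entry x a y \<in> set (list_decode d))" for x a r d Q
    using entry_member_le by blast+
  show ?thesis
    unfolding justified_def bounded
    by (intro decidable_member_list_decode recursive_entry recursive_tag recursive_arg code_intros assms)
qed

lemma decidable_valid_derivation:
  assumes "recursive n d" shows "decidable n (\<lambda>xs. valid_derivation (list_decode (d xs)))"
proof -
  let ?J = "\<lambda>d i e. justified (set (list_decode (code_drop d (Suc i)))) (tag e) (tag (arg e)) (arg (arg e))"
  have "decidable n (\<lambda>xs. \<forall>i<code_length (d xs). ?J (d xs) i (code_nth (d xs) i))"
    by (intro decidable_justified recursive_tag recursive_arg code_intros assms)
  moreover have "(\<forall>i<code_length d. ?J d i (code_nth d i)) \<longleftrightarrow> valid_derivation (list_decode d)" for d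
    using code_length_list_encode[of "list_decode d"] code_nth_list_encode[of _ "list_decode d"]
      code_drop_list_encode[of "list_decode d"]
    by (auto simp: valid_derivation_def)
  ultimately show ?thesis by simp
qed

text \<open>
  A derivation that the program with code \<open>c\<close> halts on its own code contains the output, so
  its code \<open>s\<close> is greater than the output.
\<close>

definition halting_time :: "nat \<Rightarrow> nat \<Rightarrow> bool" where
  "halting_time c s \<longleftrightarrow> valid_derivation (list_decode s) \<and>
     (\<exists>r\<le>s. entry c (list_encode [c]) r \<in> set (list_decode s))"

lemma decidable_halting_time:
  "recursive n a \<Longrightarrow> recursive n b \<Longrightarrow> decidable n (\<lambda>xs. halting_time (a xs) (b xs))"
  unfolding halting_time_def list_encode.simps
  by (intro decidable_valid_derivation decidable_member_list_decode recursive_entry code_intros)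

text \<open>The witness is the code of a program for \<open>g\<close> itself. Run on its own code it
  halts, and by determinism every derivation of this has the output \<open>g c\<close>.\<close>

lemma halting_time_dominates:
  assumes "recursive 1 (\<lambda>xs. g (xs ! 0))"
  shows "\<exists>c. (\<exists>s. halting_time c s) \<and> (\<forall>s. halting_time c s \<longrightarrow> g c < s)"
proof -
  obtain f where f: "\<And>xs. length xs = 1 \<Longrightarrow> rec_eval f xs (g (xs ! 0))"
    using assms unfolding recursive_def by auto
  let ?e = "entry (code f) (list_encode [code f])"
  have eval: "rec_eval f [code f] (g (code f))" using f[of "[code f]"] by simp
  then obtain D where D: "valid_derivation D" "?e (g (code f)) \<in> set D"
    using rec_eval_derivable unfolding derivable_def by blast
  have "halting_time (code f) (list_encode D)"
    using D entry_member_le(2)[of "code f" "list_encode [code f]" "g (code f)" "list_encode D"]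
    unfolding halting_time_def by auto
  moreover have "g (code f) < s" if s: "halting_time (code f) s" for s
  proof -
    obtain r where r: "valid_derivation (list_decode s)" "?e r \<in> set (list_decode s)"
      using s unfolding halting_time_def by blast
    then have "r = g (code f)"
      using valid_derivation_sound rec_eval_deterministic[OF _ eval] by blast
    moreover have "r \<le> ?e r"
      unfolding entry_def by (meson le_prod_encode_2 order_trans)
    moreover have "?e r < s" using member_less_list_encode[OF r(2)] by simp
    ultimately show ?thesis by linarith
  qed
  ultimately show ?thesis by blast
qed

section \<open>The C*-algebra of continuous functions\<close>

locale real_or_complex =
  fixes K :: "complex set"
  assumes scalars: "K = \<real> \<or> K = UNIV"
begin

lemma scalars_simps [simp]:
  "0 \<in> K" "1 \<in> K" "-1 \<in> K" "complex_of_real r \<in> K"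
  using scalars by auto

lemma scalars_closed:
  "x \<in> K \<Longrightarrow> y \<in> K \<Longrightarrow> x + y \<in> K" "x \<in> K \<Longrightarrow> y \<in> K \<Longrightarrow> x * y \<in> K"
  "x \<in> K \<Longrightarrow> y \<in> K \<Longrightarrow> x - y \<in> K" "x \<in> K \<Longrightarrow> cnj x \<in> K"
  using scalars by (auto simp: Reals_cnj_iff)

lemma closed_scalars: "closed K"
  using scalars closed_complex_Reals by auto

text \<open>In the real case a sum of real terms equals its own conjugate.\<close>

lemma infsum_scalars:
  assumes "\<And>x. f x \<in> K" shows "infsum f A \<in> K"
proof (cases "K = \<real>")
  case True
  then have "cnj (infsum f A) = infsum f A"
    using assms by (subst infsum_cnj[symmetric]) (simp add: Reals_cnj_iff)
  then show ?thesis by (simp add: True Reals_cnj_iff)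
qed (use scalars in auto)

end

subsection \<open>Square-summable families\<close>

definition l2_space :: "complex set \<Rightarrow> ('i \<Rightarrow> complex) ip_space" where
  "l2_space K = \<lparr>points = {v. range v \<subseteq> K \<and> (\<lambda>i. (cmod (v i))\<^sup>2) summable_on UNIV},
     vzero = (\<lambda>i. 0), vadd = (\<lambda>v w i. v i + w i), vscale = (\<lambda>c v i. c * v i),
     ip = (\<lambda>v w. \<Sum>\<^sub>\<infinity>i. v i * cnj (w i))\<rparr>"

lemma l2_space_simps [simp]:
  "v \<in> points (l2_space K) \<longleftrightarrow> range v \<subseteq> K \<and> (\<lambda>i. (cmod (v i))\<^sup>2) summable_on UNIV"
  "vzero (l2_space K) = (\<lambda>i. 0)"
  "vadd (l2_space K) v w = (\<lambda>i. v i + w i)"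
  "vscale (l2_space K) c v = (\<lambda>i. c * v i)"
  "ip (l2_space K) v w = (\<Sum>\<^sub>\<infinity>i. v i * cnj (w i))"
  "vminus (l2_space K) v w = (\<lambda>i. v i - w i)"
  by (simp_all add: l2_space_def vminus_def)

lemma square_summable_add:
  assumes "(\<lambda>i. (cmod (v i))\<^sup>2) summable_on A" "(\<lambda>i. (cmod (w i))\<^sup>2) summable_on A"
  shows "(\<lambda>i. (cmod (v i + w i))\<^sup>2) summable_on A"
proof (rule summable_on_comparison_test)
  show "(\<lambda>i. 2 * (cmod (v i))\<^sup>2 + 2 * (cmod (w i))\<^sup>2) summable_on A"
    by (intro summable_on_add summable_on_cmult_right assms)
  fix i
  have "(cmod (v i + w i))\<^sup>2 \<le> (cmod (v i) + cmod (w i))\<^sup>2"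
    by (simp add: norm_triangle_ineq power_mono)
  also have "\<dots> \<le> 2 * (cmod (v i))\<^sup>2 + 2 * (cmod (w i))\<^sup>2"
    using sum_squares_bound[of "cmod (v i)" "cmod (w i)"] by (simp add: power2_sum)
  finally show "(cmod (v i + w i))\<^sup>2 \<le> 2 * (cmod (v i))\<^sup>2 + 2 * (cmod (w i))\<^sup>2" .
qed simp

lemma square_summable_scale:
  assumes "(\<lambda>i. (cmod (v i))\<^sup>2) summable_on A" "\<And>i. cmod (c i) \<le> M"
  shows "(\<lambda>i. (cmod (c i * v i))\<^sup>2) summable_on A"
proof (rule summable_on_comparison_test)
  show "(\<lambda>i. M\<^sup>2 * (cmod (v i))\<^sup>2) summable_on A"
    by (intro summable_on_cmult_right assms)
  show "(cmod (c i * v i))\<^sup>2 \<le> M\<^sup>2 * (cmod (v i))\<^sup>2" for i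
    using assms(2) by (simp add: norm_mult power_mult_distrib mult_right_mono power_mono)
qed simp

lemma square_summable_diff:
  assumes "(\<lambda>i. (cmod (v i))\<^sup>2) summable_on A" "(\<lambda>i. (cmod (w i))\<^sup>2) summable_on A"
  shows "(\<lambda>i. (cmod (v i - w i))\<^sup>2) summable_on A"
  using square_summable_add[OF assms(1), of "\<lambda>i. - w i"] assms(2) by simp

lemma summable_ip:
  assumes "(\<lambda>i. (cmod (v i))\<^sup>2) summable_on A" "(\<lambda>i. (cmod (w i))\<^sup>2) summable_on A"
  shows "(\<lambda>i. v i * cnj (w i)) summable_on A"
proof (rule abs_summable_summable, rule Infinite_Sum.abs_summable_on_comparison_test')
  show "(\<lambda>i. (cmod (v i))\<^sup>2 + (cmod (w i))\<^sup>2) summable_on A"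
    by (intro summable_on_add assms)
  fix i
  have "2 * (cmod (v i) * cmod (w i)) \<le> (cmod (v i))\<^sup>2 + (cmod (w i))\<^sup>2"
    using sum_squares_bound[of "cmod (v i)" "cmod (w i)"] by simp
  moreover have "0 \<le> cmod (v i) * cmod (w i)" by simp
  ultimately show "norm (v i * cnj (w i)) \<le> (cmod (v i))\<^sup>2 + (cmod (w i))\<^sup>2"
    unfolding norm_mult complex_mod_cnj by linarith
qed

text \<open>This holds for every family: if the squares are not summable, both infinite sums have
  the default value 0.\<close>

lemma ip_self_eq: "(\<Sum>\<^sub>\<infinity>i\<in>A. v i * cnj (v i)) = of_real (\<Sum>\<^sub>\<infinity>i\<in>A. (cmod (v i))\<^sup>2)"
proof -
  have eq: "(\<lambda>i. v i * cnj (v i)) = (\<lambda>i. complex_of_real ((cmod (v i))\<^sup>2))"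
    by (simp only: complex_norm_square)
  show ?thesis
  proof (cases "(\<lambda>i. (cmod (v i))\<^sup>2) summable_on A")
    case True
    then show ?thesis unfolding eq by (intro infsumI has_sum_of_real) simp
  next
    case False
    then have "\<not> (\<lambda>i. complex_of_real ((cmod (v i))\<^sup>2)) summable_on A"
      using summable_on_Re by fastforce
    then show ?thesis unfolding eq using False by (simp add: infsum_not_exists)
  qed
qed

lemma hnorm_l2_space: "hnorm (l2_space K) v = sqrt (\<Sum>\<^sub>\<infinity>i. (cmod (v i))\<^sup>2)"
  by (simp add: hnorm_def ip_self_eq)

lemma hnorm_l2_nonneg: "0 \<le> hnorm (l2_space K) v"
  by (simp add: hnorm_l2_space infsum_nonneg)

lemma L2_set_le_hnorm:
  assumes "v \<in> points (l2_space K)" "finite F"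
  shows "L2_set (\<lambda>i. cmod (v i)) F \<le> hnorm (l2_space K) v"
  using assms unfolding L2_set_def hnorm_l2_space
  by (intro real_sqrt_le_mono finite_sum_le_infsum) auto

lemma cmod_le_hnorm: "v \<in> points (l2_space K) \<Longrightarrow> cmod (v i) \<le> hnorm (l2_space K) v"
  using L2_set_le_hnorm[of v K "{i}"] by simp

text \<open>The norm is the supremum of the norms of finite subfamilies, so inequalities are
  inherited from \<open>L2_set\<close>.\<close>

lemma hnorm_l2_le:
  assumes "v \<in> points (l2_space K)" "0 \<le> c" "\<And>F. finite F \<Longrightarrow> L2_set (\<lambda>i. cmod (v i)) F \<le> c"
  shows "hnorm (l2_space K) v \<le> c"
proof -
  have "(\<Sum>\<^sub>\<infinity>i. (cmod (v i))\<^sup>2) \<le> c\<^sup>2"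
  proof (rule infsum_le_finite_sums)
    fix F :: "'a set" assume "finite F"
    then have "(L2_set (\<lambda>i. cmod (v i)) F)\<^sup>2 \<le> c\<^sup>2"
      by (intro power_mono assms) auto
    then show "(\<Sum>i\<in>F. (cmod (v i))\<^sup>2) \<le> c\<^sup>2"
      by (simp add: L2_set_def sum_nonneg)
  qed (use assms in auto)
  then show ?thesis
    unfolding hnorm_l2_space using assms(2) real_le_lsqrt by blast
qed

lemma hnorm_l2_triangle:
  assumes "v \<in> points (l2_space K)" "w \<in> points (l2_space K)" "(\<lambda>i. v i + w i) \<in> points (l2_space K)"
  shows "hnorm (l2_space K) (\<lambda>i. v i + w i) \<le> hnorm (l2_space K) v + hnorm (l2_space K) w"
proof (rule hnorm_l2_le)
  fix F :: "'a set" assume F: "finite F"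
  have "L2_set (\<lambda>i. cmod (v i + w i)) F \<le> L2_set (\<lambda>i. cmod (v i) + cmod (w i)) F"
    by (intro L2_set_mono norm_triangle_ineq) auto
  also have "\<dots> \<le> L2_set (\<lambda>i. cmod (v i)) F + L2_set (\<lambda>i. cmod (w i)) F"
    by (rule L2_set_triangle_ineq)
  also have "\<dots> \<le> hnorm (l2_space K) v + hnorm (l2_space K) w"
    by (intro add_mono L2_set_le_hnorm assms F)
  finally show "L2_set (\<lambda>i. cmod (v i + w i)) F \<le> hnorm (l2_space K) v + hnorm (l2_space K) w" .
qed (use assms in \<open>auto intro: add_nonneg_nonneg hnorm_l2_nonneg\<close>)

context real_or_complex
begin

lemma l2_diff_closed:
  "v \<in> points (l2_space K) \<Longrightarrow> w \<in> points (l2_space K) \<Longrightarrow> (\<lambda>i. v i - w i) \<in> points (l2_space K)"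
  by (auto intro: square_summable_diff scalars_closed(3))

lemma Metric_space_l2: "Metric_space (points (l2_space K)) (hdist (l2_space K :: ('i \<Rightarrow> complex) ip_space))"
proof
  let ?H = "l2_space K :: ('i \<Rightarrow> complex) ip_space"
  show "0 \<le> hdist ?H v w" for v w
    by (simp add: hdist_def hnorm_l2_nonneg del: l2_space_simps(1))
  show "hdist ?H v w = hdist ?H w v" for v w
    by (simp add: hdist_def hnorm_l2_space norm_minus_commute)
  show "hdist ?H v w = 0 \<longleftrightarrow> v = w" if "v \<in> points ?H" "w \<in> points ?H" for v w
  proof
    assume "hdist ?H v w = 0"
    then have "cmod (v i - w i) \<le> 0" for i
      using cmod_le_hnorm[OF l2_diff_closed[OF that], of i] that by (simp add: hdist_def)
    then show "v = w" by (intro ext) simp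
  qed (use that in \<open>simp add: hdist_def hnorm_l2_space\<close>)
  show "hdist ?H u w \<le> hdist ?H u v + hdist ?H v w"
    if "u \<in> points ?H" "v \<in> points ?H" "w \<in> points ?H" for u v w
    using hnorm_l2_triangle[OF l2_diff_closed[OF that(1,2)] l2_diff_closed[OF that(2,3)]]
      l2_diff_closed[OF that(1,3)] that by (simp add: hdist_def del: l2_space_simps(1))
qed

lemma mcomplete_l2: "Metric_space.mcomplete (points (l2_space K)) (hdist (l2_space K :: ('i \<Rightarrow> complex) ip_space))"
proof -
  let ?H = "l2_space K :: ('i \<Rightarrow> complex) ip_space"
  interpret Metric_space "points ?H" "hdist ?H" by (rule Metric_space_l2)
  show ?thesis
    unfolding mcomplete_def
  proof (intro allI impI)
    fix \<sigma> assume "MCauchy \<sigma>"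
    then have \<sigma>: "\<And>n. \<sigma> n \<in> points ?H"
      and cauchy: "\<And>e. e > 0 \<Longrightarrow> \<exists>N. \<forall>m\<ge>N. \<forall>n\<ge>N. hdist ?H (\<sigma> m) (\<sigma> n) < e"
      unfolding MCauchy_def image_subset_iff by blast+
    have dist: "hdist ?H (\<sigma> m) (\<sigma> n) = hnorm ?H (\<lambda>i. \<sigma> m i - \<sigma> n i)" for m n
      using \<sigma> by (simp add: hdist_def del: l2_space_simps(1))
    have "Cauchy (\<lambda>n. \<sigma> n i)" for i
    proof (rule metric_CauchyI)
      fix e :: real assume "e > 0"
      then obtain N where "\<forall>m\<ge>N. \<forall>n\<ge>N. hdist ?H (\<sigma> m) (\<sigma> n) < e" using cauchy by blast
      moreover have "dist (\<sigma> m i) (\<sigma> n i) \<le> hdist ?H (\<sigma> m) (\<sigma> n)" for m n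
        using cmod_le_hnorm[OF l2_diff_closed[OF \<sigma> \<sigma>]] by (simp add: dist dist_norm)
      ultimately show "\<exists>N. \<forall>m\<ge>N. \<forall>n\<ge>N. dist (\<sigma> m i) (\<sigma> n i) < e"
        using order.strict_trans1 by blast
    qed
    then have "\<exists>x. (\<lambda>n. \<sigma> n i) \<longlonglongrightarrow> x" for i
      by (simp add: Cauchy_convergent_iff convergent_def)
    then obtain l where l: "\<And>i. (\<lambda>n. \<sigma> n i) \<longlonglongrightarrow> l i" by metis
    \<comment> \<open>The convergence is only pointwise, but on a finite set of indices this
      suffices to pass to the limit in the Cauchy condition.\<close>
    have tail: "L2_set (\<lambda>i. cmod (\<sigma> n i - l i)) F \<le> e"
      if "finite F" and N: "\<forall>m\<ge>N. \<forall>n\<ge>N. hdist ?H (\<sigma> m) (\<sigma> n) < e" "n \<ge> N" for e N n F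
    proof (rule LIMSEQ_le_const2)
      show "(\<lambda>m. L2_set (\<lambda>i. cmod (\<sigma> n i - \<sigma> m i)) F) \<longlonglongrightarrow> L2_set (\<lambda>i. cmod (\<sigma> n i - l i)) F"
        unfolding L2_set_def by (intro tendsto_intros l)
      show "\<exists>N. \<forall>m\<ge>N. L2_set (\<lambda>i. cmod (\<sigma> n i - \<sigma> m i)) F \<le> e"
        using L2_set_le_hnorm[OF l2_diff_closed[OF \<sigma> \<sigma>] that(1)] N
        unfolding dist by (meson less_imp_le order_trans)
    qed
    have diff: "(\<lambda>i. \<sigma> n i - l i) \<in> points ?H \<and> hnorm ?H (\<lambda>i. \<sigma> n i - l i) \<le> e"
      if "e > 0" and N: "\<forall>m\<ge>N. \<forall>n\<ge>N. hdist ?H (\<sigma> m) (\<sigma> n) < e" "n \<ge> N" for e N n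
    proof -
      have "l i \<in> K" for i
        by (rule closed_sequentially[OF closed_scalars _ l]) (use \<sigma> in auto)
      then have "range (\<lambda>i. \<sigma> n i - l i) \<subseteq> K"
        using \<sigma>[of n] by (auto intro: scalars_closed(3))
      moreover have "(\<lambda>i. (cmod (\<sigma> n i - l i))\<^sup>2) summable_on UNIV"
      proof (rule nonneg_bdd_above_summable_on)
        have "(\<Sum>i\<in>F. (cmod (\<sigma> n i - l i))\<^sup>2) \<le> e\<^sup>2" if "finite F" for F
          using power_mono[OF tail[OF that N] L2_set_nonneg, of 2] by (simp add: L2_set_def sum_nonneg)
        then show "bdd_above (sum (\<lambda>i. (cmod (\<sigma> n i - l i))\<^sup>2) ` {F. F \<subseteq> UNIV \<and> finite F})"
          by (intro bdd_aboveI2[where M = "e\<^sup>2"]) auto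
      qed simp
      ultimately have mem: "(\<lambda>i. \<sigma> n i - l i) \<in> points ?H" by simp
      moreover have "hnorm ?H (\<lambda>i. \<sigma> n i - l i) \<le> e"
        using \<open>e > 0\<close> by (intro hnorm_l2_le[OF mem] tail[OF _ N]) auto
      ultimately show ?thesis by blast
    qed
    obtain N1 where N1: "\<forall>m\<ge>N1. \<forall>n\<ge>N1. hdist ?H (\<sigma> m) (\<sigma> n) < 1"
      using cauchy[of 1] by auto
    \<comment> \<open>Square-summability is so far known for the difference of
      \<open>\<sigma> N1\<close> and \<open>l\<close> only; subtracting it from
      \<open>\<sigma> N1\<close> gives \<open>l\<close>.\<close>
    have "(\<lambda>i. \<sigma> N1 i - (\<sigma> N1 i - l i)) \<in> points ?H"
      by (rule l2_diff_closed[OF \<sigma> conjunct1[OF diff[OF zero_less_one N1 order_refl]]])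
    moreover have "(\<lambda>i. \<sigma> N1 i - (\<sigma> N1 i - l i)) = l" by auto
    ultimately have lmem: "l \<in> points ?H" by (simp only:)
    have "limitin mtopology \<sigma> l sequentially"
      unfolding limit_metric_sequentially
    proof (intro conjI allI impI lmem)
      fix e :: real assume "e > 0"
      then obtain N where N: "\<forall>m\<ge>N. \<forall>n\<ge>N. hdist ?H (\<sigma> m) (\<sigma> n) < e / 2"
        using cauchy[of "e / 2"] by auto
      have "hdist ?H (\<sigma> n) l < e" if "n \<ge> N" for n
        using diff[OF _ N that] \<open>e > 0\<close> \<sigma> lmem by (simp add: hdist_def del: l2_space_simps(1))
      then show "\<exists>N. \<forall>n\<ge>N. \<sigma> n \<in> points ?H \<and> hdist ?H (\<sigma> n) l < e"
        using \<sigma> by blast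
    qed
    then show "\<exists>x. limitin mtopology \<sigma> x sequentially" by blast
  qed
qed

lemma hilbert_space_l2: "hilbert_space_over K (l2_space K :: ('i \<Rightarrow> complex) ip_space)"
proof
  let ?H = "l2_space K :: ('i \<Rightarrow> complex) ip_space"
  show "vscale ?H c x \<in> points ?H" if "c \<in> K" "x \<in> points ?H" for c x
    using that square_summable_scale[of x UNIV "\<lambda>i. c" "cmod c"] by (auto intro: scalars_closed(2))
  show "\<exists>y\<in>points ?H. vadd ?H x y = vzero ?H" if "x \<in> points ?H" for x
    using that scalars_closed(3)[OF scalars_simps(1)]
    by (intro bexI[of _ "\<lambda>i. - x i"]) auto
  show "ip ?H v w \<in> K" if "v \<in> points ?H" "w \<in> points ?H" for v w
    unfolding l2_space_simps by (intro infsum_scalars scalars_closed(2,4)) (use that in auto)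
  show "ip ?H (vadd ?H u v) w = ip ?H u w + ip ?H v w"
    if "u \<in> points ?H" "v \<in> points ?H" "w \<in> points ?H" for u v w
    using that by (simp add: distrib_right infsum_add summable_ip)
  show "ip ?H (vscale ?H c v) w = c * ip ?H v w" for c v w
    by (simp add: mult.assoc infsum_cmult_right')
  show "ip ?H w v = cnj (ip ?H v w)" for v w
    by (simp add: mult.commute flip: infsum_cnj)
  show "0 \<le> Re (ip ?H v v)" for v
    by (simp add: ip_self_eq infsum_nonneg)
  show "v = vzero ?H" if "v \<in> points ?H" "ip ?H v v = 0" for v
  proof -
    have "hnorm ?H v = 0" using that by (simp add: hnorm_def)
    then have "cmod (v i) \<le> 0" for i using cmod_le_hnorm[OF that(1), of i] by simp
    then show ?thesis by (intro ext) simp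
  qed
  show "Metric_space.mcomplete (points ?H) (hdist ?H)" by (rule mcomplete_l2)
qed (auto intro: square_summable_add scalars_closed simp: algebra_simps)

end

subsection \<open>Continuous functions\<close>

lemma cont_simps [simp]:
  "f \<in> points (cont_unit_interval K) \<longleftrightarrow>
     continuous_on {0..1} f \<and> (\<forall>t\<in>{0..1}. f t \<in> K) \<and> (\<forall>t. t \<notin> {0..1} \<longrightarrow> f t = 0)"
  "vzero (cont_unit_interval K) = (\<lambda>t. 0)"
  "vadd (cont_unit_interval K) f g = (\<lambda>t. f t + g t)"
  "vscale (cont_unit_interval K) c f = (\<lambda>t. c * f t)"
  "amult (cont_unit_interval K) f g = (\<lambda>t. f t * g t)"
  "astar (cont_unit_interval K) f = (\<lambda>t. cnj (f t))"
  "vminus (cont_unit_interval K) f g = (\<lambda>t. f t - g t)"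
  by (auto simp: cont_unit_interval_def vminus_def)

lemma cont_norm_eq: "anorm (cont_unit_interval K) f = (SUP t\<in>{0..1}. cmod (f t))"
  by (simp add: cont_unit_interval_def)

lemma cmod_le_cont_norm:
  assumes "f \<in> points (cont_unit_interval K)"
  shows "cmod (f t) \<le> anorm (cont_unit_interval K) f"
proof -
  have "compact ((\<lambda>t. cmod (f t)) ` {0..1})"
    by (intro compact_continuous_image continuous_intros) (use assms in auto)
  then have bdd: "bdd_above ((\<lambda>t. cmod (f t)) ` {0..1})"
    by (intro bounded_imp_bdd_above compact_imp_bounded)
  have le: "cmod (f s) \<le> anorm (cont_unit_interval K) f" if "s \<in> {0..1}" for s
    unfolding cont_norm_eq by (rule cSUP_upper[OF that bdd])
  show ?thesis
  proof (cases "t \<in> {0..1}")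
    case False
    then have "cmod (f t) \<le> cmod (f 0)" using assms by simp
    then show ?thesis using le[of 0] by simp
  qed (rule le)
qed

lemma cont_norm_least:
  "(\<And>t. t \<in> {0..1} \<Longrightarrow> cmod (f t) \<le> c) \<Longrightarrow> anorm (cont_unit_interval K) f \<le> c"
  unfolding cont_norm_eq by (rule cSUP_least) auto

lemma cont_norm_nonneg: "f \<in> points (cont_unit_interval K) \<Longrightarrow> 0 \<le> anorm (cont_unit_interval K) f"
  using cmod_le_cont_norm[of f K 0] order_trans[OF norm_ge_zero] by blast

context real_or_complex
begin

abbreviation "A \<equiv> cont_unit_interval K"

lemma cont_closed:
  "f \<in> points A \<Longrightarrow> g \<in> points A \<Longrightarrow> (\<lambda>t. f t + g t) \<in> points A"
  "f \<in> points A \<Longrightarrow> g \<in> points A \<Longrightarrow> (\<lambda>t. f t - g t) \<in> points A"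
  "f \<in> points A \<Longrightarrow> g \<in> points A \<Longrightarrow> (\<lambda>t. f t * g t) \<in> points A"
  "f \<in> points A \<Longrightarrow> c \<in> K \<Longrightarrow> (\<lambda>t. c * f t) \<in> points A"
  "f \<in> points A \<Longrightarrow> (\<lambda>t. cnj (f t)) \<in> points A"
  "(\<lambda>t. 0) \<in> points A"
  by (auto intro!: continuous_intros scalars_closed)

lemma cont_adist: "f \<in> points A \<Longrightarrow> g \<in> points A \<Longrightarrow> adist A f g = anorm A (\<lambda>t. f t - g t)"
  by (simp add: adist_def)

lemma cont_norm_triangle:
  assumes "f \<in> points A" "g \<in> points A"
  shows "anorm A (\<lambda>t. f t + g t) \<le> anorm A f + anorm A g"
proof (rule cont_norm_least)
  fix t
  show "cmod (f t + g t) \<le> anorm A f + anorm A g"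
    using norm_triangle_ineq[of "f t" "g t"] cmod_le_cont_norm[OF assms(1), of t]
      cmod_le_cont_norm[OF assms(2), of t] by linarith
qed

lemma cont_norm_eq_0: "f \<in> points A \<Longrightarrow> anorm A f = 0 \<longleftrightarrow> f = (\<lambda>t. 0)"
  using cmod_le_cont_norm[of f K] by (auto simp: cont_norm_eq)

lemma Metric_space_cont: "Metric_space (points A) (adist A)"
proof
  show "0 \<le> adist A f g" for f g
    using cont_norm_nonneg[OF cont_closed(2)] by (simp add: adist_def del: cont_simps(1))
  show "adist A f g = adist A g f" for f g
    by (simp add: adist_def cont_norm_eq norm_minus_commute del: cont_simps(1))
  show "adist A f g = 0 \<longleftrightarrow> f = g" if "f \<in> points A" "g \<in> points A" for f g
    unfolding cont_adist[OF that] cont_norm_eq_0[OF cont_closed(2)[OF that]]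
    by (auto simp: fun_eq_iff)
  show "adist A f h \<le> adist A f g + adist A g h"
    if "f \<in> points A" "g \<in> points A" "h \<in> points A" for f g h
    using cont_norm_triangle[OF cont_closed(2)[OF that(1,2)] cont_closed(2)[OF that(2,3)]] that
    by (simp add: cont_adist del: cont_simps(1))
qed

lemma mcomplete_cont: "Metric_space.mcomplete (points A) (adist A)"
proof -
  interpret Metric_space "points A" "adist A" by (rule Metric_space_cont)
  show ?thesis
    unfolding mcomplete_def
  proof (intro allI impI)
    fix \<sigma> assume "MCauchy \<sigma>"
    then have \<sigma>: "\<And>n. \<sigma> n \<in> points A"
      and cauchy: "\<And>e. e > 0 \<Longrightarrow> \<exists>N. \<forall>m\<ge>N. \<forall>n\<ge>N. adist A (\<sigma> m) (\<sigma> n) < e"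
      unfolding MCauchy_def image_subset_iff by blast+
    have dist: "cmod (\<sigma> m t - \<sigma> n t) \<le> adist A (\<sigma> m) (\<sigma> n)" for m n t
      using cmod_le_cont_norm[OF cont_closed(2)[OF \<sigma> \<sigma>]] by (simp add: cont_adist[OF \<sigma> \<sigma>])
    have "Cauchy (\<lambda>n. \<sigma> n t)" for t
    proof (rule metric_CauchyI)
      fix e :: real assume "e > 0"
      then show "\<exists>N. \<forall>m\<ge>N. \<forall>n\<ge>N. dist (\<sigma> m t) (\<sigma> n t) < e"
        using cauchy[of e] dist order.strict_trans1 unfolding dist_norm by blast
    qed
    then have "\<exists>x. (\<lambda>n. \<sigma> n t) \<longlonglongrightarrow> x" for t
      by (simp add: Cauchy_convergent_iff convergent_def)
    then obtain l where l: "\<And>t. (\<lambda>n. \<sigma> n t) \<longlonglongrightarrow> l t" by metis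
    have tail: "cmod (\<sigma> n t - l t) \<le> e"
      if N: "\<forall>m\<ge>N. \<forall>n\<ge>N. adist A (\<sigma> m) (\<sigma> n) < e" "n \<ge> N" for e N n t
    proof (rule LIMSEQ_le_const2)
      show "(\<lambda>m. cmod (\<sigma> n t - \<sigma> m t)) \<longlonglongrightarrow> cmod (\<sigma> n t - l t)"
        by (intro tendsto_intros l)
      show "\<exists>N. \<forall>m\<ge>N. cmod (\<sigma> n t - \<sigma> m t) \<le> e"
        using dist N by (meson less_imp_le order_trans)
    qed
    have "uniform_limit {0..1} \<sigma> l sequentially"
    proof (rule uniform_limitI)
      fix e :: real assume "e > 0"
      then obtain N where N: "\<forall>m\<ge>N. \<forall>n\<ge>N. adist A (\<sigma> m) (\<sigma> n) < e / 2"
        using cauchy[of "e / 2"] by auto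
      show "\<forall>\<^sub>F n in sequentially. \<forall>x\<in>{0..1}. dist (\<sigma> n x) (l x) < e"
        unfolding eventually_sequentially dist_norm
      proof (intro exI[of _ N] allI impI ballI)
        fix n x assume "N \<le> n"
        then show "norm (\<sigma> n x - l x) < e" using tail[OF N, of n x] \<open>e > 0\<close> by simp
      qed
    qed
    then have "continuous_on {0..1} l"
      by (rule uniform_limit_theorem[rotated]) (use \<sigma> in auto)
    moreover have "l t \<in> K" if "t \<in> {0..1}" for t
      by (rule closed_sequentially[OF closed_scalars _ l]) (use \<sigma> that in auto)
    moreover have "l t = 0" if "t \<notin> {0..1}" for t
      using l[of t] \<sigma> that by (simp add: LIMSEQ_const_iff)
    ultimately have lmem: "l \<in> points A" by auto
    have "limitin mtopology \<sigma> l sequentially"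
      unfolding limit_metric_sequentially
    proof (intro conjI allI impI lmem)
      fix e :: real assume "e > 0"
      then obtain N where N: "\<forall>m\<ge>N. \<forall>n\<ge>N. adist A (\<sigma> m) (\<sigma> n) < e / 2"
        using cauchy[of "e / 2"] by auto
      have "adist A (\<sigma> n) l < e" if "n \<ge> N" for n
      proof -
        have "adist A (\<sigma> n) l \<le> e / 2"
          unfolding cont_adist[OF \<sigma> lmem] by (intro cont_norm_least tail[OF N that])
        then show ?thesis using \<open>e > 0\<close> by simp
      qed
      then show "\<exists>N. \<forall>n\<ge>N. \<sigma> n \<in> points A \<and> adist A (\<sigma> n) l < e"
        using \<sigma> by blast
    qed
    then show "\<exists>x. limitin mtopology \<sigma> x sequentially" by blast
  qed
qed

lemma banach_star_algebra_cont: "banach_star_algebra K A"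
proof
  show "\<exists>y\<in>points A. vadd A x y = vzero A" if "x \<in> points A" for x
    using cont_closed(2)[OF cont_closed(6) that] by (intro bexI[of _ "\<lambda>t. 0 - x t"]) auto
  show "0 \<le> anorm A x" if "x \<in> points A" for x
    using that by (rule cont_norm_nonneg)
  show "anorm A x = 0 \<longleftrightarrow> x = vzero A" if "x \<in> points A" for x
    using cont_norm_eq_0[OF that] by simp
  show "anorm A (vadd A x y) \<le> anorm A x + anorm A y" if "x \<in> points A" "y \<in> points A" for x y
    using cont_norm_triangle[OF that] by simp
  show "anorm A (vscale A c x) = cmod c * anorm A x" if "c \<in> K" "x \<in> points A" for c x
  proof (rule antisym)
    show "anorm A (vscale A c x) \<le> cmod c * anorm A x"
      using cmod_le_cont_norm[OF that(2)] by (intro cont_norm_least) (simp add: norm_mult mult_left_mono)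
    have "anorm A x \<le> anorm A (\<lambda>t. c * x t) / cmod c" if "c \<noteq> 0"
    proof (rule cont_norm_least)
      fix t
      show "cmod (x t) \<le> anorm A (\<lambda>t. c * x t) / cmod c"
        using cmod_le_cont_norm[OF cont_closed(4)[OF \<open>x \<in> points A\<close> \<open>c \<in> K\<close>], of t] that
        by (simp add: norm_mult field_simps)
    qed
    then show "cmod c * anorm A x \<le> anorm A (vscale A c x)"
      using cont_norm_nonneg[OF cont_closed(4)[OF that(2,1)]]
      by (cases "c = 0") (simp_all add: field_simps del: cont_simps(1))
  qed
  show "anorm A (amult A x y) \<le> anorm A x * anorm A y" if "x \<in> points A" "y \<in> points A" for x y
    using cmod_le_cont_norm[OF that(1)] cmod_le_cont_norm[OF that(2)] cont_norm_nonneg[OF that(1)]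
    by (intro cont_norm_least) (simp add: norm_mult mult_mono del: cont_simps(1))
  show "anorm A (astar A x) = anorm A x" for x
    by (simp add: cont_norm_eq)
  show "Metric_space.mcomplete (points A) (adist A)" by (rule mcomplete_cont)
qed (auto intro!: continuous_intros scalars_closed simp: algebra_simps)

end

subsection \<open>The algebra as multiplication operators\<close>

context real_or_complex
begin

abbreviation "H \<equiv> l2_space K"

abbreviation "B \<equiv> bounded_operators K H"

lemma operators_simps:
  "T \<in> points B \<longleftrightarrow> T \<in> points H \<rightarrow>\<^sub>E points H \<and>
     (\<forall>v\<in>points H. \<forall>w\<in>points H. T (vadd H v w) = vadd H (T v) (T w)) \<and>
     (\<forall>c\<in>K. \<forall>v\<in>points H. T (vscale H c v) = vscale H c (T v)) \<and>
     (\<exists>M. \<forall>v\<in>points H. hnorm H (T v) \<le> M * hnorm H v)"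
  "vzero B = (\<lambda>v\<in>points H. vzero H)"
  "vadd B S T = (\<lambda>v\<in>points H. vadd H (S v) (T v))"
  "vscale B c T = (\<lambda>v\<in>points H. vscale H c (T v))"
  "amult B S T = (\<lambda>v\<in>points H. S (T v))"
  "astar B T = (\<lambda>v\<in>points H. THE w. w \<in> points H \<and> (\<forall>u\<in>points H. ip H (T u) v = ip H u w))"
  "anorm B T = (SUP v\<in>{v \<in> points H. hnorm H v \<le> 1}. hnorm H (T v))"
  by (auto simp: bounded_operators_def)

lemma operator_dist:
  assumes "S \<in> points B" "T \<in> points B"
  shows "adist B S T = (SUP v\<in>{v \<in> points H. hnorm H v \<le> 1}. hdist H (S v) (T v))"
proof -
  have "hnorm H (vminus B S T v) = hdist H (S v) (T v)" if "v \<in> points H" for v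
  proof -
    have "S v \<in> points H" "T v \<in> points H"
      using assms that unfolding operators_simps by blast+
    then show ?thesis
      using that unfolding vminus_def operators_simps hdist_def
      by (simp del: l2_space_simps)
  qed
  then show ?thesis
    unfolding adist_def operators_simps(7) using assms by (auto intro!: SUP_cong)
qed

lemma zero_in_ball: "(\<lambda>i. 0) \<in> {v \<in> points H. hnorm H v \<le> 1}"
  by (simp add: hnorm_l2_space)

lemma hnorm_scale: "hnorm H (\<lambda>i. c * v i) = cmod c * hnorm H v"
  by (simp add: hnorm_l2_space norm_mult power_mult_distrib infsum_cmult_right' real_sqrt_mult)

text \<open>Closedness of the image in \<open>cstar_algebra\<close> refers to the topology of this
  distance, so general facts about metric spaces are available only once it is known to be a metric.
  Boundedness of the operators gives the suprema over the unit ball their meaning.\<close>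

lemma Metric_space_operators: "Metric_space (points (B :: (('i \<Rightarrow> complex) \<Rightarrow> _) star_alg)) (adist B)"
proof -
  let ?H = "H :: ('i \<Rightarrow> complex) ip_space"
  let ?U = "{v \<in> points ?H. hnorm ?H v \<le> 1}"
  interpret H: Metric_space "points ?H" "hdist ?H" by (rule Metric_space_l2)
  have mem: "T v \<in> points ?H" if "T \<in> points B" "v \<in> points ?H" for T v
    using that unfolding operators_simps by blast
  have bdd: "bdd_above ((\<lambda>v. hdist ?H (S v) (T v)) ` ?U)"
    if S: "S \<in> points B" and T: "T \<in> points B" for S T
  proof -
    obtain M where M: "\<forall>v\<in>points ?H. hnorm ?H (S v) \<le> M * hnorm ?H v"
      using S unfolding operators_simps by metis
    obtain M' where M': "\<forall>v\<in>points ?H. hnorm ?H (T v) \<le> M' * hnorm ?H v"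
      using T unfolding operators_simps by metis
    have "hdist ?H (S v) (T v) \<le> \<bar>M\<bar> + \<bar>M'\<bar>" if v: "v \<in> ?U" for v
    proof -
      have z: "vzero ?H \<in> points ?H" by simp
      have "hdist ?H (S v) (T v) \<le> hdist ?H (S v) (vzero ?H) + hdist ?H (T v) (vzero ?H)"
        using H.triangle[of "S v" "vzero ?H" "T v"] mem[OF S, of v] mem[OF T, of v] z v
        by (simp add: H.commute del: l2_space_simps)
      also have "\<dots> = hnorm ?H (S v) + hnorm ?H (T v)"
        using mem[OF S, of v] mem[OF T, of v] v z unfolding hdist_def by simp
      also have "\<dots> \<le> M * hnorm ?H v + M' * hnorm ?H v"
        using M M' v by (intro add_mono) auto
      also have "\<dots> \<le> \<bar>M\<bar> * 1 + \<bar>M'\<bar> * 1"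
        using v by (intro add_mono mult_mono) (auto simp: hnorm_l2_nonneg)
      finally show ?thesis by simp
    qed
    then show ?thesis by (intro bdd_aboveI2)
  qed
  note upper = cSUP_upper[OF _ bdd]
  show ?thesis
  proof
    show "0 \<le> adist B S T" for S T :: "('i \<Rightarrow> complex) \<Rightarrow> _"
    proof (cases "S \<in> points B \<and> T \<in> points B")
      case True
      have "0 \<le> hdist ?H (S (\<lambda>i. 0)) (T (\<lambda>i. 0))" by (rule H.nonneg)
      also have "\<dots> \<le> adist B S T"
        using True unfolding operator_dist[OF conjunct1[OF True] conjunct2[OF True]]
        by (intro upper zero_in_ball) auto
      finally show ?thesis .
    next
      case False
      then show ?thesis by (auto simp: adist_def)
    qed
    show "adist B S T = adist B T S" for S T :: "('i \<Rightarrow> complex) \<Rightarrow> _"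
    proof (cases "S \<in> points B \<and> T \<in> points B")
      case True
      then show ?thesis
        by (simp add: operator_dist H.commute del: l2_space_simps)
    next
      case False
      then show ?thesis by (auto simp: adist_def)
    qed
    show "adist B R T \<le> adist B R S + adist B S T"
      if R: "R \<in> points B" and S: "S \<in> points B" and T: "T \<in> points B"
      for R S T :: "('i \<Rightarrow> complex) \<Rightarrow> _"
      unfolding operator_dist[OF R T]
    proof (rule cSUP_least)
      show "?U \<noteq> {}" using zero_in_ball by blast
      fix v assume v: "v \<in> ?U"
      then have "hdist ?H (R v) (T v) \<le> hdist ?H (R v) (S v) + hdist ?H (S v) (T v)"
        using H.triangle mem R S T by blast
      also have "\<dots> \<le> adist B R S + adist B S T"
        unfolding operator_dist[OF R S] operator_dist[OF S T]
        by (intro add_mono upper R S T v)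
      finally show "hdist ?H (R v) (T v) \<le> adist B R S + adist B S T" .
    qed
    show "adist B S T = 0 \<longleftrightarrow> S = T"
      if S: "S \<in> points B" and T: "T \<in> points B" for S T :: "('i \<Rightarrow> complex) \<Rightarrow> _"
    proof
      assume *: "adist B S T = 0"
      have ball: "S v = T v" if "v \<in> ?U" for v
      proof -
        have "hdist ?H (S v) (T v) \<le> 0"
          using upper[OF that S T] * unfolding operator_dist[OF S T] by simp
        then show ?thesis
          using mem[OF S, of v] mem[OF T, of v] that H.nonneg[of "S v" "T v"] H.zero[of "S v" "T v"]
          by (simp del: H.zero l2_space_simps)
      qed
      have eq: "S v = T v" if v: "v \<in> points ?H" for v
      proof -
        \<comment> \<open>The factor \<open>1 + hnorm ?H v\<close> instead of
          \<open>hnorm ?H v\<close> is positive also for the zero vector.\<close>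
        define c where "c = complex_of_real (1 + hnorm ?H v)"
        have c: "c \<noteq> 0" "c \<in> K" "1 / c \<in> K" "cmod c = 1 + hnorm ?H v"
          using hnorm_l2_nonneg[of K v] scalars
          by (auto simp: c_def norm_of_real simp del: of_real_add intro: Reals_divide)
        define w where "w = vscale ?H (1 / c) v"
        have w: "w \<in> points ?H"
          unfolding w_def using hilbert_space_over.axioms(1)[OF hilbert_space_l2] c(3) v
          by (rule vect_space_over.scale_closed)
        have "hnorm ?H w = hnorm ?H v / (1 + hnorm ?H v)"
          unfolding w_def l2_space_simps hnorm_scale by (simp add: norm_divide c(4))
        then have "w \<in> ?U" using w hnorm_l2_nonneg[of K v] by simp
        then have "S w = T w" by (rule ball)
        moreover have "v = vscale ?H c w" using c(1) by (simp add: w_def)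
        ultimately show ?thesis
          using S T w c(2) unfolding operators_simps by metis
      qed
      have "S \<in> extensional (points ?H)" "T \<in> extensional (points ?H)"
        using S T unfolding operators_simps PiE_def by blast+
      then show "S = T" using eq by (rule extensionalityI)
    next
      assume "S = T"
      moreover have "(SUP v\<in>?U. hdist ?H (T v) (T v)) = (SUP v\<in>?U. 0)"
        using mem[OF T] by (intro SUP_cong) (auto simp del: l2_space_simps)
      moreover have "(SUP v\<in>?U. 0) = (0 :: real)"
        using zero_in_ball by (intro cSUP_const) blast
      ultimately show "adist B S T = 0"
        using operator_dist[OF S T] by simp
    qed
  qed
qed

end

text \<open>\<open>cstar_algebra\<close> prescribes the type of the Hilbert space, whose indices are
  not points of the interval. A map \<tau> of the index type onto \<open>{0..1}\<close> takes their
  place; its surjectivity makes the multiplication operators isometric.\<close>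

locale interval_index = real_or_complex +
  fixes \<tau> :: "'i \<Rightarrow> real"
  assumes range_\<tau>: "range \<tau> = {0..1}"
begin

abbreviation "Hi \<equiv> l2_space K :: ('i \<Rightarrow> complex) ip_space"
abbreviation "Bi \<equiv> bounded_operators K Hi"

definition mult_op :: "(real \<Rightarrow> complex) \<Rightarrow> ('i \<Rightarrow> complex) \<Rightarrow> ('i \<Rightarrow> complex)" where
  "mult_op f = (\<lambda>v\<in>points Hi. \<lambda>i. f (\<tau> i) * v i)"

lemma mult_op_apply [simp]: "v \<in> points Hi \<Longrightarrow> mult_op f v = (\<lambda>i. f (\<tau> i) * v i)"
  by (simp add: mult_op_def del: l2_space_simps)

lemma mult_op_vec_closed:
  assumes f: "f \<in> points A" and v: "v \<in> points Hi"
  shows "(\<lambda>i. f (\<tau> i) * v i) \<in> points Hi"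
proof -
  have "f (\<tau> i) \<in> K" for i using f range_\<tau> by auto
  moreover have "v i \<in> K" for i using v by auto
  ultimately have "f (\<tau> i) * v i \<in> K" for i by (intro scalars_closed(2))
  moreover have "(\<lambda>i. (cmod (f (\<tau> i) * v i))\<^sup>2) summable_on UNIV"
    using v cmod_le_cont_norm[OF f] by (intro square_summable_scale) auto
  ultimately show ?thesis by auto
qed

lemma hnorm_mult_op_le:
  assumes f: "f \<in> points A" and v: "v \<in> points Hi"
  shows "hnorm Hi (\<lambda>i. f (\<tau> i) * v i) \<le> anorm A f * hnorm Hi v"
proof (rule hnorm_l2_le[OF mult_op_vec_closed[OF f v]])
  show "0 \<le> anorm A f * hnorm Hi v"
    by (intro mult_nonneg_nonneg cont_norm_nonneg f hnorm_l2_nonneg)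
  fix F :: "'i set" assume F: "finite F"
  have "L2_set (\<lambda>i. cmod (f (\<tau> i) * v i)) F \<le> L2_set (\<lambda>i. anorm A f * cmod (v i)) F"
    using cmod_le_cont_norm[OF f] by (intro L2_set_mono) (auto simp: norm_mult mult_right_mono)
  also have "\<dots> = anorm A f * L2_set (\<lambda>i. cmod (v i)) F"
    by (rule L2_set_right_distrib[symmetric]) (rule cont_norm_nonneg[OF f])
  also have "\<dots> \<le> anorm A f * hnorm Hi v"
    by (intro mult_left_mono L2_set_le_hnorm v F cont_norm_nonneg f)
  finally show "L2_set (\<lambda>i. cmod (f (\<tau> i) * v i)) F \<le> anorm A f * hnorm Hi v" .
qed

lemma hilbert_closed:
  "v \<in> points Hi \<Longrightarrow> w \<in> points Hi \<Longrightarrow> vadd Hi v w \<in> points Hi"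
  "c \<in> K \<Longrightarrow> v \<in> points Hi \<Longrightarrow> vscale Hi c v \<in> points Hi"
  using hilbert_space_over.axioms(1)[OF hilbert_space_l2]
  by (auto intro: vect_space_over.add_closed vect_space_over.scale_closed simp del: l2_space_simps)

lemma mult_op_closed:
  assumes f: "f \<in> points A"
  shows "mult_op f \<in> points Bi"
  unfolding operators_simps
proof (intro conjI ballI)
  show "mult_op f \<in> points Hi \<rightarrow>\<^sub>E points Hi"
    using mult_op_vec_closed[OF f] unfolding mult_op_def by (simp del: l2_space_simps)
  show "mult_op f (vadd Hi v w) = vadd Hi (mult_op f v) (mult_op f w)"
    if "v \<in> points Hi" "w \<in> points Hi" for v w
    using hilbert_closed(1)[OF that] that
    by (simp add: algebra_simps del: l2_space_simps(1))
  show "mult_op f (vscale Hi c v) = vscale Hi c (mult_op f v)" if "c \<in> K" "v \<in> points Hi" for c v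
    using hilbert_closed(2)[OF that] that
    by (simp add: algebra_simps del: l2_space_simps(1))
  show "\<exists>M. \<forall>v\<in>points Hi. hnorm Hi (mult_op f v) \<le> M * hnorm Hi v"
    using hnorm_mult_op_le[OF f] by (intro exI[of _ "anorm A f"]) (simp del: l2_space_simps)
qed

lemma mult_op_adjoint:
  assumes f: "f \<in> points A"
  shows "astar Bi (mult_op f) = mult_op (\<lambda>t. cnj (f t))"
  unfolding operators_simps mult_op_def[of "\<lambda>t. cnj (f t)"]
proof (rule restrict_ext)
  fix v assume v: "v \<in> points Hi"
  let ?w = "\<lambda>i. cnj (f (\<tau> i)) * v i"
  have w: "?w \<in> points Hi"
    by (rule mult_op_vec_closed[OF cont_closed(5)[OF f] v])
  show "(THE w. w \<in> points Hi \<and> (\<forall>u\<in>points Hi. ip Hi (mult_op f u) v = ip Hi u w)) = ?w"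
  proof (rule the_equality)
    have "ip Hi (mult_op f u) v = ip Hi u ?w" if "u \<in> points Hi" for u
      unfolding mult_op_apply[OF that] by (simp add: mult.assoc mult.left_commute)
    then show "?w \<in> points Hi \<and> (\<forall>u\<in>points Hi. ip Hi (mult_op f u) v = ip Hi u ?w)"
      using w by blast
  next
    fix w assume *: "w \<in> points Hi \<and> (\<forall>u\<in>points Hi. ip Hi (mult_op f u) v = ip Hi u w)"
    have eq: "ip Hi u w = ip Hi u ?w" if u: "u \<in> points Hi" for u
    proof -
      have "ip Hi u w = ip Hi (mult_op f u) v" using * u by simp
      also have "\<dots> = ip Hi u ?w"
        unfolding mult_op_apply[OF u] by (simp add: mult.assoc mult.left_commute)
      finally show ?thesis .
    qed
    \<comment> \<open>The adjoint is defined by a unique description. A second candidate differs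
      from \<open>?w\<close> by a vector orthogonal to all vectors, in particular to itself.\<close>
    define d where "d = (\<lambda>i. w i - ?w i)"
    have d: "d \<in> points Hi" unfolding d_def using l2_diff_closed[OF conjunct1[OF *] w] .
    have "ip Hi d ?w + ip Hi d d = (\<Sum>\<^sub>\<infinity>i. d i * cnj (?w i) + d i * cnj (d i))"
      unfolding l2_space_simps(5) using d w by (intro infsum_add[symmetric] summable_ip) auto
    also have "\<dots> = ip Hi d w"
      unfolding l2_space_simps(5) by (rule infsum_cong) (simp add: d_def algebra_simps)
    finally have "ip Hi d d = 0" using eq[OF d] by simp
    then have "d = vzero Hi"
      using hilbert_space_over.ip_definite[OF hilbert_space_l2 d] by blast
    then show "w = ?w" by (auto simp: d_def fun_eq_iff)
  qed
qed

lemma norm_mult_op: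
  assumes f: "f \<in> points A"
  shows "anorm Bi (mult_op f) = anorm A f"
proof -
  let ?U = "{v \<in> points Hi. hnorm Hi v \<le> 1}"
  have "hnorm Hi (mult_op f v) \<le> anorm A f" if "v \<in> ?U" for v
  proof -
    have "anorm A f * hnorm Hi v \<le> anorm A f * 1"
      using that by (intro mult_left_mono cont_norm_nonneg f) auto
    then show ?thesis
      using hnorm_mult_op_le[OF f, of v] that by (simp del: l2_space_simps)
  qed
  note le = this
  show ?thesis
  proof (rule antisym)
    show "anorm Bi (mult_op f) \<le> anorm A f"
      unfolding operators_simps
    proof (rule cSUP_least)
      show "?U \<noteq> {}" using zero_in_ball by blast
    qed (rule le)
    show "anorm A f \<le> anorm Bi (mult_op f)"
    proof (rule cont_norm_least)
      fix t :: real assume "t \<in> {0..1}"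
      then obtain i where i: "t = \<tau> i" using range_\<tau> by blast
      \<comment> \<open>The unit vector at \<open>i\<close> is an eigenvector with eigenvalue
        \<open>f t\<close>. The fact \<open>sq\<close> is stated for all factors \<open>c\<close> to
        treat the vector and its image together.\<close>
      define v :: "'i \<Rightarrow> complex" where "v = (\<lambda>j. if j = i then 1 else 0)"
      have sq: "((\<lambda>j. (cmod (v j * c))\<^sup>2) has_sum (cmod c)\<^sup>2) UNIV" for c
        by (rule has_sum_finite_neutralI[of "{i}"]) (auto simp: v_def)
      have mem: "v \<in> points Hi"
        using has_sum_imp_summable[OF sq[of 1]] by (auto simp: v_def)
      have norm: "hnorm Hi (\<lambda>j. v j * c) = cmod c" for c
        using infsumI[OF sq] by (simp add: hnorm_l2_space)
      have "v \<in> ?U" using mem norm[of 1] by simp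
      then have "hnorm Hi (mult_op f v) \<le> anorm Bi (mult_op f)"
        unfolding operators_simps
        by (rule cSUP_upper) (rule bdd_aboveI2[OF le])
      moreover have "mult_op f v = (\<lambda>j. v j * f t)"
        unfolding mult_op_apply[OF mem] by (auto simp: v_def i)
      ultimately show "cmod (f t) \<le> anorm Bi (mult_op f)" using norm by simp
    qed
  qed
qed

lemma mult_op_hom: "star_hom K A Bi mult_op"
  unfolding star_hom_def
proof (intro ballI conjI)
  fix f assume f: "f \<in> points A"
  show "mult_op f \<in> points Bi" by (rule mult_op_closed[OF f])
  show "mult_op (astar A f) = astar Bi (mult_op f)"
    unfolding mult_op_adjoint[OF f] by simp
  show "mult_op (vscale A c f) = vscale Bi c (mult_op f)" for c
    unfolding operators_simps mult_op_def
    by (rule restrict_ext) (simp add: mult.assoc del: l2_space_simps(1))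
  fix g assume g: "g \<in> points A"
  show "mult_op (vadd A f g) = vadd Bi (mult_op f) (mult_op g)"
    unfolding operators_simps mult_op_def
    by (rule restrict_ext) (simp add: distrib_right del: l2_space_simps(1))
  show "mult_op (amult A f g) = amult Bi (mult_op f) (mult_op g)"
    unfolding operators_simps mult_op_def
    using mult_op_vec_closed[OF g]
    by (intro restrict_ext) (simp add: mult.assoc del: l2_space_simps(1))
qed

lemma mult_op_diff:
  assumes "f \<in> points A" "g \<in> points A"
  shows "vminus Bi (mult_op f) (mult_op g) = mult_op (\<lambda>t. f t - g t)"
  unfolding vminus_def operators_simps mult_op_def
  by (rule restrict_ext) (simp add: left_diff_distrib del: l2_space_simps(1))

lemma adist_mult_op:
  assumes "f \<in> points A" "g \<in> points A"
  shows "adist Bi (mult_op f) (mult_op g) = adist A f g"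
  unfolding cont_adist[OF assms] norm_mult_op[OF cont_closed(2)[OF assms], symmetric]
  using assms by (simp add: adist_def mult_op_closed mult_op_diff del: cont_simps(1))

text \<open>An isometric image of a complete space is complete, and complete subsets of a metric
  space are closed.\<close>

lemma closed_range_mult_op: "closed_star_subalgebra K Bi (mult_op ` points A)"
proof -
  interpret cont: Metric_space "points A" "adist A" by (rule Metric_space_cont)
  interpret op: Metric_space "points Bi" "adist Bi" by (rule Metric_space_operators)
  have sub: "mult_op ` points A \<subseteq> points Bi" using mult_op_closed by blast
  interpret Submetric "points Bi" "adist Bi" "mult_op ` points A"
    by unfold_locales (rule sub)
  have "sub.mcomplete"
    unfolding sub.mcomplete_def
  proof (intro allI impI)
    fix \<sigma> assume \<sigma>: "sub.MCauchy \<sigma>"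
    then have "\<forall>n. \<exists>f. f \<in> points A \<and> \<sigma> n = mult_op f"
      unfolding sub.MCauchy_def by blast
    then obtain f where f: "\<And>n. f n \<in> points A" "\<And>n. \<sigma> n = mult_op (f n)" by metis
    have "cont.MCauchy f"
      using \<sigma> f(1) unfolding sub.MCauchy_def cont.MCauchy_def f(2) adist_mult_op[OF f(1) f(1)]
      by blast
    then obtain l where "limitin cont.mtopology f l sequentially"
      using mcomplete_cont unfolding cont.mcomplete_def by blast
    then have l: "l \<in> points A" "\<And>e. e > 0 \<Longrightarrow> \<exists>N. \<forall>n\<ge>N. adist A (f n) l < e"
      unfolding cont.limit_metric_sequentially by blast+
    have "limitin sub.mtopology \<sigma> (mult_op l) sequentially"
      unfolding sub.limit_metric_sequentially f(2) adist_mult_op[OF f(1) l(1)] using f(1) l by blast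
    then show "\<exists>x. limitin sub.mtopology \<sigma> x sequentially" by blast
  qed
  then have closed: "closedin op.mtopology (mult_op ` points A)"
    by (rule mcomplete_imp_closedin)
  note hom = mult_op_hom[unfolded star_hom_def]
  have "vadd Bi (mult_op f) (mult_op g) \<in> mult_op ` points A"
      "amult Bi (mult_op f) (mult_op g) \<in> mult_op ` points A"
    if "f \<in> points A" "g \<in> points A" for f g
  proof -
    have "vadd A f g \<in> points A" "amult A f g \<in> points A"
      using cont_closed(1,3)[OF that] by (simp_all del: cont_simps(1))
    then show "vadd Bi (mult_op f) (mult_op g) \<in> mult_op ` points A"
        "amult Bi (mult_op f) (mult_op g) \<in> mult_op ` points A"
      using hom that by (metis image_eqI)+
  qed
  moreover have "astar Bi (mult_op f) \<in> mult_op ` points A" if "f \<in> points A" for f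
    unfolding mult_op_adjoint[OF that] using cont_closed(5)[OF that] by blast
  moreover have "vscale Bi c (mult_op f) \<in> mult_op ` points A" if "f \<in> points A" "c \<in> K" for f c
  proof -
    have "vscale A c f \<in> points A"
      using cont_closed(4)[OF that] by (simp del: cont_simps(1))
    then show ?thesis using hom that by (metis image_eqI)
  qed
  moreover have "vzero Bi \<in> mult_op ` points A"
  proof -
    have "vzero Bi = mult_op (\<lambda>t. 0)"
      unfolding operators_simps mult_op_def by (rule restrict_ext) (simp del: l2_space_simps(1))
    then show ?thesis using cont_closed(6) by blast
  qed
  ultimately show ?thesis
    unfolding closed_star_subalgebra_def using sub closed by blast
qed

end

lemma (in real_or_complex) cstar_algebra_cont: "cstar_algebra K A"
proof -
  define \<tau> :: "(real \<Rightarrow> complex) \<times> nat \<Rightarrow> real"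
    where "\<tau> = (\<lambda>(g, n). max 0 (min 1 (Re (g 0))))"
  \<comment> \<open>Clamping keeps the values in the interval, and the constant functions show that
    \<tau> is onto.\<close>
  have "range \<tau> = {0..1}"
  proof (intro equalityI subsetI)
    show "t \<in> {0..1}" if "t \<in> range \<tau>" for t
      using that by (auto simp: \<tau>_def)
    show "t \<in> range \<tau>" if "t \<in> {0..1}" for t
      by (rule range_eqI[of _ _ "(\<lambda>s. complex_of_real t, 0)"]) (use that in \<open>simp add: \<tau>_def\<close>)
  qed
  then interpret interval_index K \<tau> by unfold_locales
  show ?thesis
    unfolding cstar_algebra_def
    using banach_star_algebra_cont hilbert_space_l2 mult_op_hom norm_mult_op closed_range_mult_op
    by blast
qed

section \<open>Evaluation of rational polynomials\<close>

text \<open>\<open>Inl i\<close> and \<open>Inr i\<close> get the same value because the special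
  points used here are real-valued, hence self-adjoint.\<close>

definition word_eval :: "(nat \<Rightarrow> real) \<Rightarrow> (nat + nat) list \<Rightarrow> real" where
  "word_eval x w = prod_list (map (\<lambda>l. x (letter_index l)) w)"

definition poly_eval :: "(nat \<Rightarrow> real) \<Rightarrow> star_poly \<Rightarrow> complex" where
  "poly_eval x p = sum_list (map (\<lambda>(c, w). c * complex_of_real (word_eval x w)) p)"

lemma word_eval_bound:
  assumes "\<And>l. l \<in> set w \<Longrightarrow> \<bar>x (letter_index l)\<bar> \<le> 1"
  shows "\<bar>word_eval x w\<bar> \<le> 1"
  using assms
proof (induction w)
  case (Cons l w)
  then have "\<bar>x (letter_index l)\<bar> * \<bar>word_eval x w\<bar> \<le> 1 * 1"
    by (intro mult_mono) auto
  then show ?case by (simp add: word_eval_def abs_mult)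
qed (simp add: word_eval_def)

lemma word_eval_lipschitz:
  assumes "\<And>l. l \<in> set w \<Longrightarrow> \<bar>x (letter_index l)\<bar> \<le> 1 \<and> \<bar>y (letter_index l)\<bar> \<le> 1 \<and>
    \<bar>x (letter_index l) - y (letter_index l)\<bar> \<le> e"
  shows "\<bar>word_eval x w - word_eval y w\<bar> \<le> real (length w) * e"
  using assms
proof (induction w)
  case (Cons l w)
  let ?a = "x (letter_index l)" and ?b = "y (letter_index l)"
  have "word_eval x (l # w) - word_eval y (l # w) =
      ?a * (word_eval x w - word_eval y w) + (?a - ?b) * word_eval y w"
    by (simp add: word_eval_def algebra_simps)
  also have "\<bar>\<dots>\<bar> \<le> \<bar>?a\<bar> * \<bar>word_eval x w - word_eval y w\<bar> + \<bar>?a - ?b\<bar> * \<bar>word_eval y w\<bar>"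
    unfolding abs_mult[symmetric] by (rule abs_triangle_ineq)
  also have "\<dots> \<le> 1 * (real (length w) * e) + e * 1"
    using Cons word_eval_bound[of w y] by (intro add_mono mult_mono) force+
  finally show ?case by (simp add: algebra_simps)
qed (simp add: word_eval_def)

lemma abs_int_decode_le: "\<bar>int_decode n\<bar> \<le> int n"
  by (auto simp: int_decode_def sum_decode_def elim!: oddE)

lemma abs_rat_of_code_le: "\<bar>rat_of_code n\<bar> \<le> of_nat n"
proof -
  obtain a b where ab: "prod_decode n = (a, b)" by fastforce
  then have "a \<le> n" by (metis le_prod_encode_1 prod_decode_inverse)
  have "\<bar>rat_of_code n\<bar> = of_int \<bar>int_decode a\<bar> / of_nat (Suc b)"
    by (simp add: rat_of_code_def ab)
  also have "\<dots> \<le> of_int \<bar>int_decode a\<bar> / 1"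
    by (intro divide_left_mono) auto
  also have "\<dots> \<le> of_int (int n)"
    using abs_int_decode_le[of a] \<open>a \<le> n\<close> by (simp only: of_int_le_iff div_by_1)
  finally show ?thesis by simp
qed

lemma cmod_coeff_of_code_le: "cmod (coeff_of_code n) \<le> real n"
proof -
  obtain a b where ab: "prod_decode n = (a, b)" by fastforce
  then have n: "n = prod_encode (a, b)" by (metis prod_decode_inverse)
  have "cmod (coeff_of_code n) \<le> \<bar>real_of_rat (rat_of_code a)\<bar> + \<bar>real_of_rat (rat_of_code b)\<bar>"
    unfolding coeff_of_code_def ab prod.case by (rule order_trans[OF cmod_le]) simp
  also have "\<dots> = real_of_rat (\<bar>rat_of_code a\<bar> + \<bar>rat_of_code b\<bar>)"
    by (simp add: of_rat_add)
  also have "\<dots> \<le> real_of_rat (of_nat a + of_nat b)"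
    unfolding of_rat_less_eq using abs_rat_of_code_le by (intro add_mono)
  also have "\<dots> = real (a + b)" by (simp add: of_rat_add)
  also have "\<dots> \<le> real n"
    unfolding n of_nat_le_iff prod_encode_def using triangle_ge[of "a + b"] by simp
  finally show ?thesis .
qed

lemma mult_le_prod_encode: "a * b \<le> prod_encode (a, b)"
proof -
  have "a * b \<le> triangle (a + b)"
  proof (induction a)
    case (Suc a)
    then show ?case by simp
  qed simp
  then show ?thesis by (simp add: prod_encode_def)
qed

lemma letter_index_sum_decode: "letter_index (sum_decode n) = n div 2"
  by (simp add: sum_decode_def)

text \<open>The code of a polynomial bounds the sum of \<open>|c| * length w\<close> over its terms \<open>(c, w)\<close>.\<close>

lemma poly_eval_lipschitz:
  assumes "\<And>i. i \<le> q \<Longrightarrow> \<bar>x i\<bar> \<le> 1 \<and> \<bar>y i\<bar> \<le> 1 \<and> \<bar>x i - y i\<bar> \<le> e" and e: "0 \<le> e"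
  shows "cmod (poly_eval x (poly_of_code q) - poly_eval y (poly_of_code q)) \<le> real q * e"
proof -
  let ?v = "\<lambda>x t. case term_of_code t of (c, w) \<Rightarrow> c * complex_of_real (word_eval x w)"
  have term_diff: "cmod (?v x t - ?v y t) \<le> real t * e" if "t \<le> q" for t
  proof -
    obtain a b where ab: "prod_decode t = (a, b)" by fastforce
    then have t: "t = prod_encode (a, b)" by (metis prod_decode_inverse)
    let ?w = "map sum_decode (list_decode b)"
    have len: "length ?w \<le> b"
      using sum_list_length_le_list_encode[of "list_decode b"] by simp
    have "letter_index l \<le> q" if l: "l \<in> set ?w" for l
    proof -
      obtain s where "s \<in> set (list_decode b)" "l = sum_decode s" using l by auto
      then have "letter_index l \<le> b"
        using member_less_list_encode[of s "list_decode b"] by (simp add: letter_index_sum_decode)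
      also have "b \<le> q" using \<open>t \<le> q\<close> le_prod_encode_2[of b a] unfolding t by simp
      finally show ?thesis .
    qed
    then have "\<bar>word_eval x ?w - word_eval y ?w\<bar> \<le> real (length ?w) * e"
      by (intro word_eval_lipschitz assms(1)) auto
    also have "\<dots> \<le> real b * e" using len e by (intro mult_right_mono) auto
    finally have w: "\<bar>word_eval x ?w - word_eval y ?w\<bar> \<le> real b * e" .
    have "?v x t - ?v y t = coeff_of_code a * complex_of_real (word_eval x ?w - word_eval y ?w)"
      unfolding term_of_code_def ab by (simp add: algebra_simps)
    also have "cmod \<dots> = cmod (coeff_of_code a) * \<bar>word_eval x ?w - word_eval y ?w\<bar>"
      unfolding norm_mult norm_of_real ..
    also have "\<dots> \<le> real a * (real b * e)"
      using w cmod_coeff_of_code_le by (intro mult_mono) auto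
    also have "\<dots> = real (a * b) * e" by simp
    also have "\<dots> \<le> real t * e"
      unfolding t using mult_le_prod_encode e by (intro mult_right_mono) (simp_all only: of_nat_le_iff)
    finally show ?thesis .
  qed
  have "cmod (sum_list (map (?v x) ts) - sum_list (map (?v y) ts)) \<le> real (sum_list ts) * e"
    if "\<And>t. t \<in> set ts \<Longrightarrow> t \<le> q" for ts
    using that
  proof (induction ts)
    case (Cons t ts)
    have "cmod (?v x t + sum_list (map (?v x) ts) - (?v y t + sum_list (map (?v y) ts)))
        \<le> cmod (?v x t - ?v y t) + cmod (sum_list (map (?v x) ts) - sum_list (map (?v y) ts))"
      by (rule norm_diff_triangle_ineq)
    also have "\<dots> \<le> real t * e + real (sum_list ts) * e"
      using Cons by (intro add_mono term_diff) auto
    finally show ?case by (simp add: algebra_simps)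
  qed simp
  moreover have "poly_eval z (poly_of_code q) = sum_list (map (?v z) (list_decode q))" for z
    by (simp add: poly_eval_def poly_of_code_def comp_def)
  moreover have "t \<le> q" if "t \<in> set (list_decode q)" for t
    using member_less_list_encode[OF that] by simp
  ultimately have "cmod (poly_eval x (poly_of_code q) - poly_eval y (poly_of_code q))
      \<le> real (sum_list (list_decode q)) * e"
    by simp
  also have "\<dots> \<le> real q * e"
    using sum_list_length_le_list_encode[of "list_decode q"] e by (intro mult_right_mono) auto
  finally show ?thesis .
qed

section \<open>Zigzag presentations\<close>

text \<open>The polynomial that sends sin^2 x to sin^2 3x, a rescaled Chebyshev polynomial of degree
  3. It maps each of [0, 1/4], [1/4, 3/4] and [3/4, 1] monotonically onto [0, 1]. Its coefficients
  are integers, so it can be evaluated exactly at rational points.\<close>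

definition zigzag :: "real \<Rightarrow> real" where "zigzag r = r * (3 - 4 * r)\<^sup>2"

lemma zigzag_values [simp]: "zigzag 0 = 0" "zigzag 1 = 1" "zigzag (1/4) = 1" "zigzag (3/4) = 0"
  by (simp_all add: zigzag_def)

lemma zigzag_range: "r \<in> {0..1} \<Longrightarrow> zigzag r \<in> {0..1}"
proof -
  assume r: "r \<in> {0..1}"
  have "1 - zigzag r = (1 - r) * (1 - 4 * r)\<^sup>2"
    by (simp add: zigzag_def power2_eq_square algebra_simps)
  then have "0 \<le> 1 - zigzag r" using r by simp
  moreover have "0 \<le> zigzag r" using r by (simp add: zigzag_def)
  ultimately show ?thesis by simp
qed

lemma continuous_zigzag: "continuous_on S zigzag"
  unfolding zigzag_def by (intro continuous_intros)

lemma zigzag_surj: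
  assumes "s \<in> {0..1}" shows "\<exists>r\<in>{0..1}. zigzag r = s"
  using IVT'[of zigzag 0 s 1] assms continuous_zigzag by auto

lemma zigzag_lipschitz:
  assumes "r \<in> {0..1}" "s \<in> {0..1}"
  shows "\<bar>zigzag r - zigzag s\<bar> \<le> 57 * \<bar>r - s\<bar>"
proof -
  have "0 \<le> r * r" "0 \<le> r * s" "0 \<le> s * s" "r * r \<le> 1" "r * s \<le> 1" "s * s \<le> 1"
    using assms by (auto simp: mult_le_one)
  moreover have "0 \<le> r" "r \<le> 1" "0 \<le> s" "s \<le> 1" using assms by auto
  \<comment> \<open>The expression is the difference quotient of \<open>zigzag\<close>. Dropping the
    negative terms bounds it by 57 = 16 * 3 + 9 from above; from below it is at least 9 - 24 *
    2.\<close>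
  ultimately have "\<bar>16 * (r * r + r * s + s * s) - 24 * (r + s) + 9\<bar> \<le> 57"
    unfolding abs_le_iff distrib_left by (intro conjI; linarith)
  then have "\<bar>16 * (r * r + r * s + s * s) - 24 * (r + s) + 9\<bar> * \<bar>r - s\<bar> \<le> 57 * \<bar>r - s\<bar>"
    by (intro mult_right_mono) auto
  moreover have "zigzag r - zigzag s = (16 * (r * r + r * s + s * s) - 24 * (r + s) + 9) * (r - s)"
    by (simp add: zigzag_def power2_eq_square algebra_simps)
  ultimately show ?thesis by (simp add: abs_mult)
qed

definition ramp :: "nat \<Rightarrow> real \<Rightarrow> real" where
  "ramp n t = max 0 (min 1 (2 ^ Suc n * t - 1))"

lemma continuous_ramp: "continuous_on S (ramp n)"
  unfolding ramp_def by (intro continuous_intros)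

text \<open>
  The interval \<open>[2^-(n+1), 2^-n]\<close> carries the coordinates \<open>2n+1\<close> and \<open>2n+2\<close>. If
  \<open>\<delta> n > 0\<close>, the first one runs through \<open>[0, 1]\<close> three times, and the second one,
  of size at most \<open>\<delta> n\<close>, separates the three strands.
\<close>

definition coordinate :: "(nat \<Rightarrow> real) \<Rightarrow> nat \<Rightarrow> real \<Rightarrow> real" where
  "coordinate \<delta> i t = (if i = 0 then 1 else
     let n = (i - 1) div 2; r = ramp n t in
     if odd i then (if \<delta> n = 0 then r else zigzag r) else \<delta> n * (zigzag r - r))"

text \<open>
  The coordinates at the point with parameter \<open>r\<close> on the \<open>n\<close>-th interval. Tracing a segment with
  or without the zigzag gives the same set of points, so the case \<open>d = 0\<close> needs no exception.
\<close>

definition place :: "real \<Rightarrow> nat \<Rightarrow> real \<Rightarrow> nat \<Rightarrow> real" where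
  "place d n r i = (if i = 0 then 1 else
     if odd i then (if (i - 1) div 2 < n then 0 else if (i - 1) div 2 = n then zigzag r else 1)
     else (if (i - 1) div 2 = n then d * (zigzag r - r) else 0))"

lemma ramp_eq:
  assumes "t = (1 + r) / 2 ^ Suc n" "r \<in> {0..1}"
  shows "ramp l t = (if l < n then 0 else if l = n then r else 1)"
proof -
  consider "l < n" | "l = n" | "n < l" by linarith
  then show ?thesis
  proof cases
    case 1
    then have "(2::real) ^ Suc l \<le> 2 ^ n" by (intro power_increasing) auto
    then have "2 ^ Suc l * t \<le> 2 ^ n * t"
      using assms by (intro mult_right_mono) auto
    also have "\<dots> = (1 + r) / 2" using assms by simp
    finally show ?thesis using 1 assms(2) by (simp add: ramp_def)
  next
    case 2
    then show ?thesis using assms by (simp add: ramp_def)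
  next
    case 3
    then have "(2::real) ^ Suc (Suc n) \<le> 2 ^ Suc l" by (intro power_increasing) auto
    then have le: "2 ^ Suc (Suc n) * t \<le> 2 ^ Suc l * t"
      using assms by (intro mult_right_mono) auto
    have "2 \<le> 2 * (1 + r)" using assms(2) by simp
    also have "\<dots> = 2 ^ Suc (Suc n) * t" using assms(1) by simp
    also note le
    finally have "ramp l t = 1" unfolding ramp_def by (simp del: power_Suc)
    then show ?thesis using 3 by simp
  qed
qed

text \<open>If \<open>\<delta> n = 0\<close>, the segment is traced once, and the point with first
  coordinate \<open>zigzag r\<close> lies at the position \<open>zigzag r\<close> of the interval;
  otherwise it lies at the position \<open>r\<close>.\<close>

lemma coordinate_eq_place:
  assumes "t = (1 + (if \<delta> n = 0 then zigzag r else r)) / 2 ^ Suc n" "r \<in> {0..1}"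
  shows "coordinate \<delta> i t = place (\<delta> n) n r i"
proof -
  have "ramp l t = (if l < n then 0 else if l = n then (if \<delta> n = 0 then zigzag r else r) else 1)" for l
    by (rule ramp_eq[OF assms(1)]) (use assms(2) zigzag_range in auto)
  then show ?thesis
    by (simp add: coordinate_def place_def Let_def)
qed

lemma ex_coordinate_eq_place:
  assumes "r \<in> {0..1}"
  shows "\<exists>t\<in>{0..1}. \<forall>i. coordinate \<delta> i t = place (\<delta> n) n r i"
proof (intro bexI allI)
  let ?r = "if \<delta> n = 0 then zigzag r else r"
  show "coordinate \<delta> i ((1 + ?r) / 2 ^ Suc n) = place (\<delta> n) n r i" for i
    by (rule coordinate_eq_place[OF refl assms])
  have "?r \<in> {0..1}" using assms zigzag_range by auto
  moreover have "(1::real) \<le> 2 ^ n" by simp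
  ultimately have "0 \<le> 1 + ?r" "1 + ?r \<le> 2 * 2 ^ n" by (auto simp del: one_le_power)
  then show "(1 + ?r) / 2 ^ Suc n \<in> {0..1}" by simp
qed

text \<open>For t at most 2^-(q+1) the coordinates with indices from 1 to \<open>q\<close> vanish,
  so as far as they are concerned the rest of the curve is one point, the start of segment
  \<open>q\<close>. Finitely many segments thus suffice for a given polynomial.\<close>

lemma ex_place_eq_coordinate:
  assumes t: "t \<in> {0..1}"
  shows "\<exists>n\<le>q. \<exists>r\<in>{0..1}. \<forall>i\<le>q. coordinate \<delta> i t = place (\<delta> n) n r i"
proof (cases "2 ^ Suc q * t \<le> 1")
  case True
  have ramp: "ramp l t = 0" if "l \<le> q" for l
  proof -
    have "(2::real) ^ Suc l * t \<le> 2 ^ Suc q * t"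
      using t that by (intro mult_right_mono power_increasing) auto
    then show ?thesis using True by (simp add: ramp_def)
  qed
  have "coordinate \<delta> i t = place (\<delta> q) q 0 i" if "i \<le> q" for i
  proof -
    have "(i - 1) div 2 \<le> q" "\<not> q < (i - 1) div 2" using that by linarith+
    then show ?thesis by (auto simp: coordinate_def place_def Let_def ramp)
  qed
  then show ?thesis by (intro exI[of _ q] conjI bexI[of _ 0]) auto
next
  case False
  define n where "n = (LEAST n. 1 < 2 ^ Suc n * t)"
  have n: "1 < 2 ^ Suc n * t" "n \<le> q"
    using False LeastI[of "\<lambda>n. 1 < 2 ^ Suc n * t" q] Least_le[of "\<lambda>n. 1 < 2 ^ Suc n * t" q]
    by (auto simp: n_def not_le)
  have "2 ^ n * t \<le> 1"
  proof (cases n)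
    case (Suc m)
    then show ?thesis using not_less_Least[of m "\<lambda>n. 1 < 2 ^ Suc n * t"] by (simp add: n_def not_less)
  qed (use t in simp)
  define s where "s = 2 ^ Suc n * t - 1"
  have s: "s \<in> {0..1}" "t = (1 + s) / 2 ^ Suc n"
    using n(1) \<open>2 ^ n * t \<le> 1\<close> by (auto simp: s_def)
  \<comment> \<open>With \<open>\<delta> n = 0\<close> the position \<open>s\<close> is not
    \<open>r\<close> but \<open>zigzag r\<close>, and surjectivity supplies
    \<open>r\<close>.\<close>
  obtain r where r: "r \<in> {0..1}" "(if \<delta> n = 0 then zigzag r else r) = s"
    using zigzag_surj[OF s(1)] s(1) by (cases "\<delta> n = 0") auto
  have "t = (1 + (if \<delta> n = 0 then zigzag r else r)) / 2 ^ Suc n"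
    unfolding r(2) by (rule s(2))
  then have "coordinate \<delta> i t = place (\<delta> n) n r i" for i
    using r(1) by (rule coordinate_eq_place)
  then show ?thesis using n(2) r(1) by blast
qed

lemma place_bound:
  assumes "d \<in> {0..1}" "r \<in> {0..1}" shows "\<bar>place d n r i\<bar> \<le> 1"
proof -
  have "\<bar>d\<bar> * \<bar>zigzag r - r\<bar> \<le> 1 * 1"
    using assms zigzag_range[OF assms(2)] by (intro mult_mono) auto
  then show ?thesis
    using zigzag_range[OF assms(2)] unfolding place_def abs_mult[symmetric] by simp
qed

lemma place_lipschitz:
  assumes "d \<in> {0..1}" "d' \<in> {0..1}" "r \<in> {0..1}" "r' \<in> {0..1}"
  shows "\<bar>place d n r i - place d' n r' i\<bar> \<le> 58 * \<bar>r - r'\<bar> + \<bar>d - d'\<bar>"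
proof -
  note z = zigzag_lipschitz[OF assms(3,4)]
  \<comment> \<open>58 = 57 + 1, where the second summand comes from the identity in
    \<open>zigzag r - r\<close>.\<close>
  have z': "\<bar>(zigzag r - zigzag r') - (r - r')\<bar> \<le> 58 * \<bar>r - r'\<bar>"
    using order_trans[OF abs_triangle_ineq4 add_right_mono[OF z], of "r - r'"] by simp
  have split: "d * (zigzag r - r) - d' * (zigzag r' - r') =
      d * ((zigzag r - zigzag r') - (r - r')) + (d - d') * (zigzag r' - r')"
    by (simp add: algebra_simps)
  define e where "e = 58 * \<bar>r - r'\<bar> + \<bar>d - d'\<bar>"
  have "\<bar>d * (zigzag r - r) - d' * (zigzag r' - r')\<bar>
      \<le> \<bar>d\<bar> * \<bar>(zigzag r - zigzag r') - (r - r')\<bar> + \<bar>d - d'\<bar> * \<bar>zigzag r' - r'\<bar>"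
    unfolding split abs_mult[symmetric] by (rule abs_triangle_ineq)
  also have "\<dots> \<le> 1 * (58 * \<bar>r - r'\<bar>) + \<bar>d - d'\<bar> * 1"
    by (rule add_mono; rule mult_mono) (use assms z' zigzag_range[OF assms(4)] in auto)
  finally have v: "\<bar>d * (zigzag r - r) - d' * (zigzag r' - r')\<bar> \<le> e"
    by (simp only: mult_1 mult_1_right e_def)
  have u: "\<bar>zigzag r - zigzag r'\<bar> \<le> e"
    unfolding e_def by (rule order_trans[OF z]) simp
  have "0 \<le> e"
    unfolding e_def by (intro add_nonneg_nonneg mult_nonneg_nonneg) auto
  with u v show ?thesis
    unfolding e_def[symmetric] place_def by (simp del: diff_0 diff_0_right)
qed

definition unit_fun :: "(real \<Rightarrow> real) \<Rightarrow> real \<Rightarrow> complex" where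
  "unit_fun g = (\<lambda>t. if t \<in> {0..1} then complex_of_real (g t) else 0)"

definition zigzag_presentation ::
    "complex set \<Rightarrow> (nat \<Rightarrow> real) \<Rightarrow> (real \<Rightarrow> complex) presentation" where
  "zigzag_presentation K \<delta> =
     \<lparr>alg = cont_unit_interval K, num_special = \<infinity>, special = (\<lambda>i. unit_fun (coordinate \<delta> i))\<rparr>"

lemma zigzag_presentation_simps [simp]:
  "alg (zigzag_presentation K \<delta>) = cont_unit_interval K"
  "num_special (zigzag_presentation K \<delta>) = \<infinity>"
  "special (zigzag_presentation K \<delta>) i = unit_fun (coordinate \<delta> i)"
  by (simp_all add: zigzag_presentation_def)

lemma continuous_coordinate: "continuous_on S (coordinate \<delta> i)"
  unfolding coordinate_def zigzag_def Let_def
  by (cases "i = 0"; cases "odd i"; cases "\<delta> ((i - 1) div 2) = 0")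
    (auto intro!: continuous_intros continuous_ramp)

section \<open>Rational points as polynomials in the coordinates\<close>

context real_or_complex
begin

lemma unit_fun_mem: "continuous_on {0..1} g \<Longrightarrow> unit_fun g \<in> points A"
  by (auto simp: unit_fun_def intro!: continuous_intros
      cong: continuous_on_cong_simp)

lemma letter_value_zigzag:
  "letter_value (zigzag_presentation K \<delta>) l = unit_fun (coordinate \<delta> (letter_index l))"
  by (cases l) (auto simp: unit_fun_def)

lemma word_value_zigzag:
  "w \<noteq> [] \<Longrightarrow> word_value (zigzag_presentation K \<delta>) w = unit_fun (\<lambda>t. word_eval (\<lambda>i. coordinate \<delta> i t) w)"
proof (induction w rule: induct_list012)
  case (3 l l' w)
  then show ?case
    by (simp add: letter_value_zigzag) (auto simp: unit_fun_def word_eval_def)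
qed (auto simp: letter_value_zigzag word_eval_def)

lemma continuous_word_eval: "continuous_on S (\<lambda>t. word_eval (\<lambda>i. coordinate \<delta> i t) w)"
  by (induction w) (auto simp: word_eval_def intro!: continuous_intros continuous_coordinate)

lemma poly_value_zigzag:
  assumes "rational_poly K \<infinity> p"
  shows "poly_value (zigzag_presentation K \<delta>) p \<in> points A"
    "t \<in> {0..1} \<Longrightarrow> poly_value (zigzag_presentation K \<delta>) p t = poly_eval (\<lambda>i. coordinate \<delta> i t) p"
proof -
  have "poly_value (zigzag_presentation K \<delta>) p \<in> points A \<and> (t \<in> {0..1} \<longrightarrow>
      poly_value (zigzag_presentation K \<delta>) p t = poly_eval (\<lambda>i. coordinate \<delta> i t) p)"
    using assms
  proof (induction p)
    case Nil
    then show ?case by (simp add: poly_eval_def)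
  next
    case (Cons m p)
    obtain c w where m: "m = (c, w)" by fastforce
    have c: "c \<in> K" "w \<noteq> []" "rational_poly K \<infinity> p"
      using Cons.prems by (auto simp: rational_poly_def m)
    have w: "word_value (zigzag_presentation K \<delta>) w \<in> points A"
      unfolding word_value_zigzag[OF c(2)] by (intro unit_fun_mem continuous_word_eval)
    show ?case
      using cont_closed(1)[OF cont_closed(4)[OF w c(1)]] Cons.IH[OF c(3)]
      by (auto simp: m poly_eval_def word_value_zigzag[OF c(2)] unit_fun_def simp del: cont_simps(1))
  qed
  then show "poly_value (zigzag_presentation K \<delta>) p \<in> points A"
    "t \<in> {0..1} \<Longrightarrow> poly_value (zigzag_presentation K \<delta>) p t = poly_eval (\<lambda>i. coordinate \<delta> i t) p"
    by blast+
qed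

text \<open>Together with \<open>norm_le_of_places\<close> this describes the norm of a rational
  point as a supremum over places, without a case distinction on
  \<open>\<delta> n = 0\<close>.\<close>

lemma cmod_place_le_norm:
  assumes "rational_code K (zigzag_presentation K \<delta>) q" "r \<in> {0..1}"
  shows "cmod (poly_eval (place (\<delta> n) n r) (poly_of_code q))
    \<le> anorm A (point_of_code (zigzag_presentation K \<delta>) q)"
proof -
  obtain t where t: "t \<in> {0..1}" "(\<lambda>i. coordinate \<delta> i t) = place (\<delta> n) n r"
    using ex_coordinate_eq_place[OF assms(2), of \<delta> n] by (auto simp: fun_eq_iff)
  have rat: "rational_poly K \<infinity> (poly_of_code q)" using assms(1) by (simp add: rational_code_def)
  show ?thesis
    using cmod_le_cont_norm[OF poly_value_zigzag(1)[OF rat], of \<delta> t] poly_value_zigzag(2)[OF rat t(1), of \<delta>]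
    by (simp add: t(2) point_of_code_def)
qed

lemma norm_le_of_places:
  assumes rat: "rational_code K (zigzag_presentation K \<delta>) q" and \<delta>: "\<And>n. \<delta> n \<in> {0..1}"
    and c: "\<And>n r. n \<le> q \<Longrightarrow> r \<in> {0..1} \<Longrightarrow> cmod (poly_eval (place (\<delta> n) n r) (poly_of_code q)) \<le> c"
  shows "anorm A (point_of_code (zigzag_presentation K \<delta>) q) \<le> c"
proof (rule cont_norm_least)
  fix t :: real assume t: "t \<in> {0..1}"
  obtain n r where nr: "n \<le> q" "r \<in> {0..1}" "\<And>i. i \<le> q \<Longrightarrow> coordinate \<delta> i t = place (\<delta> n) n r i"
    using ex_place_eq_coordinate[OF t, of q \<delta>] by blast
  let ?x = "\<lambda>i. coordinate \<delta> i t"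
  \<comment> \<open>With error 0 the Lipschitz bound says that a polynomial depends only on the
    coordinates up to its code.\<close>
  have "cmod (poly_eval ?x (poly_of_code q) - poly_eval (place (\<delta> n) n r) (poly_of_code q)) \<le> real q * 0"
    by (rule poly_eval_lipschitz) (use nr place_bound[OF \<delta> nr(2)] in auto)
  then have "poly_eval ?x (poly_of_code q) = poly_eval (place (\<delta> n) n r) (poly_of_code q)" by simp
  moreover have "rational_poly K \<infinity> (poly_of_code q)" using rat by (simp add: rational_code_def)
  ultimately show "cmod (point_of_code (zigzag_presentation K \<delta>) q t) \<le> c"
    using c[OF nr(1,2)] poly_value_zigzag(2)[OF _ t] by (simp add: point_of_code_def)
qed

end

section \<open>Recursive functions with rational values\<close>

text \<open>With a difference of natural numbers over a successor, neither signs nor vanishing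
  denominators need a case distinction.\<close>

definition rat_recursive :: "nat \<Rightarrow> (nat list \<Rightarrow> real) \<Rightarrow> bool" where
  "rat_recursive n r \<longleftrightarrow> (\<exists>P N D. recursive n P \<and> recursive n N \<and> recursive n D \<and>
     (\<forall>xs. length xs = n \<longrightarrow> r xs = (real (P xs) - real (N xs)) / real (Suc (D xs))))"

lemma rat_recursiveI:
  assumes "recursive n P" "recursive n N" "recursive n D"
    "\<And>xs. length xs = n \<Longrightarrow> r xs = (real (P xs) - real (N xs)) / real (Suc (D xs))"
  shows "rat_recursive n r"
  using assms unfolding rat_recursive_def by blast

lemma rat_recursive_cong:
  assumes "rat_recursive n r" "\<And>xs. length xs = n \<Longrightarrow> r xs = r' xs"
  shows "rat_recursive n r'"
  using assms unfolding rat_recursive_def by metis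

lemma rat_recursive_of_nat: "recursive n a \<Longrightarrow> rat_recursive n (\<lambda>xs. real (a xs))"
  by (rule rat_recursiveI[of _ a "\<lambda>_. 0" "\<lambda>_. 0"]) (auto intro: recursive_const)

lemma rat_recursive_nat_const: "rat_recursive n (\<lambda>xs. real c)"
  by (intro rat_recursive_of_nat recursive_const)

lemma rat_recursive_tl:
  assumes "rat_recursive n r" shows "rat_recursive (Suc n) (\<lambda>xs. r (tl xs))"
proof -
  obtain P N D where *: "recursive n P" "recursive n N" "recursive n D"
    "\<And>xs. length xs = n \<Longrightarrow> r xs = (real (P xs) - real (N xs)) / real (Suc (D xs))"
    using assms unfolding rat_recursive_def by metis
  show ?thesis
    by (rule rat_recursiveI[OF *(1-3)[THEN recursive_tl]]) (simp add: *(4))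
qed

lemma rat_recursive_add:
  assumes "rat_recursive n r" "rat_recursive n r'"
  shows "rat_recursive n (\<lambda>xs. r xs + r' xs)"
proof -
  obtain P N D where *: "recursive n P" "recursive n N" "recursive n D"
    "\<And>xs. length xs = n \<Longrightarrow> r xs = (real (P xs) - real (N xs)) / real (Suc (D xs))"
    using assms(1) unfolding rat_recursive_def by metis
  obtain P' N' D' where **: "recursive n P'" "recursive n N'" "recursive n D'"
    "\<And>xs. length xs = n \<Longrightarrow> r' xs = (real (P' xs) - real (N' xs)) / real (Suc (D' xs))"
    using assms(2) unfolding rat_recursive_def by metis
  show ?thesis
  proof (rule rat_recursiveI)
    show "recursive n (\<lambda>xs. P xs * Suc (D' xs) + P' xs * Suc (D xs))"
      "recursive n (\<lambda>xs. N xs * Suc (D' xs) + N' xs * Suc (D xs))"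
      "recursive n (\<lambda>xs. Suc (D xs) * Suc (D' xs) - 1)"
      by (intro recursive_intros * **)+
    fix xs :: "nat list" assume "length xs = n"
    then show "r xs + r' xs = (real (P xs * Suc (D' xs) + P' xs * Suc (D xs)) -
        real (N xs * Suc (D' xs) + N' xs * Suc (D xs))) / real (Suc (Suc (D xs) * Suc (D' xs) - 1))"
      by (simp add: *(4) **(4) add_frac_eq algebra_simps)
  qed
qed

lemma rat_recursive_uminus:
  assumes "rat_recursive n r" shows "rat_recursive n (\<lambda>xs. - r xs)"
proof -
  obtain P N D where *: "recursive n P" "recursive n N" "recursive n D"
    "\<And>xs. length xs = n \<Longrightarrow> r xs = (real (P xs) - real (N xs)) / real (Suc (D xs))"
    using assms unfolding rat_recursive_def by metis
  show ?thesis
    by (rule rat_recursiveI[OF *(2,1,3)]) (simp add: *(4) minus_divide_left)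
qed

lemma rat_recursive_diff:
  assumes "rat_recursive n r" "rat_recursive n r'"
  shows "rat_recursive n (\<lambda>xs. r xs - r' xs)"
  using rat_recursive_add[OF assms(1) rat_recursive_uminus[OF assms(2)]] by simp

lemma rat_recursive_mult:
  assumes "rat_recursive n r" "rat_recursive n r'"
  shows "rat_recursive n (\<lambda>xs. r xs * r' xs)"
proof -
  obtain P N D where *: "recursive n P" "recursive n N" "recursive n D"
    "\<And>xs. length xs = n \<Longrightarrow> r xs = (real (P xs) - real (N xs)) / real (Suc (D xs))"
    using assms(1) unfolding rat_recursive_def by metis
  obtain P' N' D' where **: "recursive n P'" "recursive n N'" "recursive n D'"
    "\<And>xs. length xs = n \<Longrightarrow> r' xs = (real (P' xs) - real (N' xs)) / real (Suc (D' xs))"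
    using assms(2) unfolding rat_recursive_def by metis
  show ?thesis
  proof (rule rat_recursiveI)
    show "recursive n (\<lambda>xs. P xs * P' xs + N xs * N' xs)"
      "recursive n (\<lambda>xs. P xs * N' xs + N xs * P' xs)"
      "recursive n (\<lambda>xs. Suc (D xs) * Suc (D' xs) - 1)"
      by (intro recursive_intros * **)+
    fix xs :: "nat list" assume "length xs = n"
    then show "r xs * r' xs = (real (P xs * P' xs + N xs * N' xs) -
        real (P xs * N' xs + N xs * P' xs)) / real (Suc (Suc (D xs) * Suc (D' xs) - 1))"
      by (simp add: *(4) **(4) algebra_simps)
  qed
qed

lemma rat_recursive_power: "rat_recursive n r \<Longrightarrow> rat_recursive n (\<lambda>xs. r xs ^ k)"
  by (induction k) (use rat_recursive_nat_const[of n 1] in \<open>auto intro: rat_recursive_mult\<close>)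

lemma rat_recursive_divide_nat:
  assumes "rat_recursive n r" "recursive n b"
  shows "rat_recursive n (\<lambda>xs. r xs / real (b xs))"
proof -
  have "rat_recursive n (\<lambda>xs. 1 / real (b xs))"
  proof (rule rat_recursiveI)
    \<comment> \<open>If \<open>b xs\<close> is 0, the numerator is 0, in accordance with division
      by 0.\<close>
    show "recursive n (\<lambda>xs. if b xs = 0 then 0 else 1)" "recursive n (\<lambda>_. 0)"
      "recursive n (\<lambda>xs. b xs - 1)"
      by (intro recursive_intros assms)+
  qed auto
  from rat_recursive_mult[OF assms(1) this] show ?thesis by simp
qed

lemma rat_recursive_if:
  assumes "decidable n Q" "rat_recursive n r" "rat_recursive n r'"
  shows "rat_recursive n (\<lambda>xs. if Q xs then r xs else r' xs)"
proof -
  have "rat_recursive n (\<lambda>xs. real (if Q xs then 1 else 0) * r xs + real (if Q xs then 0 else 1) * r' xs)"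
    by (intro rat_recursive_add rat_recursive_mult rat_recursive_of_nat recursive_intros assms)
  then show ?thesis by (rule rat_recursive_cong) auto
qed

lemma decidable_rat_less:
  assumes "rat_recursive n r" "rat_recursive n r'"
  shows "decidable n (\<lambda>xs. r xs < r' xs)"
proof -
  obtain P N D where *: "recursive n P" "recursive n N" "recursive n D"
    "\<And>xs. length xs = n \<Longrightarrow> r' xs - r xs = (real (P xs) - real (N xs)) / real (Suc (D xs))"
    using rat_recursive_diff[OF assms(2,1)] unfolding rat_recursive_def by metis
  have "r xs < r' xs \<longleftrightarrow> N xs < P xs" if "length xs = n" for xs
  proof -
    have "r xs < r' xs \<longleftrightarrow> 0 < r' xs - r xs" by simp
    also have "\<dots> \<longleftrightarrow> N xs < P xs"
      unfolding *(4)[OF that] by (simp add: zero_less_divide_iff)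
    finally show ?thesis .
  qed
  then show ?thesis
    using decidable_less[OF *(2,1)] unfolding decidable_def by (auto elim: recursive_cong)
qed

lemma decidable_rat_le:
  assumes "rat_recursive n r" "rat_recursive n r'"
  shows "decidable n (\<lambda>xs. r xs \<le> r' xs)"
  using decidable_not[OF decidable_rat_less[OF assms(2,1)]] by (simp add: not_less)

definition real_of_code :: "nat \<Rightarrow> real" where
  "real_of_code c = real_of_rat (rat_of_code c)"

lemma real_of_code_prod_encode:
  "real_of_code (prod_encode (a, b)) = real_of_int (int_decode a) / real (Suc b)"
  by (simp add: real_of_code_def rat_of_code_def of_rat_divide of_rat_add)

lemma rat_recursive_real_of_code:
  assumes "recursive n c" shows "rat_recursive n (\<lambda>xs. real_of_code (c xs))"
proof (rule rat_recursiveI)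
  let ?a = "\<lambda>xs. fst (prod_decode (c xs))"
  show "recursive n (\<lambda>xs. if even (?a xs) then ?a xs div 2 else 0)"
    "recursive n (\<lambda>xs. if even (?a xs) then 0 else Suc (?a xs div 2))"
    "recursive n (\<lambda>xs. snd (prod_decode (c xs)))"
    by (intro code_intros assms)+
  fix xs
  have "c xs = prod_encode (?a xs, snd (prod_decode (c xs)))" by simp
  then have "real_of_code (c xs) = real_of_int (int_decode (?a xs)) / real (Suc (snd (prod_decode (c xs))))"
    using real_of_code_prod_encode by metis
  then show "real_of_code (c xs) = (real (if even (?a xs) then ?a xs div 2 else 0) -
      real (if even (?a xs) then 0 else Suc (?a xs div 2))) / real (Suc (snd (prod_decode (c xs))))"
    by (auto simp: int_decode_def sum_decode_def)
qed

lemma rat_recursive_code: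
  assumes "rat_recursive n r"
  shows "\<exists>c. recursive n c \<and> (\<forall>xs. length xs = n \<longrightarrow> real_of_code (c xs) = r xs)"
proof -
  obtain P N D where *: "recursive n P" "recursive n N" "recursive n D"
    "\<And>xs. length xs = n \<Longrightarrow> r xs = (real (P xs) - real (N xs)) / real (Suc (D xs))"
    using assms unfolding rat_recursive_def by metis
  let ?a = "\<lambda>p n :: nat. if n \<le> p then 2 * (p - n) else Suc (2 * (n - p - 1))"
  have "int_decode (?a p n) = int p - int n" for p n
    by (auto simp: int_decode_def sum_decode_def)
  then have "real_of_code (prod_encode (?a (P xs) (N xs), D xs)) = r xs" if "length xs = n" for xs
    unfolding real_of_code_prod_encode *(4)[OF that] by simp
  moreover have "recursive n (\<lambda>xs. prod_encode (?a (P xs) (N xs), D xs))"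
    by (intro code_intros *)
  ultimately show ?thesis by (intro exI[of _ "\<lambda>xs. prod_encode (?a (P xs) (N xs), D xs)"]) blast
qed

text \<open>Primitive recursion carries a natural number, so the accumulator is a code of the
  rational value. Codes are not unique; the invariant speaks of decoded values only.\<close>

lemma rat_recursive_fold:
  assumes B: "rat_recursive (Suc n) (\<lambda>ys. B (hd ys) (tl ys))" and c: "recursive n c"
    and init: "rat_recursive n (\<lambda>_. init)"
    and step: "rat_recursive 2 (\<lambda>xs. f (real_of_code (xs ! 0)) (real_of_code (xs ! 1)))"
  shows "rat_recursive n (\<lambda>xs. rec_nat init (\<lambda>i y. f y (B i xs)) (c xs))"
proof -
  obtain b where b: "recursive (Suc n) b"
      "\<And>ys. length ys = Suc n \<Longrightarrow> real_of_code (b ys) = B (hd ys) (tl ys)"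
    using rat_recursive_code[OF B] by blast
  obtain a where a: "recursive n a" "\<And>xs. length xs = n \<Longrightarrow> real_of_code (a xs) = init"
    using rat_recursive_code[OF init] by blast
  obtain s where s: "recursive 2 s"
      "\<And>xs. length xs = 2 \<Longrightarrow> real_of_code (s xs) = f (real_of_code (xs ! 0)) (real_of_code (xs ! 1))"
    using rat_recursive_code[OF step] by blast
  have s': "recursive 2 (\<lambda>xs. s [xs ! 0, xs ! 1])"
    using s(1)
  proof (rule recursive_cong)
    fix xs :: "nat list" assume "length xs = 2"
    then have "xs = [xs ! 0, xs ! 1]" by (auto simp: length_Suc_conv numeral_2_eq_2)
    then show "s xs = s [xs ! 0, xs ! 1]" by metis
  qed
  define R where "R = (\<lambda>xs. rec_nat (a xs) (\<lambda>i y. s [y, b (i # xs)]))"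
  have "recursive (Suc (Suc n)) (\<lambda>ys. s [hd (tl ys), b (hd ys # tl (tl ys))])"
    by (rule recursive_app2[where f = "\<lambda>x y. s [x, y]", OF s'])
      (intro recursive_tl recursive_hd recursive_skip b)+
  then have "recursive n (\<lambda>xs. R xs (c xs))"
    unfolding R_def by (intro recursive_rec a c)
  then have "rat_recursive n (\<lambda>xs. real_of_code (R xs (c xs)))"
    by (rule rat_recursive_real_of_code)
  then show ?thesis
  proof (rule rat_recursive_cong)
    fix xs :: "nat list" assume xs: "length xs = n"
    have "real_of_code (R xs m) = rec_nat init (\<lambda>i y. f y (B i xs)) m" for m
      by (induction m) (simp_all add: R_def xs a s b)
    then show "real_of_code (R xs (c xs)) = rec_nat init (\<lambda>i y. f y (B i xs)) (c xs)" .
  qed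
qed

lemma rat_recursive_sum:
  assumes "rat_recursive (Suc n) (\<lambda>ys. B (hd ys) (tl ys))" "recursive n c"
  shows "rat_recursive n (\<lambda>xs. \<Sum>i<c xs. B i xs)"
proof -
  have "rat_recursive n (\<lambda>xs. rec_nat 0 (\<lambda>i y. y + B i xs) (c xs))"
    using rat_recursive_nat_const[of n 0]
    by (intro rat_recursive_fold[OF assms, where f = "(+)"] rat_recursive_add
        rat_recursive_real_of_code recursive_nth) auto
  moreover have "rec_nat 0 (\<lambda>i y. y + B i xs) m = (\<Sum>i<m. B i xs)" for xs m
    by (induction m) auto
  ultimately show ?thesis by simp
qed

lemma rat_recursive_prod:
  assumes "rat_recursive (Suc n) (\<lambda>ys. B (hd ys) (tl ys))" "recursive n c"
  shows "rat_recursive n (\<lambda>xs. \<Prod>i<c xs. B i xs)"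
proof -
  have "rat_recursive n (\<lambda>xs. rec_nat 1 (\<lambda>i y. y * B i xs) (c xs))"
    using rat_recursive_nat_const[of n 1]
    by (intro rat_recursive_fold[OF assms, where f = "(*)"] rat_recursive_mult
        rat_recursive_real_of_code recursive_nth) auto
  moreover have "rec_nat 1 (\<lambda>i y. y * B i xs) m = (\<Prod>i<m. B i xs)" for xs m
    by (induction m) auto
  ultimately show ?thesis by simp
qed

lemma rat_recursive_const:
  "rat_recursive n (\<lambda>xs. 0)" "rat_recursive n (\<lambda>xs. 1)" "rat_recursive n (\<lambda>xs. numeral k)"
  using rat_recursive_nat_const[of n 0] rat_recursive_nat_const[of n 1]
    rat_recursive_nat_const[of n "numeral k"] by simp_all

lemma rat_recursive_divide_power:
  assumes "rat_recursive n r" "recursive n b"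
  shows "rat_recursive n (\<lambda>xs. r xs / 2 ^ b xs)"
  using rat_recursive_divide_nat[OF assms(1) recursive_power[OF recursive_const[of n 2] assms(2)]] by simp

lemmas rat_recursive_intros =
  rat_recursive_const rat_recursive_of_nat rat_recursive_add rat_recursive_diff rat_recursive_mult
  rat_recursive_power rat_recursive_divide_nat rat_recursive_divide_power rat_recursive_if
  rat_recursive_sum rat_recursive_prod rat_recursive_real_of_code decidable_rat_less
  decidable_rat_le rat_recursive_tl

subsection \<open>Evaluation is recursive\<close>

text \<open>With \<open>proj = fst\<close> and \<open>proj = snd\<close>, this is the real and the imaginary part of \<open>poly_eval\<close>.\<close>

definition poly_part :: "(nat \<times> nat \<Rightarrow> nat) \<Rightarrow> (nat \<Rightarrow> real) \<Rightarrow> nat \<Rightarrow> real" where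
  "poly_part proj x q = (\<Sum>j<code_length q.
     real_of_code (proj (prod_decode (fst (prod_decode (code_nth q j))))) *
     (\<Prod>l<code_length (snd (prod_decode (code_nth q j))).
        x (code_nth (snd (prod_decode (code_nth q j))) l div 2)))"

lemma prod_list_eq_prod_nth: "prod_list xs = (\<Prod>i<length xs. xs ! i :: 'a :: comm_monoid_mult)"
  by (induction xs) (simp_all del: prod.lessThan_Suc add: prod.lessThan_Suc_shift)

lemma poly_eval_parts:
  "Re (poly_eval x (poly_of_code q)) = poly_part fst x q"
  "Im (poly_eval x (poly_of_code q)) = poly_part snd x q"
proof -
  define ts where "ts = list_decode q"
  have q: "q = list_encode ts" by (simp add: ts_def)
  have word: "word_eval x (map sum_decode (list_decode b)) =
      (\<Prod>l<code_length b. x (code_nth b l div 2))" for b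
  proof -
    define ls where "ls = list_decode b"
    have b: "b = list_encode ls" by (simp add: ls_def)
    show ?thesis
      by (simp add: b word_eval_def prod_list_eq_prod_nth letter_index_sum_decode)
  qed
  have eval: "poly_eval x (poly_of_code q) = (\<Sum>j<length ts.
      coeff_of_code (fst (prod_decode (ts ! j))) *
      complex_of_real (\<Prod>l<code_length (snd (prod_decode (ts ! j))).
        x (code_nth (snd (prod_decode (ts ! j))) l div 2)))"
    by (simp add: poly_eval_def poly_of_code_def q sum_list_sum_nth atLeast0LessThan
        term_of_code_def case_prod_beta word)
  show "Re (poly_eval x (poly_of_code q)) = poly_part fst x q"
    "Im (poly_eval x (poly_of_code q)) = poly_part snd x q"
    unfolding eval unfolding poly_part_def q
    by (auto simp: coeff_of_code_def case_prod_beta real_of_code_def simp del: of_real_prod intro!: sum.cong)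
qed

lemma rat_recursive_place:
  assumes "rat_recursive n d" "recursive n m" "rat_recursive n r" "recursive n i"
  shows "rat_recursive n (\<lambda>xs. place (d xs) (m xs) (r xs) (i xs))"
  unfolding place_def zigzag_def
  by (intro rat_recursive_intros code_intros assms)

lemma rat_recursive_poly_part:
  assumes "rat_recursive n d" "recursive n m" "rat_recursive n r" "recursive n q"
  shows "rat_recursive n (\<lambda>xs. poly_part fst (place (d xs) (m xs) (r xs)) (q xs))"
    "rat_recursive n (\<lambda>xs. poly_part snd (place (d xs) (m xs) (r xs)) (q xs))"
  unfolding poly_part_def
  by (intro rat_recursive_intros rat_recursive_place code_intros assms)+

section \<open>Approximation of the strand distances and of the norm\<close>

definition delta :: "(nat \<Rightarrow> nat \<Rightarrow> bool) \<Rightarrow> nat \<Rightarrow> real" where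
  "delta T n = (if \<exists>s. T n s then 1 / 2 ^ (LEAST s. T n s) else 0)"

text \<open>The alternative \<open>m < s\<close> ends the search at \<open>m + 1\<close> at the
  latest, so that it is total. A result above \<open>m\<close> means that no time up to
  \<open>m\<close> was found.\<close>

definition delta_upto :: "(nat \<Rightarrow> nat \<Rightarrow> bool) \<Rightarrow> nat \<Rightarrow> nat \<Rightarrow> real" where
  "delta_upto T m n =
     (if (LEAST s. T n s \<or> m < s) \<le> m then 1 / 2 ^ (LEAST s. T n s \<or> m < s) else 0)"

lemma delta_range: "delta T n \<in> {0..1}"
  by (auto simp: delta_def)

lemma delta_upto_range: "delta_upto T m n \<in> {0..1}"
  by (auto simp: delta_upto_def)

text \<open>A time not found up to \<open>m\<close> exceeds \<open>m\<close>, so ignoring it changes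
  the distance by at most \<open>1 / 2 ^ m\<close>. This is why the undecidability of halting does
  not affect the norm.\<close>

lemma delta_upto_close: "\<bar>delta T n - delta_upto T m n\<bar> \<le> 1 / 2 ^ m"
proof (cases "\<exists>s\<le>m. T n s")
  case True
  then obtain s where s: "s \<le> m" "T n s" by blast
  let ?l = "LEAST s. T n s"
  have l: "T n ?l" "?l \<le> m"
    using s(2) LeastI[of "T n"] Least_le[of "T n" s] s(1) by auto
  have "(LEAST s. T n s \<or> m < s) = ?l"
    by (rule Least_equality) (use l in \<open>auto intro: Least_le\<close>)
  then show ?thesis using s l by (auto simp: delta_def delta_upto_def)
next
  case False
  have "\<not> (LEAST s. T n s \<or> m < s) \<le> m"
    using LeastI[of "\<lambda>s. T n s \<or> m < s" "Suc m"] False by auto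
  moreover have "\<bar>delta T n\<bar> \<le> 1 / 2 ^ m"
  proof (cases "\<exists>s. T n s")
    case True
    then have "T n (LEAST s. T n s)" by (rule LeastI_ex)
    then have "m \<le> (LEAST s. T n s)" using False nat_le_linear by blast
    then have "(2::real) ^ m \<le> 2 ^ (LEAST s. T n s)" by (intro power_increasing) auto
    then show ?thesis using True by (simp add: delta_def frac_le)
  qed (simp add: delta_def)
  ultimately show ?thesis by (simp add: delta_upto_def)
qed

lemma rat_recursive_delta_upto:
  assumes T: "\<And>n a b. recursive n a \<Longrightarrow> recursive n b \<Longrightarrow> decidable n (\<lambda>xs. T (a xs) (b xs))"
    and "recursive n m" "recursive n a"
  shows "rat_recursive n (\<lambda>xs. delta_upto T (m xs) (a xs))"
proof -
  have "recursive n (\<lambda>xs. LEAST s. T (a xs) s \<or> m xs < s)"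
  proof (rule recursive_Least)
    show "decidable (Suc n) (\<lambda>ys. T (a (tl ys)) (hd ys) \<or> m (tl ys) < hd ys)"
      by (intro code_intros T assms)
    show "\<exists>s. T (a xs) s \<or> m xs < s" for xs by blast
  qed
  then show ?thesis
    unfolding delta_upto_def by (intro rat_recursive_intros code_intros assms)
qed

definition grid_value :: "(nat \<Rightarrow> nat \<Rightarrow> bool) \<Rightarrow> nat \<Rightarrow> nat \<Rightarrow> nat \<Rightarrow> nat \<Rightarrow> complex" where
  "grid_value T q m n j =
     poly_eval (place (delta_upto T m n) n (real j / real (64 * 2 ^ m))) (poly_of_code q)"

text \<open>\<open>c\<close> is an upper bound in units of \<open>1 / 2 ^ (k + 2)\<close>, a quarter
  of the tolerance. The grid has mesh \<open>1 / (64 * 2 ^ m)\<close> with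
  \<open>m = q + k + 3\<close>, where 64 exceeds the Lipschitz constant 58 of
  \<open>place\<close>.\<close>

definition grid_bound :: "(nat \<Rightarrow> nat \<Rightarrow> bool) \<Rightarrow> nat \<Rightarrow> nat \<Rightarrow> nat \<Rightarrow> bool" where
  "grid_bound T q k c \<longleftrightarrow> (\<forall>n\<le>q. \<forall>j\<le>64 * 2 ^ (q + k + 3).
     cmod (grid_value T q (q + k + 3) n j) \<le> real c / 2 ^ (k + 2))"

lemma grid_point_range: "j \<le> 64 * 2 ^ m \<Longrightarrow> real j / real (64 * 2 ^ m) \<in> {0..1}"
proof -
  assume "j \<le> 64 * 2 ^ m"
  then have "real j \<le> real (64 * 2 ^ m)" by (simp only: of_nat_le_iff)
  then show ?thesis by (simp add: divide_le_eq)
qed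

lemma decidable_grid_bound:
  assumes T: "\<And>n a b. recursive n a \<Longrightarrow> recursive n b \<Longrightarrow> decidable n (\<lambda>xs. T (a xs) (b xs))"
    and "recursive n q" "recursive n k" "recursive n c"
  shows "decidable n (\<lambda>xs. grid_bound T (q xs) (k xs) (c xs))"
proof -
  \<comment> \<open>Squaring avoids the root in the modulus and keeps both sides rational.\<close>
  have eq: "cmod (grid_value T q m n j) \<le> c / 2 ^ l \<longleftrightarrow>
      (poly_part fst (place (delta_upto T m n) n (real j / real (64 * 2 ^ m))) q)\<^sup>2 +
      (poly_part snd (place (delta_upto T m n) n (real j / real (64 * 2 ^ m))) q)\<^sup>2 \<le> (c / 2 ^ l)\<^sup>2"
    if "0 \<le> c" for q m n j l c
    unfolding grid_value_def poly_eval_parts[symmetric] cmod_power2[symmetric]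
    using that by (simp add: abs_le_square_iff[symmetric])
  show ?thesis
    unfolding grid_bound_def eq[OF of_nat_0_le_iff]
    by (intro rat_recursive_intros code_intros rat_recursive_poly_part rat_recursive_delta_upto T assms)
qed

lemma ex_grid_bound: "\<exists>c. grid_bound T q k c"
proof -
  let ?M = "cmod (poly_eval (\<lambda>_. 0) (poly_of_code q)) + real q"
  obtain c where c: "?M * 2 ^ (k + 2) \<le> real c" using real_arch_simple by blast
  have "cmod (grid_value T q m n j) \<le> ?M" if "j \<le> 64 * 2 ^ m" for m n j
  proof -
    let ?x = "place (delta_upto T m n) n (real j / real (64 * 2 ^ m))"
    have "cmod (poly_eval ?x (poly_of_code q) - poly_eval (\<lambda>_. 0) (poly_of_code q)) \<le> real q * 1"
      using place_bound[OF delta_upto_range grid_point_range[OF that], of T m n n]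
      by (intro poly_eval_lipschitz) auto
    then show ?thesis
      unfolding grid_value_def
      using norm_triangle_sub[of "poly_eval ?x (poly_of_code q)" "poly_eval (\<lambda>_. 0) (poly_of_code q)"]
      by linarith
  qed
  moreover have "?M \<le> real c / 2 ^ (k + 2)" using c by (simp add: pos_le_divide_eq)
  ultimately have "grid_bound T q k c"
    unfolding grid_bound_def by (meson order_trans)
  then show ?thesis ..
qed

text \<open>With \<open>m = q + k + 3\<close>, the mesh and the cut-off of the distance each move a
  coordinate by at most \<open>1 / 2 ^ m\<close>. The Lipschitz constant \<open>q\<close> is at most
  \<open>2 ^ q\<close>, which leaves \<open>2 ^ q * 2 / 2 ^ m\<close>.\<close>

lemma grid_value_close:
  assumes r: "r \<in> {0..1}" and j: "j \<le> 64 * 2 ^ (q + k + 3)"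
    and rj: "\<bar>r - real j / real (64 * 2 ^ (q + k + 3))\<bar> \<le> 1 / real (64 * 2 ^ (q + k + 3))"
  shows "cmod (poly_eval (place (delta T n) n r) (poly_of_code q) - grid_value T q (q + k + 3) n j)
    \<le> 1 / 2 ^ (k + 2)"
proof -
  let ?m = "q + k + 3" and ?N = "real (64 * 2 ^ (q + k + 3))"
  have "cmod (poly_eval (place (delta T n) n r) (poly_of_code q) - grid_value T q ?m n j)
      \<le> real q * (2 / 2 ^ ?m)"
    unfolding grid_value_def
  proof (rule poly_eval_lipschitz)
    fix i
    have "58 * \<bar>r - real j / ?N\<bar> \<le> 58 * (1 / ?N)" by (intro mult_left_mono rj) auto
    also have "\<dots> \<le> 1 / 2 ^ ?m" by (simp add: divide_simps)
    finally have "\<bar>place (delta T n) n r i - place (delta_upto T ?m n) n (real j / ?N) i\<bar> \<le> 2 / 2 ^ ?m"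
      using place_lipschitz[where d = "delta T n" and d' = "delta_upto T ?m n" and n = n and i = i,
          OF delta_range delta_upto_range r grid_point_range[OF j]]
        delta_upto_close[of T n ?m] by linarith
    then show "\<bar>place (delta T n) n r i\<bar> \<le> 1 \<and> \<bar>place (delta_upto T ?m n) n (real j / ?N) i\<bar> \<le> 1 \<and>
        \<bar>place (delta T n) n r i - place (delta_upto T ?m n) n (real j / ?N) i\<bar> \<le> 2 / 2 ^ ?m"
      using place_bound[OF delta_range r] place_bound[OF delta_upto_range grid_point_range[OF j]] by blast
  qed simp
  also have "\<dots> \<le> 2 ^ q * (2 / 2 ^ ?m)"
    using of_nat_less_two_power[of q, where 'a = real] by (intro mult_right_mono) auto
  also have "\<dots> = 1 / 2 ^ (k + 2)" by (simp add: power_add)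
  finally show ?thesis .
qed

text \<open>In units of \<open>1 / 2 ^ (k + 2)\<close>, the norm exceeds the least bound by at most
  1, the grid error, and falls short of it by at most 2, the rounding and the grid error. The
  tolerance is 4 units.\<close>

lemma (in real_or_complex) norm_approximation:
  assumes rat: "rational_code K (zigzag_presentation K (delta T)) q"
  shows "\<bar>anorm A (point_of_code (zigzag_presentation K (delta T)) q) -
    real (LEAST c. grid_bound T q k c) / 2 ^ (k + 2)\<bar> < 1 / 2 ^ k"
proof -
  let ?n = "anorm A (point_of_code (zigzag_presentation K (delta T)) q)"
  let ?c = "LEAST c. grid_bound T q k c" and ?m = "q + k + 3" and ?e = "1 / 2 ^ (k + 2) :: real"
  have c: "grid_bound T q k ?c" using ex_grid_bound by (rule LeastI_ex)
  have "?n \<le> ?c / 2 ^ (k + 2) + ?e"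
  proof (rule norm_le_of_places[OF rat delta_range])
    fix n r assume n: "n \<le> q" and r: "r \<in> {0..1::real}"
    let ?N = "64 * 2 ^ ?m :: nat"
    define M where "M = real ?N"
    have M: "0 < M" by (simp add: M_def)
    define j where "j = nat \<lfloor>r * M\<rfloor>"
    have j: "real j \<le> r * M" "r * M < real j + 1"
      using r M unfolding j_def by (simp_all add: floor_le_iff)
    have "r * M \<le> 1 * M" using r M by (intro mult_right_mono) auto
    then have "real j \<le> real ?N" using j(1) unfolding M_def by linarith
    then have jN: "j \<le> ?N" by (simp only: of_nat_le_iff)
    have "r - real j / M = (r * M - real j) / M"
      using M by (simp add: diff_divide_distrib)
    then have "\<bar>r - real j / M\<bar> = \<bar>r * M - real j\<bar> / M"
      using M by (simp only: abs_divide abs_of_pos)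
    also have "\<dots> \<le> 1 / M"
      using j M by (intro divide_right_mono) auto
    finally have "\<bar>r - real j / M\<bar> \<le> 1 / M" .
    then have "cmod (poly_eval (place (delta T n) n r) (poly_of_code q) - grid_value T q ?m n j) \<le> ?e"
      unfolding M_def
      by (rule grid_value_close[OF r jN])
    moreover have "cmod (grid_value T q ?m n j) \<le> ?c / 2 ^ (k + 2)"
      using c n jN unfolding grid_bound_def by blast
    ultimately show "cmod (poly_eval (place (delta T n) n r) (poly_of_code q)) \<le> ?c / 2 ^ (k + 2) + ?e"
      using norm_triangle_sub[of "poly_eval (place (delta T n) n r) (poly_of_code q)" "grid_value T q ?m n j"]
      by linarith
  qed
  moreover have "?c / 2 ^ (k + 2) \<le> ?n + 2 * ?e"
  proof (cases ?c)
    case 0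
    have "0 \<le> cmod (poly_eval (place (delta T 0) 0 0) (poly_of_code q))" by simp
    also have "\<dots> \<le> ?n" by (rule cmod_place_le_norm[OF rat]) simp
    finally show ?thesis using 0 by simp
  next
    case (Suc c)
    \<comment> \<open>By minimality the next smaller bound fails at some grid point, and this point
      bounds the norm from below.\<close>
    then have "\<not> grid_bound T q k c" using not_less_Least[of c "grid_bound T q k"] by simp
    then obtain n j where nj: "n \<le> q" "j \<le> 64 * 2 ^ ?m"
        "real c / 2 ^ (k + 2) < cmod (grid_value T q ?m n j)"
      unfolding grid_bound_def by (auto simp: not_le)
    let ?v = "poly_eval (place (delta T n) n (real j / real (64 * 2 ^ ?m))) (poly_of_code q)"
    have "cmod (?v - grid_value T q ?m n j) \<le> ?e"
      by (rule grid_value_close[OF grid_point_range[OF nj(2)] nj(2)]) simp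
    moreover have "cmod ?v \<le> ?n"
      by (rule cmod_place_le_norm[OF rat grid_point_range[OF nj(2)]])
    ultimately have "real c / 2 ^ (k + 2) \<le> ?n + ?e"
      using nj(3) norm_triangle_sub[of "grid_value T q ?m n j" ?v] by (simp add: norm_minus_commute)
    moreover have "real ?c / 2 ^ (k + 2) = real c / 2 ^ (k + 2) + ?e"
      unfolding Suc by (simp add: add_divide_distrib)
    ultimately show ?thesis by linarith
  qed
  moreover have "2 * ?e < 1 / 2 ^ k" "?e < 1 / 2 ^ k" by (simp_all add: divide_simps)
  ultimately show ?thesis by linarith
qed

lemma (in real_or_complex) norm_computable:
  assumes T: "\<And>n a b. recursive n a \<Longrightarrow> recursive n b \<Longrightarrow> decidable n (\<lambda>xs. T (a xs) (b xs))"
  shows "\<exists>f. \<forall>p k. rational_code K (zigzag_presentation K (delta T)) p \<longrightarrow>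
    (\<exists>q. rec_eval f [p, k] q \<and>
      \<bar>anorm A (point_of_code (zigzag_presentation K (delta T)) p) - of_rat (rat_of_code q)\<bar> < 1 / 2 ^ k)"
proof -
  have nth: "recursive 2 (\<lambda>xs. xs ! 0)" "recursive 2 (\<lambda>xs. xs ! 1)"
    by (simp_all add: recursive_nth)
  have "recursive 2 (\<lambda>xs. LEAST c. grid_bound T (xs ! 0) (xs ! 1) c)"
    by (intro recursive_Least decidable_grid_bound T ex_grid_bound recursive_tl recursive_hd nth)
  then have "rat_recursive 2 (\<lambda>xs. real (LEAST c. grid_bound T (xs ! 0) (xs ! 1) c) / 2 ^ (xs ! 1 + 2))"
    by (intro rat_recursive_intros recursive_intros nth)
  then obtain c where c: "recursive 2 c" "\<And>xs. length xs = 2 \<Longrightarrow> real_of_code (c xs) =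
      real (LEAST c. grid_bound T (xs ! 0) (xs ! 1) c) / 2 ^ (xs ! 1 + 2)"
    using rat_recursive_code by blast
  then obtain f where f: "\<And>xs. length xs = 2 \<Longrightarrow> rec_eval f xs (c xs)"
    unfolding recursive_def by blast
  show ?thesis
  proof (intro exI[of _ f] allI impI)
    fix p k assume "rational_code K (zigzag_presentation K (delta T)) p"
    from norm_approximation[OF this, of k] have "\<bar>anorm A (point_of_code (zigzag_presentation K (delta T)) p) -
        real_of_code (c [p, k])\<bar> < 1 / 2 ^ k"
      using c(2)[of "[p, k]"] by simp
    then show "\<exists>q. rec_eval f [p, k] q \<and> \<bar>anorm A (point_of_code (zigzag_presentation K (delta T)) p) -
        of_rat (rat_of_code q)\<bar> < 1 / 2 ^ k"
      using f[of "[p, k]"] by (auto simp: real_of_code_def)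
  qed
qed

section \<open>Zigzag presentations generate the algebra\<close>

lemma ramp_mono: "x \<le> y \<Longrightarrow> ramp n x \<le> ramp n y"
proof -
  assume "x \<le> y"
  then have "2 ^ Suc n * x \<le> 2 ^ Suc n * y" by (intro mult_left_mono) auto
  then show ?thesis unfolding ramp_def by linarith
qed

text \<open>Choose the segment that contains \<open>y\<close>, that is, the least \<open>n\<close>
  with 2^-(n+1) < y. Then \<open>ramp n\<close> is positive at \<open>y\<close> and not yet cut off
  at 1.\<close>

lemma ramp_separates:
  assumes "0 \<le> x" "x < y" "y \<le> 1"
  shows "\<exists>n. ramp n x < ramp n y"
proof -
  obtain m where "1 / y < 2 ^ m" using real_arch_pow[of 2 "1 / y"] by auto
  then have "1 < 2 ^ Suc m * y"
    using assms by (simp add: field_simps)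
  then have ex: "\<exists>m. 1 < 2 ^ Suc m * y" ..
  define n where "n = (LEAST m. 1 < 2 ^ Suc m * y)"
  have n: "1 < 2 ^ Suc n * y" unfolding n_def using ex by (rule LeastI_ex)
  have "2 ^ n * y \<le> 1"
  proof (cases n)
    case (Suc m)
    then show ?thesis using not_less_Least[of m "\<lambda>n. 1 < 2 ^ Suc n * y"] by (simp add: n_def not_less)
  qed (use assms in simp)
  moreover have "2 ^ Suc n * x < 2 ^ Suc n * y" using assms by (intro mult_strict_left_mono) auto
  ultimately have "ramp n x < ramp n y"
    using n unfolding ramp_def power_Suc by linarith
  then show ?thesis ..
qed

context real_or_complex
begin

lemma unit_fun_algebra:
  "vadd A (unit_fun f) (unit_fun g) = unit_fun (\<lambda>t. f t + g t)"
  "amult A (unit_fun f) (unit_fun g) = unit_fun (\<lambda>t. f t * g t)"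
  "vscale A (complex_of_real c) (unit_fun f) = unit_fun (\<lambda>t. c * f t)"
  by (auto simp: unit_fun_def)

lemma closed_star_subalgebra_limit:
  assumes S: "closed_star_subalgebra K A S" and f: "f \<in> points A"
    and approx: "\<And>e. e > 0 \<Longrightarrow> \<exists>g\<in>S. adist A f g < e"
  shows "f \<in> S"
proof (rule ccontr)
  interpret Metric_space "points A" "adist A" by (rule Metric_space_cont)
  assume "f \<notin> S"
  moreover have "closedin mtopology S" using S by (simp add: closed_star_subalgebra_def)
  ultimately obtain r where r: "r > 0" "disjnt S (mball f r)"
    using f unfolding closedin_metric by blast
  then obtain g where "g \<in> S" "adist A f g < r" using approx by blast
  moreover have "S \<subseteq> points A" using S by (simp add: closed_star_subalgebra_def)
  ultimately have "g \<in> mball f r" using f by (auto simp: in_mball simp del: cont_simps(1))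
  then show False using r \<open>g \<in> S\<close> by (auto simp: disjnt_def)
qed

text \<open>The ramps are recovered from the coordinates and separate points, so Stone-Weierstrass
  gives all real functions. A complex function is split into its real and imaginary parts.\<close>

lemma zigzag_generates:
  assumes S: "closed_star_subalgebra K A S" and gen: "\<And>i. unit_fun (coordinate \<delta> i) \<in> S"
  shows "S = points A"
proof -
  have alg: "\<And>f g. f \<in> S \<Longrightarrow> g \<in> S \<Longrightarrow> vadd A f g \<in> S" "\<And>f g. f \<in> S \<Longrightarrow> g \<in> S \<Longrightarrow> amult A f g \<in> S"
    "\<And>f c. f \<in> S \<Longrightarrow> c \<in> K \<Longrightarrow> vscale A c f \<in> S"
    and sub: "S \<subseteq> points A"
    using S unfolding closed_star_subalgebra_def by blast+
  define R where "R = {g. continuous_on {0..1} g \<and> unit_fun g \<in> S}"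
  \<comment> \<open>All other coordinates vanish at 0, so the unit has to be a special
    point.\<close>
  have one: "unit_fun (\<lambda>t. 1) \<in> S"
    using gen[of 0] by (simp add: coordinate_def[abs_def])
  have ramp: "ramp n \<in> R" for n
  proof (cases "\<delta> n = 0")
    case True
    then have "coordinate \<delta> (2 * n + 1) = ramp n" by (auto simp: coordinate_def fun_eq_iff)
    then show ?thesis using gen[of "2 * n + 1"] by (simp add: R_def continuous_ramp)
  next
    case False
    \<comment> \<open>Division by \<open>\<delta> n\<close> turns the small coordinate into
      \<open>zigzag r - r\<close>, the difference between the first coordinate and the ramp.\<close>
    have "ramp n = (\<lambda>t. coordinate \<delta> (2 * n + 1) t + (- 1 / \<delta> n) * coordinate \<delta> (2 * n + 2) t)"
      using False by (auto simp: coordinate_def Let_def fun_eq_iff)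
    then have "unit_fun (ramp n) = vadd A (unit_fun (coordinate \<delta> (2 * n + 1)))
        (vscale A (complex_of_real (- 1 / \<delta> n)) (unit_fun (coordinate \<delta> (2 * n + 2))))"
      unfolding unit_fun_algebra by simp
    then have "unit_fun (ramp n) \<in> S" by (simp only: alg gen scalars_simps)
    then show ?thesis by (simp add: R_def continuous_ramp)
  qed
  interpret function_ring_on R "{0..1}"
  proof
    show "(\<lambda>t. f t + g t) \<in> R" "(\<lambda>t. f t * g t) \<in> R" if "f \<in> R" "g \<in> R" for f g
      using that alg(1,2)[of "unit_fun f" "unit_fun g"]
      by (auto simp: R_def unit_fun_algebra simp del: cont_simps intro!: continuous_intros)
    show "(\<lambda>_. c) \<in> R" for c
      using alg(3)[OF one, of "complex_of_real c"] by (simp add: R_def unit_fun_algebra del: cont_simps)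
    show "\<exists>f\<in>R. f x \<noteq> f y" if xy: "x \<in> {0..1}" "y \<in> {0..1}" "x \<noteq> y" for x y
    proof -
      obtain n where "ramp n x \<noteq> ramp n y"
        using ramp_separates[of x y] ramp_separates[of y x] xy
        by (metis atLeastAtMost_iff less_irrefl linorder_neqE)
      then show ?thesis using ramp by blast
    qed
  qed (auto simp: R_def)
  have real: "unit_fun g \<in> S" if g: "continuous_on {0..1} g" for g
  proof (rule closed_star_subalgebra_limit[OF S unit_fun_mem[OF g]])
    fix e :: real assume "e > 0"
    then obtain h where h: "h \<in> R" "\<And>x. x \<in> {0..1} \<Longrightarrow> \<bar>g x - h x\<bar> < e / 2"
      using Stone_Weierstrass_basic[OF g, of "e / 2"] by auto
    have mem: "unit_fun h \<in> points A" using h(1) sub by (auto simp: R_def simp del: cont_simps)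
    have "adist A (unit_fun g) (unit_fun h) \<le> e / 2"
      unfolding cont_adist[OF unit_fun_mem[OF g] mem]
    proof (rule cont_norm_least)
      fix t :: real assume t: "t \<in> {0..1}"
      have "cmod (unit_fun g t - unit_fun h t) = \<bar>g t - h t\<bar>"
        using t unfolding unit_fun_def by (simp flip: of_real_diff)
      then show "cmod (unit_fun g t - unit_fun h t) \<le> e / 2" using h(2)[OF t] by simp
    qed
    then show "\<exists>h\<in>S. adist A (unit_fun g) h < e"
      using h(1) \<open>e > 0\<close> by (intro bexI[of _ "unit_fun h"]) (auto simp: R_def)
  qed
  have "f \<in> S" if f: "f \<in> points A" for f
  proof (cases "K = UNIV")
    case True
    have "unit_fun (\<lambda>t. Re (f t)) \<in> S" "unit_fun (\<lambda>t. Im (f t)) \<in> S"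
      using f by (auto intro!: real continuous_intros)
    then have "vadd A (unit_fun (\<lambda>t. Re (f t))) (vscale A \<i> (unit_fun (\<lambda>t. Im (f t)))) \<in> S"
      using True by (intro alg) auto
    moreover have "vadd A (unit_fun (\<lambda>t. Re (f t))) (vscale A \<i> (unit_fun (\<lambda>t. Im (f t)))) = f"
      using f by (auto simp: unit_fun_def complex_eq_iff)
    ultimately show ?thesis by simp
  next
    case False
    then have "K = \<real>" using scalars by blast
    then have "unit_fun (\<lambda>t. Re (f t)) = f"
      using f by (auto simp: unit_fun_def)
    moreover have "unit_fun (\<lambda>t. Re (f t)) \<in> S"
      using f by (auto intro!: real continuous_intros)
    ultimately show ?thesis by simp
  qed
  then show ?thesis using sub by blast
qed

lemma zigzag_computable_presentation:
  assumes T: "\<And>n a b. recursive n a \<Longrightarrow> recursive n b \<Longrightarrow> decidable n (\<lambda>xs. T (a xs) (b xs))"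
  shows "computable_presentation_of K A (zigzag_presentation K (delta T))"
  unfolding computable_presentation_of_def presentation_of_def
proof (intro conjI allI impI)
  show "cstar_algebra K A" by (rule cstar_algebra_cont)
  show "special (zigzag_presentation K (delta T)) `
      {i. enat i < num_special (zigzag_presentation K (delta T))} \<subseteq> points A"
    using unit_fun_mem[OF continuous_coordinate] by (auto simp del: cont_simps)
  fix S
  assume "closed_star_subalgebra K A S \<and> special (zigzag_presentation K (delta T)) `
      {i. enat i < num_special (zigzag_presentation K (delta T))} \<subseteq> S"
  then show "S = points A" by (intro zigzag_generates[of S "delta T"]) auto
qed (use norm_computable[OF T] in auto)

section \<open>Automorphisms of the algebra\<close>

text \<open>
  Evaluation of \<open>\<phi>\<close> at \<open>t\<close> is evaluation at \<open>s = \<phi> id t\<close>: if \<open>\<phi> f t = c \<noteq> f s\<close>, then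
  \<open>|f - c|^2 + (id - s)^2\<close> is invertible, although its image vanishes at \<open>t\<close>.
\<close>

lemma automorphism_composition:
  assumes hom: "star_hom K A A \<phi>" and bij: "bij_betw \<phi> (points A) (points A)"
  obtains h where "continuous_on {0..1} h" "inj_on h {0..1}"
    "\<And>t. t \<in> {0..1} \<Longrightarrow> h t \<in> {0..1}"
    "\<And>f t. f \<in> points A \<Longrightarrow> t \<in> {0..1} \<Longrightarrow> \<phi> f t = f (h t)"
proof -
  note [simp del] = cont_simps(1)
  have closed: "\<phi> f \<in> points A" if "f \<in> points A" for f
    using hom that unfolding star_hom_def by blast
  have hom_simps:
    "\<And>f t. f \<in> points A \<Longrightarrow> \<phi> (\<lambda>t. cnj (f t)) t = cnj (\<phi> f t)"
    "\<And>f c t. f \<in> points A \<Longrightarrow> c \<in> K \<Longrightarrow> \<phi> (\<lambda>t. c * f t) t = c * \<phi> f t"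
    "\<And>f g t. f \<in> points A \<Longrightarrow> g \<in> points A \<Longrightarrow> \<phi> (\<lambda>t. f t + g t) t = \<phi> f t + \<phi> g t"
    "\<And>f g t. f \<in> points A \<Longrightarrow> g \<in> points A \<Longrightarrow> \<phi> (\<lambda>t. f t * g t) t = \<phi> f t * \<phi> g t"
    using hom unfolding star_hom_def by simp_all
  let ?one = "unit_fun (\<lambda>t. 1)" and ?id = "unit_fun (\<lambda>t. t)"
  have mem: "?one \<in> points A" "?id \<in> points A"
    by (intro unit_fun_mem continuous_intros)+
  have surj: "\<exists>f\<in>points A. \<phi> f = g" if "g \<in> points A" for g
    using bij_betw_imp_surj_on[OF bij] that by (metis imageE)
  \<comment> \<open>A homomorphism is not assumed to be unital. By surjectivity 1 has a preimage
    \<open>f\<close>, and applying \<phi> to 1 * f = f gives the claim.\<close>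
  have one: "\<phi> ?one t = 1" if t: "t \<in> {0..1}" for t
  proof -
    obtain f where f: "f \<in> points A" "\<phi> f = ?one" using surj[OF mem(1)] by blast
    have "(\<lambda>t. ?one t * f t) = f"
      using f(1) by (auto simp: unit_fun_def cont_simps(1))
    then have "?one t = \<phi> ?one t * ?one t"
      using hom_simps(4)[OF mem(1) f(1), of t] f(2) by simp
    then show ?thesis using t by (simp add: unit_fun_def)
  qed
  define h where "h t = Re (\<phi> ?id t)" for t
  \<comment> \<open>The image of a self-adjoint element is self-adjoint, hence real-valued.\<close>
  have id: "\<phi> ?id t = complex_of_real (h t)" for t
  proof -
    have "(\<lambda>t. cnj (?id t)) = ?id" by (auto simp: unit_fun_def)
    then have "cnj (\<phi> ?id t) = \<phi> ?id t" using hom_simps(1)[OF mem(2), of t] by simp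
    then show ?thesis unfolding h_def by (simp add: complex_eq_iff)
  qed
  have eval: "h t \<in> {0..1} \<and> \<phi> f t = f (h t)" if f: "f \<in> points A" and t: "t \<in> {0..1}" for f t
  proof (rule ccontr)
    assume neg: "\<not> (h t \<in> {0..1} \<and> \<phi> f t = f (h t))"
    define c where "c = \<phi> f t"
    have c: "- c \<in> K"
      using closed[OF f] t scalars_closed(3)[OF scalars_simps(1), of c] by (simp add: c_def cont_simps(1))
    have s: "- complex_of_real (h t) \<in> K" using scalars_simps(4)[of "- h t"] by simp
    define u where "u = (\<lambda>x. f x + - c * ?one x)"
    define w where "w = (\<lambda>x. ?id x + - complex_of_real (h t) * ?one x)"
    have um: "u \<in> points A" "(\<lambda>x. cnj (u x)) \<in> points A" "w \<in> points A"
      unfolding u_def w_def by (intro cont_closed f mem c s)+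
    define F where "F = (\<lambda>x. u x * cnj (u x) + w x * w x)"
    have Fm: "F \<in> points A" unfolding F_def by (intro cont_closed um)
    have "\<phi> u t = \<phi> f t + - c * \<phi> ?one t"
      unfolding u_def hom_simps(3)[OF f cont_closed(4)[OF mem(1) c]] hom_simps(2)[OF mem(1) c] ..
    moreover have "\<phi> w t = \<phi> ?id t + - complex_of_real (h t) * \<phi> ?one t"
      unfolding w_def hom_simps(3)[OF mem(2) cont_closed(4)[OF mem(1) s]] hom_simps(2)[OF mem(1) s] ..
    ultimately have "\<phi> u t = 0" "\<phi> w t = 0"
      using one[OF t] id by (simp_all add: c_def)
    then have F0: "\<phi> F t = 0"
      unfolding F_def using um by (simp add: hom_simps cont_closed)
    define G where "G = (\<lambda>x. (cmod (f x - c))\<^sup>2 + (x - h t)\<^sup>2)"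
    have FG: "F x = complex_of_real (G x)" if "x \<in> {0..1}" for x
    proof -
      have "u x = f x - c" "w x = complex_of_real (x - h t)"
        using that by (simp_all add: u_def w_def unit_fun_def)
      then show ?thesis
        unfolding F_def G_def of_real_add complex_norm_square by (simp add: power2_eq_square)
    qed
    have G: "G x > 0" if "x \<in> {0..1}" for x
    proof (rule ccontr)
      assume "\<not> G x > 0"
      then have "(cmod (f x - c))\<^sup>2 + (x - h t)\<^sup>2 = 0"
        using zero_le_power2[of "cmod (f x - c)"] zero_le_power2[of "x - h t"]
        unfolding G_def by linarith
      then have "x = h t" "f x = c" by (auto simp: sum_power2_eq_zero_iff)
      then show False using neg that by (simp add: c_def)
    qed
    have "continuous_on {0..1} G"
      unfolding G_def using f by (intro continuous_intros) (simp add: cont_simps(1))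
    then have inv: "unit_fun (\<lambda>x. 1 / G x) \<in> points A"
      using G by (intro unit_fun_mem continuous_intros) force+
    have "(\<lambda>x. F x * unit_fun (\<lambda>x. 1 / G x) x) = ?one"
    proof
      fix x
      show "F x * unit_fun (\<lambda>x. 1 / G x) x = ?one x"
        using FG[of x] G[of x] by (auto simp: unit_fun_def)
    qed
    then have "\<phi> ?one t = \<phi> F t * \<phi> (unit_fun (\<lambda>x. 1 / G x)) t"
      using hom_simps(4)[OF Fm inv, of t] by simp
    then show False using F0 one[OF t] by simp
  qed
  show ?thesis
  proof (rule that)
    show "continuous_on {0..1} h"
      unfolding h_def using closed[OF mem(2)] by (intro continuous_intros) (simp add: cont_simps(1))
    show "inj_on h {0..1}"
    proof (rule inj_onI)
      fix x y assume xy: "x \<in> {0..1}" "y \<in> {0..1}" "h x = h y"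
      \<comment> \<open>A preimage \<open>f\<close> of the identity function is a left inverse of
        \<open>h\<close>.\<close>
      obtain f where f: "f \<in> points A" "\<phi> f = ?id" using surj[OF mem(2)] by blast
      have "?id x = ?id y" using eval[OF f(1) xy(1)] eval[OF f(1) xy(2)] f(2) xy(3) by simp
      then show "x = y" using xy(1,2) by (simp add: unit_fun_def)
    qed
    show "h t \<in> {0..1}" if "t \<in> {0..1}" for t using eval[OF mem(1) that] by blast
    show "\<phi> f t = f (h t)" if "f \<in> points A" "t \<in> {0..1}" for f t using eval[OF that] by blast
  qed
qed

end

section \<open>Isomorphisms bound halting times\<close>

text \<open>The code of the variable with index \<open>2 * i + 1\<close>: the two inner pairs code 1
  and 0, the parts of the coefficient, and \<open>Inl j\<close> has the code \<open>2 * j\<close>.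
  Without zigzags this special point is \<open>ramp i\<close>.\<close>

definition ramp_code :: "nat \<Rightarrow> nat" where
  "ramp_code i = list_encode [prod_encode (prod_encode (prod_encode (2, 0), prod_encode (0, 0)),
     list_encode [2 * (2 * i + 1)])]"

lemma poly_of_ramp_code: "poly_of_code (ramp_code i) = [(1, [Inl (2 * i + 1)])]"
proof -
  have "sum_decode (2 * (2 * i + 1)) = Inl (2 * i + 1)" by (simp add: sum_decode_def)
  moreover have "coeff_of_code (prod_encode (prod_encode (2, 0), prod_encode (0, 0))) = 1"
    by (simp add: coeff_of_code_def rat_of_code_def int_decode_def sum_decode_def complex_eq_iff)
  ultimately show ?thesis
    unfolding poly_of_code_def ramp_code_def term_of_code_def list_encode_inverse by simp
qed

lemma recursive_ramp_code: "recursive n a \<Longrightarrow> recursive n (\<lambda>xs. ramp_code (a xs))"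
  unfolding ramp_code_def list_encode.simps by (intro code_intros)

text \<open>\<open>zigzag\<close> fixes 0 and 1, so the small coordinate vanishes at both ends of a
  segment, whatever the distance of the strands.\<close>

lemma place_endpoints: "place d n 0 = place 0 n 0" "place d n 1 = place 0 n 1"
  by (auto simp: place_def fun_eq_iff)

text \<open>Places with equal values of \<open>zigzag\<close> differ in the small coordinate
  only.\<close>

lemma place_close:
  assumes "zigzag r = zigzag r'" "r \<in> {0..1}" "r' \<in> {0..1}" "0 \<le> d"
  shows "\<bar>place d n r i - place d n r' i\<bar> \<le> d"
proof -
  have "d * (zigzag r - r) - d * (zigzag r' - r') = d * (r' - r)"
    using assms(1) by (simp add: algebra_simps)
  moreover have "\<bar>d * (r' - r)\<bar> \<le> d * 1"
    unfolding abs_mult using assms by (intro mult_mono) auto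
  ultimately show ?thesis using assms by (simp add: place_def)
qed

context real_or_complex
begin

lemma no_computable_isomorphism:
  "\<nexists>\<phi>. computable_isomorphism K (zigzag_presentation K (delta (\<lambda>_ _. False)))
     (zigzag_presentation K (delta halting_time)) \<phi>"
proof
  let ?P = "zigzag_presentation K (delta (\<lambda>_ _. False))"
  let ?\<delta> = "delta halting_time"
  let ?Q = "zigzag_presentation K ?\<delta>"
  assume "\<exists>\<phi>. computable_isomorphism K ?P ?Q \<phi>"
  then obtain \<phi> where hom: "star_hom K A A \<phi>" and bij: "bij_betw \<phi> (points A) (points A)"
    and comp: "\<exists>f. \<forall>p k. rational_code K ?P p \<longrightarrow> (\<exists>q. rec_eval f [p, k] q \<and> rational_code K ?Q q \<and>
      anorm A (vminus A (\<phi> (point_of_code ?P p)) (point_of_code ?Q q)) < 1 / 2 ^ k)"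
    unfolding computable_isomorphism_def computable_star_hom_def by auto
  obtain h where h: "continuous_on {0..1} h" "inj_on h {0..1}" "\<And>t. t \<in> {0..1} \<Longrightarrow> h t \<in> {0..1}"
      "\<And>f t. f \<in> points A \<Longrightarrow> t \<in> {0..1} \<Longrightarrow> \<phi> f t = f (h t)"
    using automorphism_composition[OF hom bij] by metis
  have ramp_point: "rational_code K ?P (ramp_code i)" "point_of_code ?P (ramp_code i) = unit_fun (ramp i)" for i
    by (auto simp: rational_code_def rational_poly_def poly_of_ramp_code point_of_code_def
        coordinate_def[abs_def] delta_def unit_fun_def)
  have ramp_mem: "unit_fun (ramp i) \<in> points A" for i
    by (rule unit_fun_mem[OF continuous_ramp])
  obtain f where f: "\<And>i k. \<exists>q. rec_eval f [ramp_code i, k] q \<and> rational_code K ?Q q \<and>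
      anorm A (vminus A (\<phi> (unit_fun (ramp i))) (point_of_code ?Q q)) < 1 / 2 ^ k"
    using comp ramp_point by metis
  then obtain F where F: "\<And>i k. rec_eval f [ramp_code i, k] (F i k)" "\<And>i k. rational_code K ?Q (F i k)"
      "\<And>i k. anorm A (vminus A (\<phi> (unit_fun (ramp i))) (point_of_code ?Q (F i k))) < 1 / 2 ^ k"
    by metis
  define V where "V q d n r = Re (poly_eval (place d n r) (poly_of_code q))" for q d n r
  have approx: "\<bar>ramp i (h t) - V (F i k) (?\<delta> n) n r\<bar> < 1 / 2 ^ k"
    if t: "t \<in> {0..1}" "\<And>j. coordinate ?\<delta> j t = place (?\<delta> n) n r j" for i k t n r
  proof -
    let ?q = "F i k"
    have rat: "rational_poly K \<infinity> (poly_of_code ?q)" using F(2) by (simp add: rational_code_def)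
    have qm: "point_of_code ?Q ?q \<in> points A"
      unfolding point_of_code_def by (rule poly_value_zigzag(1)[OF rat])
    have \<phi>m: "\<phi> (unit_fun (ramp i)) \<in> points A"
      using hom ramp_mem unfolding star_hom_def by blast
    have "\<phi> (unit_fun (ramp i)) t = complex_of_real (ramp i (h t))"
      unfolding h(4)[OF ramp_mem t(1)] using h(3)[OF t(1)] by (simp add: unit_fun_def)
    moreover have "Re (point_of_code ?Q ?q t) = V ?q (?\<delta> n) n r"
      unfolding point_of_code_def poly_value_zigzag(2)[OF rat t(1)] V_def t(2) ..
    ultimately have "ramp i (h t) - V ?q (?\<delta> n) n r = Re (\<phi> (unit_fun (ramp i)) t - point_of_code ?Q ?q t)"
      by simp
    then have "\<bar>ramp i (h t) - V ?q (?\<delta> n) n r\<bar> \<le> cmod (\<phi> (unit_fun (ramp i)) t - point_of_code ?Q ?q t)"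
      using abs_Re_le_cmod by metis
    also have "\<dots> \<le> anorm A (vminus A (\<phi> (unit_fun (ramp i))) (point_of_code ?Q ?q))"
      using cmod_le_cont_norm[OF cont_closed(2)[OF \<phi>m qm], of t] by simp
    also have "\<dots> < 1 / 2 ^ k" by (rule F(3))
    finally show ?thesis .
  qed
  have "recursive 2 (\<lambda>xs. F (xs ! 0) (xs ! 1))"
  proof -
    obtain c where c: "\<And>xs. length xs = 2 \<Longrightarrow> rec_eval c xs (ramp_code (xs ! 0))"
      using recursive_ramp_code[OF recursive_nth[of 0 2]] unfolding recursive_def by auto
    have "rec_eval (RComp f [c, RProj 1]) xs (F (xs ! 0) (xs ! 1))" if "length xs = 2" for xs
      by (rule rec_eval.comp[where ys = "[ramp_code (xs ! 0), xs ! 1]"])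
        (use that c F(1) rec_eval.proj[of 1 xs] in auto)
    then show ?thesis unfolding recursive_def by blast
  qed
  note recF = recursive_app2[OF this]
  \<comment> \<open>\<open>z\<close> codes the index \<open>i\<close> of a ramp and a precision
    \<open>k\<close>. The distance is set to 0, which by \<open>place_endpoints\<close> leaves the
    end values unchanged; both orders occur because \<open>h\<close> may reverse the interval. Let e
    = \<open>1 / 2 ^ k\<close>. With an error below e at each end, a true difference above 10e makes
    the test succeed at 8e, and success guarantees a true difference above 6e.\<close>
  define separated where "separated n z \<longleftrightarrow> (let k = snd (prod_decode z); q = F (fst (prod_decode z)) k in
      8 / 2 ^ k < V q 0 n 1 - V q 0 n 0 \<or> 8 / 2 ^ k < V q 0 n 0 - V q 0 n 1)" for n z
  have V_part: "V q 0 n (real r) = poly_part fst (place (real 0) n (real r)) q" for q n r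
    by (simp add: V_def poly_eval_parts)
  have dec: "decidable m (\<lambda>xs. separated (a xs) (b xs))" if "recursive m a" "recursive m b" for m a b
    unfolding separated_def Let_def V_part[of _ _ 0, unfolded of_nat_0] V_part[of _ _ 1, unfolded of_nat_1]
    by (intro rat_recursive_intros code_intros rat_recursive_poly_part recF that)
  have V_endpoints: "V q (?\<delta> n) n 0 = V q 0 n 0" "V q (?\<delta> n) n 1 = V q 0 n 1" for q n
    unfolding V_def place_endpoints[of "?\<delta> n"] by (rule refl)+
  have unit: "1 / 2 ^ m \<in> {0..1::real}" for m by simp
  have endpoints: "\<bar>ramp i (h (1 / 2 ^ Suc n)) - V (F i k) 0 n 0\<bar> < 1 / 2 ^ k"
      "\<bar>ramp i (h (1 / 2 ^ n)) - V (F i k) 0 n 1\<bar> < 1 / 2 ^ k" for i k n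
  proof -
    have "coordinate ?\<delta> j (1 / 2 ^ Suc n) = place (?\<delta> n) n 0 j" for j
      by (rule coordinate_eq_place; simp)
    from approx[OF unit this] show "\<bar>ramp i (h (1 / 2 ^ Suc n)) - V (F i k) 0 n 0\<bar> < 1 / 2 ^ k"
      unfolding V_endpoints .
    have "coordinate ?\<delta> j (1 / 2 ^ n) = place (?\<delta> n) n 1 j" for j
      by (rule coordinate_eq_place; simp)
    from approx[OF unit this] show "\<bar>ramp i (h (1 / 2 ^ n)) - V (F i k) 0 n 1\<bar> < 1 / 2 ^ k"
      unfolding V_endpoints .
  qed
  have ex: "\<exists>z. separated n z" for n
  proof -
    let ?a = "h (1 / 2 ^ Suc n)" and ?b = "h (1 / 2 ^ n)"
    note mem = unit[of "Suc n"] unit[of n]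
    have "?a \<noteq> ?b" using inj_onD[OF h(2) _ mem] by auto
    then obtain i where i: "ramp i ?a \<noteq> ramp i ?b"
      using ramp_separates[of ?a ?b] ramp_separates[of ?b ?a] h(3)[OF mem(1)] h(3)[OF mem(2)]
      by (metis atLeastAtMost_iff less_irrefl linorder_neqE)
    define d where "d = \<bar>ramp i ?b - ramp i ?a\<bar>"
    have "0 < d / 10" using i by (simp add: d_def)
    from real_arch_pow_inv[OF this, of "1 / 2"] obtain k where k: "1 / 2 ^ k < d / 10"
      by (auto simp: power_one_over)
    define e where "e = (1 / 2 ^ k :: real)"
    have "\<bar>ramp i ?a - V (F i k) 0 n 0\<bar> < e" "\<bar>ramp i ?b - V (F i k) 0 n 1\<bar> < e" "10 * e < d"
      using endpoints[of i n k] k by (simp_all add: e_def)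
    then have "8 * e < V (F i k) 0 n 1 - V (F i k) 0 n 0 \<or> 8 * e < V (F i k) 0 n 0 - V (F i k) 0 n 1"
      unfolding d_def by linarith
    then have "separated n (prod_encode (i, k))" by (simp add: separated_def e_def)
    then show ?thesis ..
  qed
  define z where "z n = (LEAST z. separated n z)" for n
  define k where "k n = snd (prod_decode (z n))" for n
  define i where "i n = fst (prod_decode (z n))" for n
  have "recursive 1 (\<lambda>xs. z (xs ! 0))"
    unfolding z_def by (intro recursive_Least dec ex recursive_tl recursive_hd recursive_nth) simp
  \<comment> \<open>This sum is what the estimate between strands needs: for the polynomial code q,
    \<open>q + k < s\<close> and \<open>q \<le> 2 ^ q\<close> give
    \<open>q / 2 ^ s \<le> 1 / 2 ^ k\<close>.\<close>
  then have "recursive 1 (\<lambda>xs. F (i (xs ! 0)) (k (xs ! 0)) + k (xs ! 0))"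
    unfolding i_def k_def by (intro code_intros recF)
  from halting_time_dominates[OF this] obtain n where n: "\<exists>s. halting_time n s"
      "\<And>s. halting_time n s \<Longrightarrow> F (i n) (k n) + k n < s"
    by blast
  define s where "s = (LEAST s. halting_time n s)"
  have s: "F (i n) (k n) + k n < s" unfolding s_def by (rule n(2)[OF LeastI_ex[OF n(1)]])
  have \<delta>: "?\<delta> n = 1 / 2 ^ s" using n(1) by (simp add: delta_def s_def)
  let ?q = "F (i n) (k n)" and ?e = "1 / 2 ^ k n :: real"
  have "separated n (z n)" unfolding z_def using ex by (rule LeastI_ex)
  then have sep: "8 * ?e < \<bar>V ?q 0 n 1 - V ?q 0 n 0\<bar>"
    by (auto simp: separated_def i_def k_def Let_def)
  define t where "t r = (1 + r) / 2 ^ Suc n" for r :: real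
  define g where "g r = ramp (i n) (h (t r))" for r
  have t: "t r \<in> {0..1}" if "r \<in> {0..1}" for r
  proof -
    have "(1::real) \<le> 2 ^ n" by simp
    then have "1 + r \<le> 2 * 2 ^ n" using that by (simp del: one_le_power)
    then show ?thesis using that by (simp add: t_def)
  qed
  \<comment> \<open>As \<open>\<delta> n\<close> is positive, the point with parameter
    \<open>r\<close> lies at the position \<open>r\<close> itself, which is
    \<open>t r\<close>.\<close>
  have close: "\<bar>g r - V ?q (?\<delta> n) n r\<bar> < ?e" if "r \<in> {0..1}" for r
    unfolding g_def
    by (rule approx[OF t[OF that]], rule coordinate_eq_place) (use that \<delta> in \<open>auto simp: t_def\<close>)
  \<comment> \<open>One \<open>?e\<close> comes from the strand distance and one from each of the
    two approximations.\<close>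
  have strands: "\<bar>g r - g r'\<bar> < 3 * ?e"
    if "r \<in> {0..1}" "r' \<in> {0..1}" "zigzag r = zigzag r'" for r r'
  proof -
    have "\<bar>V ?q (?\<delta> n) n r - V ?q (?\<delta> n) n r'\<bar> \<le>
        cmod (poly_eval (place (?\<delta> n) n r) (poly_of_code ?q) - poly_eval (place (?\<delta> n) n r') (poly_of_code ?q))"
      unfolding V_def minus_complex.simps(1)[symmetric] by (rule abs_Re_le_cmod)
    also have "\<dots> \<le> real ?q * ?\<delta> n"
      by (rule poly_eval_lipschitz)
        (use place_bound[OF delta_range] place_close that delta_range[of halting_time n] in auto)
    also have "\<dots> \<le> 2 ^ ?q * (1 / 2 ^ (?q + k n))"
      unfolding \<delta> using s of_nat_less_two_power[of ?q, where 'a = real]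
      by (intro mult_mono divide_left_mono power_increasing) auto
    also have "\<dots> = ?e" by (simp add: power_add)
    finally show ?thesis using close[OF that(1)] close[OF that(2)] by linarith
  qed
  \<comment> \<open>The four parameters are the ends and the turning points of the zigzag: its value
    is 0 at 0 and 3/4, and 1 at 1/4 and 1.\<close>
  have "\<bar>g 0 - g (3/4)\<bar> < 3 * ?e" "\<bar>g (1/4) - g 1\<bar> < 3 * ?e"
    by (rule strands; simp)+
  moreover have "6 * ?e < \<bar>g 1 - g 0\<bar>"
    using sep close[of 0] close[of 1] unfolding V_endpoints by (simp add: abs_if split: if_splits)
  moreover have "(g 0 \<le> g (1/4) \<and> g (1/4) \<le> g (3/4) \<and> g (3/4) \<le> g 1) \<or>
      (g 1 \<le> g (3/4) \<and> g (3/4) \<le> g (1/4) \<and> g (1/4) \<le> g 0)"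
  proof -
    \<comment> \<open>\<open>h\<close> is continuous and injective, hence strictly monotone. The
      ramp afterwards preserves only the weak order.\<close>
    have mono: "(h (t a) < h (t b) \<and> h (t b) < h (t c)) \<or> (h (t c) < h (t b) \<and> h (t b) < h (t a))"
      if "0 \<le> a" "a < b" "b < c" "c \<le> 1" for a b c
    proof (rule continuous_inj_imp_mono[where f = h])
      show "t a < t b" "t b < t c" using that by (simp_all add: t_def divide_strict_right_mono)
      have "{t a..t c} \<subseteq> {0..1}" using t[of a] t[of c] that by auto
      then show "continuous_on {t a..t c} h" "inj_on h {t a..t c}"
        using continuous_on_subset[OF h(1)] inj_on_subset[OF h(2)] by blast+
    qed
    have "(h (t 0) \<le> h (t (1/4)) \<and> h (t (1/4)) \<le> h (t (3/4)) \<and> h (t (3/4)) \<le> h (t 1)) \<or>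
      (h (t 1) \<le> h (t (3/4)) \<and> h (t (3/4)) \<le> h (t (1/4)) \<and> h (t (1/4)) \<le> h (t 0))"
      using mono[of 0 "1/4" "3/4"] mono[of "1/4" "3/4" 1] by auto
    then show ?thesis unfolding g_def using ramp_mono by blast
  qed
  \<comment> \<open>If \<open>g\<close> increases, \<open>g (1/4) \<le> g (3/4)\<close> makes the
    two jumps cover the whole range:
    \<open>g 1 - g 0 \<le> (g 1 - g (1/4)) + (g (3/4) - g 0)\<close>, which is below
    \<open>6 * ?e\<close>. The decreasing case is symmetric.\<close>
  ultimately show False by (auto simp: abs_if split: if_splits)
qed

end

theorem corollary4p7:
  fixes K :: "complex set"
  assumes "K = \<real> \<or> K = UNIV"
  shows "\<not> computably_categorical K (cont_unit_interval K)"
proof -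
  interpret real_or_complex K by unfold_locales (rule assms)
  have "computable_presentation_of K (cont_unit_interval K) (zigzag_presentation K (delta (\<lambda>_ _. False)))"
    by (intro zigzag_computable_presentation decidable_const)
  moreover have "computable_presentation_of K (cont_unit_interval K) (zigzag_presentation K (delta halting_time))"
    by (intro zigzag_computable_presentation decidable_halting_time)
  ultimately show ?thesis
    using no_computable_isomorphism unfolding computably_categorical_def by blast
qed

end
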